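(* Let $k\ge 1$, $n=k(k+1)/2$ and $\rho=\rho(k)$. If $(\alpha,\beta)$ is an $m$-Carter--Saxl pair of partitions of $n$, then $g(\rho,\rho,\alpha)\ge m$. In particular, for every framed staircase partition $\tau^{(a)}_{(1^b)}$ of $n$ (with $\tau$ a staircase partition and $a,b\ge 0$), one has $g(\rho,\rho,\tau^{(a)}_{(1^b)})>0$.
   Context: $\rho(j)=(j,j-1,\dots,2,1)$ denotes the $j$th staircase partition. $\chi^\lambda$ is the complex irreducible character of $\mathfrak S_n$ labelled by $\lambda$, and the Kronecker coefficient $g(\lambda,\mu,\nu)$ is the multiplicity of $\chi^\nu$ in $\chi^\lambda\chi^\mu$. Carter's criterion: a partition $\lambda=(\lambda_1,\lambda_2,\dots)$ (with $\lambda_i=0$ for large $i$) satisfies Carter's criterion if $\lambda_i-\lambda_{i+1}\equiv-1$ modulo $2^{\ell_2(\lambda_{i+1}-\lambda_{i+2})}$ for all $i\ge1$, where $\ell_2(a)$ is the least non-negative integer with $a<2^{\ell_2(a)}$. (Such partitions are $2$-regular, i.e. have distinct nonzero parts.) Let $\Bbbk$ be a field of characteristic $2$, $\mathbf S^\Bbbk(\alpha)$ the Specht module of $\Bbbk\mathfrak S_n$ labelled by $\alpha$ (James's convention), and for $\beta$ $2$-regular let $\mathbf D^\Bbbk(\beta)=\mathbf S^\Bbbk(\beta)/\operatorname{rad}\mathbf S^\Bbbk(\beta)$, a simple module. Let $d_{\alpha,\beta}=[\mathbf S^\Bbbk(\alpha):\mathbf D^\Bbbk(\beta)]$ be the composition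 multiplicity. A pair $(\alpha,\beta)$ of partitions of $n$ is an $m$-Carter--Saxl pair if $\beta$ satisfies Carter's criterion and $d_{\alpha,\beta}=m>0$. For $\tau=\rho(j)$ and partitions $\lambda,\mu$ with $\ell(\lambda)+\mu_1\le j+1$ ($\ell$ denotes the number of nonzero parts, ${}^T$ the conjugate), $\tau^\lambda_\mu=(\rho(j)+2\mu^T)^T+2\lambda$, with sums taken part by part. A framed staircase is a partition $\tau^{(a)}_{(1^b)}$ of this form, with $\lambda=(a)$ and $\mu=(1^b)$ (either of which may be empty). *)

theory Defs
  imports
    Complex_Main
    "HOL-Combinatorics.Permutations"
    "HOL-Library.Function_Algebras"
    "HOL-Library.Set_Algebras"
    "HOL-Number_Theory.Cong"
begin

section \<open>Partitions\<close>

text \<open>A partition is a function \<open>l :: nat \<Rightarrow> nat\<close>. Rows and columns are counted from 0, so \<open>l i\<close> is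
  the part usually written with index \<open>i + 1\<close>.\<close>

definition partitions :: "nat \<Rightarrow> (nat \<Rightarrow> nat) set" where
  "partitions n = {l. antimono l \<and> finite {i. l i \<noteq> 0} \<and> (\<Sum>i | l i \<noteq> 0. l i) = n}"

definition num_parts :: "(nat \<Rightarrow> nat) \<Rightarrow> nat" where
  "num_parts l = card {i. l i \<noteq> 0}"

definition conj_part :: "(nat \<Rightarrow> nat) \<Rightarrow> nat \<Rightarrow> nat" where
  "conj_part l j = card {i. j < l i}"

text \<open>Truncated subtraction supplies the trailing zeros.\<close>

definition staircase :: "nat \<Rightarrow> nat \<Rightarrow> nat" where
  "staircase k i = k - i"

definition row_part :: "nat \<Rightarrow> nat \<Rightarrow> nat" where
  "row_part a i = (if i = 0 then a else 0)"

definition col_part :: "nat \<Rightarrow> nat \<Rightarrow> nat" where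
  "col_part b i = (if i < b then 1 else 0)"

text \<open>The partition written \<open>\<tau>\<close> with upper index \<open>l\<close> and lower index \<open>m\<close>, where \<open>\<tau> = \<rho>(j)\<close>; it is
  meant only for \<open>num_parts l + m 0 \<le> j + 1\<close>.\<close>

definition staircase_frame :: "nat \<Rightarrow> (nat \<Rightarrow> nat) \<Rightarrow> (nat \<Rightarrow> nat) \<Rightarrow> nat \<Rightarrow> nat" where
  "staircase_frame j l m =
    (\<lambda>i. conj_part (\<lambda>r. staircase j r + 2 * conj_part m r) i + 2 * l i)"

definition ell2 :: "nat \<Rightarrow> nat" where
  "ell2 a = (LEAST l. a < 2 ^ l)"

definition carter :: "(nat \<Rightarrow> nat) \<Rightarrow> bool" where
  "carter l \<longleftrightarrow>
    (\<forall>i. [int (l i) - int (l (i + 1)) = -1] (mod 2 ^ ell2 (l (i + 1) - l (i + 2))))"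

lemma finite_partitions: "finite (partitions n)"
proof (rule finite_subset)
  show "partitions n \<subseteq> {l. \<forall>i. (i \<in> {..<n} \<longrightarrow> l i \<in> {..n}) \<and> (i \<notin> {..<n} \<longrightarrow> l i = 0)}"
  proof
    fix l assume "l \<in> partitions n"
    then have anti: "antimono l" and fin: "finite {i. l i \<noteq> 0}"
      and sum: "(\<Sum>i | l i \<noteq> 0. l i) = n"
      by (auto simp: partitions_def)
    have le: "l i \<le> n" for i
      using member_le_sum[of i "{i. l i \<noteq> 0}" l] fin sum by (cases "l i = 0") auto
    have zero: "l i = 0" if "n \<le> i" for i
    proof (rule ccontr)
      assume "l i \<noteq> 0"
      then have sub: "{..i} \<subseteq> {i. l i \<noteq> 0}"
        using anti by (force simp: antimono_def)
      have "i + 1 = (\<Sum>r\<le>i. 1)" by simp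
      also have "\<dots> \<le> (\<Sum>r\<le>i. l r)"
        by (intro sum_mono) (use sub in \<open>force simp: Suc_le_eq\<close>)
      also have "\<dots> \<le> n"
        unfolding sum[symmetric] by (rule sum_mono2[OF fin sub]) simp
      finally show False using that by simp
    qed
    show "l \<in> {l. \<forall>i. (i \<in> {..<n} \<longrightarrow> l i \<in> {..n}) \<and> (i \<notin> {..<n} \<longrightarrow> l i = 0)}"
      using le zero by auto
  qed
  show "finite {l. \<forall>i. (i \<in> {..<n} \<longrightarrow> l i \<in> {..n}) \<and> (i \<notin> {..<n} \<longrightarrow> l i = (0::nat))}"
    by (rule finite_set_of_finite_funs) auto
qed


section \<open>Modules over the group algebra of the symmetric group\<close>

text \<open>The symmetric group is \<open>{p. p permutes {1..n}}\<close>. A tabloid, i.e. a row equivalence class of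
  tableaux, is encoded by the function sending \<open>i\<close> to the set of entries in row \<open>i\<close>. All modules
  are subquotients \<open>V / U\<close> of the space of functions from tabloids to the field, a function
  standing for the formal linear combination of tabloids with these coefficients.\<close>

type_synonym tabloid = "nat \<Rightarrow> nat set"

definition fscale :: "'k::field \<Rightarrow> ('t \<Rightarrow> 'k) \<Rightarrow> 't \<Rightarrow> 'k" where
  "fscale c f = (\<lambda>x. c * f x)"

interpretation fun_vs: vector_space "fscale :: 'k::field \<Rightarrow> ('t \<Rightarrow> 'k) \<Rightarrow> 't \<Rightarrow> 'k"
  by unfold_locales (auto simp: fscale_def algebra_simps)

definition tabloid_act :: "(nat \<Rightarrow> nat) \<Rightarrow> tabloid \<Rightarrow> tabloid" where
  "tabloid_act p T = (\<lambda>i. p ` T i)"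

text \<open>The linear extension of \<open>tabloid_act\<close>: the indicator function of \<open>T\<close> is sent to that of
  \<open>tabloid_act p T\<close>.\<close>

definition act :: "(nat \<Rightarrow> nat) \<Rightarrow> (tabloid \<Rightarrow> 'k::field) \<Rightarrow> tabloid \<Rightarrow> 'k" where
  "act p f = (\<lambda>T. f (tabloid_act (inv p) T))"

definition submodule :: "nat \<Rightarrow> (tabloid \<Rightarrow> 'k::field) set \<Rightarrow> bool" where
  "submodule n U \<longleftrightarrow> fun_vs.subspace U \<and> (\<forall>p. p permutes {1..n} \<longrightarrow> act p ` U \<subseteq> U)"

text \<open>Equivalently, \<open>V / U\<close> is a simple module.\<close>

definition maximal_submodule ::
    "nat \<Rightarrow> (tabloid \<Rightarrow> 'k::field) set \<Rightarrow> (tabloid \<Rightarrow> 'k) set \<Rightarrow> bool" where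
  "maximal_submodule n U V \<longleftrightarrow> submodule n U \<and> submodule n V \<and> U \<subset> V \<and>
    (\<forall>W. submodule n W \<and> U \<subseteq> W \<and> W \<subseteq> V \<longrightarrow> W = U \<or> W = V)"

definition radical :: "nat \<Rightarrow> (tabloid \<Rightarrow> 'k::field) set \<Rightarrow> (tabloid \<Rightarrow> 'k) set" where
  "radical n V = V \<inter> \<Inter>{U. maximal_submodule n U V}"

text \<open>The cosets making up \<open>V / U\<close>. Elementwise addition of sets is the addition of cosets; the
  summand \<open>U\<close> below only matters for the scalar 0, where the image of a coset is \<open>{0}\<close>.\<close>

definition cosets :: "(tabloid \<Rightarrow> 'k::field) set \<Rightarrow> (tabloid \<Rightarrow> 'k) set \<Rightarrow> (tabloid \<Rightarrow> 'k) set set" where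
  "cosets V U = (\<lambda>v. v +o U) ` V"

definition quotient_iso :: "nat \<Rightarrow> (tabloid \<Rightarrow> 'k::field) set \<Rightarrow> (tabloid \<Rightarrow> 'k) set \<Rightarrow>
    (tabloid \<Rightarrow> 'k) set \<Rightarrow> (tabloid \<Rightarrow> 'k) set \<Rightarrow> bool" where
  "quotient_iso n V U V' U' \<longleftrightarrow>
    (\<exists>h. bij_betw h (cosets V U) (cosets V' U') \<and>
      (\<forall>A\<in>cosets V U. \<forall>B\<in>cosets V U. h (A + B) = h A + h B) \<and>
      (\<forall>c. \<forall>A\<in>cosets V U. h (fscale c ` A + U) = fscale c ` h A + U') \<and>
      (\<forall>p. p permutes {1..n} \<longrightarrow> (\<forall>A\<in>cosets V U. h (act p ` A) = act p ` h A)))"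

definition composition_series ::
    "nat \<Rightarrow> (tabloid \<Rightarrow> 'k::field) set \<Rightarrow> (tabloid \<Rightarrow> 'k) set list \<Rightarrow> bool" where
  "composition_series n V Us \<longleftrightarrow> Us \<noteq> [] \<and> hd Us = {0} \<and> last Us = V \<and>
    (\<forall>i. Suc i < length Us \<longrightarrow> maximal_submodule n (Us ! i) (Us ! Suc i))"

text \<open>The multiplicity of the simple module \<open>A / B\<close> as a composition factor of \<open>V\<close>; by the
  Jordan--Hoelder theorem the choice of the series is immaterial.\<close>

definition composition_mult :: "nat \<Rightarrow> (tabloid \<Rightarrow> 'k::field) set \<Rightarrow>
    (tabloid \<Rightarrow> 'k) set \<Rightarrow> (tabloid \<Rightarrow> 'k) set \<Rightarrow> nat" where
  "composition_mult n V A B =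
    (let Us = (SOME Us. composition_series n V Us)
     in card {i. Suc i < length Us \<and> quotient_iso n (Us ! Suc i) (Us ! i) A B})"


section \<open>Specht modules and decomposition numbers\<close>

definition diagram :: "(nat \<Rightarrow> nat) \<Rightarrow> (nat \<times> nat) set" where
  "diagram l = {(i, j). j < l i}"

definition tableau :: "nat \<Rightarrow> (nat \<Rightarrow> nat) \<Rightarrow> (nat \<times> nat \<Rightarrow> nat) \<Rightarrow> bool" where
  "tableau n l t \<longleftrightarrow> bij_betw t (diagram l) {1..n}"

definition tabloid_of :: "(nat \<Rightarrow> nat) \<Rightarrow> (nat \<times> nat \<Rightarrow> nat) \<Rightarrow> tabloid" where
  "tabloid_of l t = (\<lambda>i. {t (i, j) | j. (i, j) \<in> diagram l})"

definition column_stabilizer ::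
    "nat \<Rightarrow> (nat \<Rightarrow> nat) \<Rightarrow> (nat \<times> nat \<Rightarrow> nat) \<Rightarrow> (nat \<Rightarrow> nat) set" where
  "column_stabilizer n l t = {p. p permutes {1..n} \<and>
    (\<forall>j. p ` {t (i, j) | i. (i, j) \<in> diagram l} = {t (i, j) | i. (i, j) \<in> diagram l})}"

text \<open>The signed column sum of \<open>t\<close> applied to the tabloid of \<open>t\<close>.\<close>

definition polytabloid ::
    "nat \<Rightarrow> (nat \<Rightarrow> nat) \<Rightarrow> (nat \<times> nat \<Rightarrow> nat) \<Rightarrow> tabloid \<Rightarrow> 'k::field" where
  "polytabloid n l t = (\<lambda>T. \<Sum>p\<in>column_stabilizer n l t.
    of_int (sign p) * (if T = tabloid_act p (tabloid_of l t) then 1 else 0))"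

definition specht :: "nat \<Rightarrow> (nat \<Rightarrow> nat) \<Rightarrow> (tabloid \<Rightarrow> 'k::field) set" where
  "specht n l = fun_vs.span {polytabloid n l t | t. tableau n l t}"

text \<open>The multiplicity of \<open>D(\<beta>) = S(\<beta>) / rad S(\<beta>)\<close> in \<open>S(\<alpha>)\<close> over the field \<open>'k\<close>.\<close>

definition decomposition_number ::
    "'k::field itself \<Rightarrow> nat \<Rightarrow> (nat \<Rightarrow> nat) \<Rightarrow> (nat \<Rightarrow> nat) \<Rightarrow> nat" where
  "decomposition_number _ n \<alpha> \<beta> = composition_mult n (specht n \<alpha> :: (tabloid \<Rightarrow> 'k) set)
    (specht n \<beta>) (radical n (specht n \<beta>))"

definition carter_saxl_pair ::
    "'k::field itself \<Rightarrow> nat \<Rightarrow> nat \<Rightarrow> (nat \<Rightarrow> nat) \<Rightarrow> (nat \<Rightarrow> nat) \<Rightarrow> bool" where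
  "carter_saxl_pair K n m \<alpha> \<beta> \<longleftrightarrow> \<alpha> \<in> partitions n \<and> \<beta> \<in> partitions n \<and> carter \<beta> \<and>
    decomposition_number K n \<alpha> \<beta> = m \<and> m > 0"


section \<open>Characters and Kronecker coefficients\<close>

text \<open>Trace of an endomorphism \<open>f\<close> of the finite-dimensional subspace \<open>V\<close>.\<close>

definition trace_on :: "('t \<Rightarrow> 'k::field) set \<Rightarrow> (('t \<Rightarrow> 'k) \<Rightarrow> 't \<Rightarrow> 'k) \<Rightarrow> 'k" where
  "trace_on V f = (let B = (SOME B. fun_vs.independent B \<and> fun_vs.span B = V)
     in \<Sum>b\<in>B. fun_vs.representation B (f b) b)"

definition irr_char :: "nat \<Rightarrow> (nat \<Rightarrow> nat) \<Rightarrow> (nat \<Rightarrow> nat) \<Rightarrow> complex" where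
  "irr_char n l p = trace_on (specht n l) (act p)"

text \<open>The multiplicities of the irreducible characters in a character \<open>\<psi>\<close>; the function \<open>c\<close> is
  unique because irreducible characters are linearly independent.\<close>

definition char_mult :: "nat \<Rightarrow> ((nat \<Rightarrow> nat) \<Rightarrow> complex) \<Rightarrow> (nat \<Rightarrow> nat) \<Rightarrow> nat" where
  "char_mult n \<psi> = (THE c. (\<forall>l. l \<notin> partitions n \<longrightarrow> c l = 0) \<and>
    (\<forall>p. p permutes {1..n} \<longrightarrow> \<psi> p = (\<Sum>l\<in>partitions n. of_nat (c l) * irr_char n l p)))"

definition kronecker ::
    "nat \<Rightarrow> (nat \<Rightarrow> nat) \<Rightarrow> (nat \<Rightarrow> nat) \<Rightarrow> (nat \<Rightarrow> nat) \<Rightarrow> nat" where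
  "kronecker n l m v = char_mult n (\<lambda>p. irr_char n l p * irr_char n m p) v"

end

theory Submission
  imports Defs "HOL-Combinatorics.Cycles"
begin

text \<open>In characteristic two a polytabloid is the indicator function of the tabloids that meet every column
  as the diagram does, and the Garnir relations cut out the Specht module inside the permutation module. More
  generally, the indicator function of the tabloids meeting the members of a fixed set partition in
  prescribed numbers satisfies the Garnir relations as soon as these numbers satisfy Carter's congruences
  down each column, because the binomial coefficients that occur are then even.

  If \<open>\<beta>\<close> satisfies Carter's criterion, this applies to the intersection numbers of a tabloid with its columnwise
  reversal. They form a symmetric matrix, so they define a self-adjoint idempotent with image
  \<open>S(\<beta>)\<close>; hence \<open>S(\<beta>)\<close> has trivial intersection with its orthogonal space and is simple.
  For the staircase \<open>\<rho>\<close> the Specht module is moreover projective, and the indicator function of every single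
  tabloid is the pointwise product of two elements of \<open>S(\<rho>)\<close>.

  Summing \<open>v\<^sub>1 \<otimes> v\<^sub>2 \<otimes> x\<close> over the group, for \<open>v\<^sub>1, v\<^sub>2 \<in> S(\<rho>)\<close> and \<open>x \<in> U \<subseteq> S(\<alpha>)\<close>, gives a space whose dimension
  grows at every factor of a composition series of \<open>S(\<alpha>)\<close> that is isomorphic to \<open>S(\<beta>)\<close>: an
  equivariant family in \<open>S(\<beta>)\<close> indexed by the tabloids of shape \<open>\<rho>\<close> (cut \<open>\<beta>\<close> into horizontal strips
  of sizes \<open>k, k - 1, \<dots>, 1\<close>) provides a nonzero sum. For a framed staircase such a family exists in \<open>S(\<alpha>)\<close>
  itself, so no decomposition number is needed. Finally, for \<open>U = S(\<alpha>)\<close> the space is spanned by vectors with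
  integer coordinates, so its dimension over the field of characteristic two is at most the dimension over the
  complex numbers, which is the Kronecker coefficient because it is the trace of an averaging
  idempotent.\<close>

text \<open>The Kronecker coefficient is a dimension of invariants, but invariants reduce badly:
  their dimension can be larger in characteristic two than over the complex numbers, the wrong
  direction for a lower bound. The image of the norm, the undivided sum over the group, is spanned
  by integer vectors, so its dimension can only drop under reduction. The price is that norms in
  characteristic two tend to vanish. Projectivity of S(\<rho>) prevents this, and since pointwise
  products reach every function on tabloids of shape \<rho>, every nonzero equivariant map from this
  permutation module is detected by a norm. Cutting \<beta> into strips of sizes k, ..., 1 supplies
  such a map into S(\<beta>); it is possible because Carter's criterion forces distinct parts.
  Simplicity of S(\<beta>) identifies D(\<beta>) with S(\<beta>), and the annihilator in the group
  algebra carries a nonvanishing norm over to each isomorphic composition factor.\<close>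

lemma sum_fun_apply: "(\<Sum>x\<in>A. f x) y = (\<Sum>x\<in>A. f x y)"
  by (induction A rule: infinite_finite_induct) auto

section \<open>Tabloids, polytabloids and James's combinatorial lemma over an arbitrary
  field\<close>

section \<open>Partitions and tableaux\<close>

lemma part_antimono: "l \<in> partitions n \<Longrightarrow> i \<le> j \<Longrightarrow> l j \<le> l i"
  by (auto simp: partitions_def antimono_def)

lemma part_zero:
  assumes "l \<in> partitions n" "n \<le> i"
  shows "l i = 0"
proof (rule ccontr)
  assume nz: "l i \<noteq> 0"
  have fin: "finite {i. l i \<noteq> 0}" and sum: "(\<Sum>i | l i \<noteq> 0. l i) = n"
    using assms by (auto simp: partitions_def)
  have pos: "l r \<noteq> 0" if "r \<le> i" for r
    using part_antimono[OF assms(1) that] nz by simp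
  then have sub: "{..i} \<subseteq> {i. l i \<noteq> 0}" by auto
  have "i + 1 = (\<Sum>r\<le>i. 1)" by simp
  also have "\<dots> \<le> (\<Sum>r\<le>i. l r)"
    by (intro sum_mono) (use pos in \<open>simp add: Suc_le_eq\<close>)
  also have "\<dots> \<le> n"
    unfolding sum[symmetric] by (rule sum_mono2[OF fin sub]) simp
  finally show False using assms by simp
qed

lemma part_sum:
  assumes "l \<in> partitions n" "n \<le> N"
  shows "(\<Sum>i<N. l i) = n"
proof -
  have "(\<Sum>i | l i \<noteq> 0. l i) = (\<Sum>i<N. l i)"
  proof (rule sum.mono_neutral_left)
    show "{i. l i \<noteq> 0} \<subseteq> {..<N}"
      using part_zero[OF assms(1)] assms(2) by (metis (mono_tags) lessThan_iff linorder_not_le mem_Collect_eq order_trans subsetI)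
  qed auto
  then show ?thesis using assms(1) by (auto simp: partitions_def)
qed

lemma part_le:
  assumes "l \<in> partitions n"
  shows "l i \<le> n"
proof (cases "i < n")
  case True
  then have "l i \<le> (\<Sum>i<n. l i)" by (intro member_le_sum) auto
  then show ?thesis using part_sum[OF assms order_refl] by simp
qed (use part_zero[OF assms] in simp)

lemma partitionsI:
  assumes "\<And>i. l (Suc i) \<le> l i" "\<And>i. N \<le> i \<Longrightarrow> l i = 0" "(\<Sum>i<N. l i) = n"
  shows "l \<in> partitions n"
proof -
  have sub: "{i. l i \<noteq> 0} \<subseteq> {..<N}"
  proof
    fix i assume "i \<in> {i. l i \<noteq> 0}"
    then show "i \<in> {..<N}" using assms(2)[of i] by (cases "N \<le> i") simp_all
  qed
  have "(\<Sum>i | l i \<noteq> 0. l i) = (\<Sum>i<N. l i)"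
    by (rule sum.mono_neutral_left) (use sub in auto)
  moreover have "finite {i. l i \<noteq> 0}" using sub by (rule finite_subset) simp
  ultimately show ?thesis using assms
    by (auto simp: partitions_def decseq_Suc_iff)
qed

lemma less_conj_part:
  assumes "l \<in> partitions n"
  shows "i < conj_part l j \<longleftrightarrow> j < l i"
proof -
  have "{i. j < l i} \<subseteq> {..<n}" using part_zero[OF assms] by (metis (mono_tags) lessThan_iff linorder_not_le mem_Collect_eq not_less_zero subsetI)
  then have fin: "finite {i. j < l i}" using finite_subset by blast
  have down: "i' \<in> {i. j < l i}" if "i \<in> {i. j < l i}" "i' \<le> i" for i i'
    using part_antimono[OF assms that(2)] that(1) by simp
  have "{i. j < l i} = {..<conj_part l j}"
  proof (cases "{i. j < l i} = {}")
    case False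
    define m where "m = Max {i. j < l i}"
    have "m \<in> {i. j < l i}" unfolding m_def using fin False by (rule Max_in)
    moreover have "i \<le> m" if "i \<in> {i. j < l i}" for i
      unfolding m_def using fin that by (rule Max_ge)
    ultimately have "{i. j < l i} = {..m}"
      using down by blast
    then show ?thesis by (simp add: conj_part_def lessThan_Suc_atMost)
  qed (simp add: conj_part_def)
  then show ?thesis by auto
qed

lemma conj_part_eq:
  assumes "\<And>i. j < l i \<longleftrightarrow> i < c"
  shows "conj_part l j = c"
proof -
  have "{i. j < l i} = {..<c}" using assms by auto
  then show ?thesis by (simp add: conj_part_def)
qed

lemma conj_part_zero:
  assumes "l \<in> partitions n" "n \<le> j"
  shows "conj_part l j = 0"
  using less_conj_part[OF assms(1), of 0 j] part_le[OF assms(1), of 0] assms(2)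
  by (meson leD le_trans not_gr_zero)

lemma diagram_Sigma:
  assumes "l \<in> partitions n"
  shows "diagram l = (SIGMA i:{..<n}. {..<l i})"
  using part_zero[OF assms] by (auto simp: diagram_def) (metis linorder_not_le not_less_zero)

lemma finite_diagram: "l \<in> partitions n \<Longrightarrow> finite (diagram l)"
  by (simp add: diagram_Sigma)

lemma card_diagram: "l \<in> partitions n \<Longrightarrow> card (diagram l) = n"
  by (simp add: diagram_Sigma part_sum)

lemma tableau_exists:
  assumes "l \<in> partitions n"
  shows "\<exists>t. tableau n l t"
  unfolding tableau_def
  by (rule finite_same_card_bij) (simp_all add: finite_diagram[OF assms] card_diagram[OF assms])

lemma tableau_in: "tableau n l t \<Longrightarrow> j < l i \<Longrightarrow> t (i, j) \<in> {1..n}"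
  by (auto simp: tableau_def bij_betw_def diagram_def)

lemma tableau_eq_iff:
  "tableau n l t \<Longrightarrow> j < l i \<Longrightarrow> j' < l i' \<Longrightarrow> t (i, j) = t (i', j') \<longleftrightarrow> i = i' \<and> j = j'"
  unfolding tableau_def bij_betw_def by (auto simp: diagram_def dest: inj_onD)

lemma tableau_cover:
  assumes "tableau n l t" "x \<in> {1..n}"
  obtains i j where "j < l i" "x = t (i, j)"
  using assms by (force simp: tableau_def bij_betw_def diagram_def)

lemma tableau_perm:
  assumes "tableau n l t" "p permutes {1..n}"
  shows "tableau n l (p \<circ> t)"
  unfolding tableau_def
  by (rule bij_betw_trans) (use assms permutes_imp_bij in \<open>auto simp: tableau_def\<close>)

lemma tableau_transitive:
  assumes "tableau n l t" "tableau n l s"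
  obtains p where "p permutes {1..n}" "\<And>i j. j < l i \<Longrightarrow> s (i, j) = p (t (i, j))"
proof
  define p where "p x = (if x \<in> {1..n} then s (inv_into (diagram l) t x) else x)" for x
  have inv: "bij_betw (inv_into (diagram l) t) {1..n} (diagram l)"
    using assms(1) unfolding tableau_def by (rule bij_betw_inv_into)
  have "bij_betw (s \<circ> inv_into (diagram l) t) {1..n} {1..n}"
    by (rule bij_betw_trans[OF inv]) (use assms(2) in \<open>simp add: tableau_def\<close>)
  then have "bij_betw p {1..n} {1..n}"
    using bij_betw_cong[of "{1..n}" p "s \<circ> inv_into (diagram l) t" "{1..n}"] by (simp add: p_def)
  then show "p permutes {1..n}"
    by (rule bij_imp_permutes) (auto simp: p_def)
  show "s (i, j) = p (t (i, j))" if "j < l i" for i j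
    using tableau_in[OF assms(1) that] assms(1) that
    by (simp add: p_def tableau_def bij_betw_def inv_into_f_f diagram_def)
qed

section \<open>Tabloids\<close>

text \<open>Ordered set partitions of \<open>{1..n}\<close> with block sizes \<open>l\<close>. The
  sizes need not decrease: besides rows, the same kind of object describes the columns of a tableau,
  the strips of a chain and merged rows.\<close>

definition tabloids :: "nat \<Rightarrow> (nat \<Rightarrow> nat) \<Rightarrow> tabloid set" where
  "tabloids n l = {T. (\<forall>i. card (T i) = l i) \<and> disjoint_family T \<and> (\<Union>i. T i) = {1..n}}"

definition col_tabloid :: "(nat \<Rightarrow> nat) \<Rightarrow> (nat \<times> nat \<Rightarrow> nat) \<Rightarrow> tabloid" where
  "col_tabloid l t = (\<lambda>j. {t (i, j) | i. (i, j) \<in> diagram l})"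

lemma tabloids_card: "T \<in> tabloids n l \<Longrightarrow> card (T i) = l i"
  and tabloids_sub: "T \<in> tabloids n l \<Longrightarrow> T i \<subseteq> {1..n}"
  and tabloids_disj: "T \<in> tabloids n l \<Longrightarrow> x \<in> T i \<Longrightarrow> x \<in> T j \<Longrightarrow> i = j"
  by (auto simp: tabloids_def disjoint_family_on_def)

lemma tabloids_finite: "T \<in> tabloids n l \<Longrightarrow> finite (T i)"
  using tabloids_sub[of T n l i] by (rule finite_subset) simp_all

lemma tabloids_cover:
  assumes "T \<in> tabloids n l" "x \<in> {1..n}"
  obtains i where "x \<in> T i"
proof -
  have "x \<in> (\<Union>i. T i)" using assms unfolding tabloids_def by blast
  then show ?thesis using that by blast
qed

lemma tabloidsI:
  assumes "\<And>i. card (T i) = l i" "\<And>x i j. x \<in> T i \<Longrightarrow> x \<in> T j \<Longrightarrow> i = j"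
    "\<And>i. T i \<subseteq> {1..n}" "\<And>x. x \<in> {1..n} \<Longrightarrow> \<exists>i. x \<in> T i"
  shows "T \<in> tabloids n l"
proof -
  have "(\<Union>i. T i) = {1..n}" using assms(3,4) by blast
  moreover have "disjoint_family T" using assms(2) unfolding disjoint_family_on_def by blast
  ultimately show ?thesis using assms(1) unfolding tabloids_def by blast
qed

lemma tabloids_empty:
  assumes "T \<in> tabloids n l" "l i = 0"
  shows "T i = {}"
  using tabloids_card[OF assms(1), of i] tabloids_finite[OF assms(1), of i] assms(2) by simp

lemma finite_tabloids:
  assumes "l \<in> partitions n"
  shows "finite (tabloids n l)"
proof (rule finite_subset)
  show "tabloids n l \<subseteq> {T. \<forall>i. (i \<in> {..<n} \<longrightarrow> T i \<in> Pow {1..n}) \<and> (i \<notin> {..<n} \<longrightarrow> T i = {})}"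
  proof clarify
    fix T i assume T: "T \<in> tabloids n l"
    show "(i \<in> {..<n} \<longrightarrow> T i \<in> Pow {1..n}) \<and> (i \<notin> {..<n} \<longrightarrow> T i = {})"
      using tabloids_sub[OF T, of i] tabloids_empty[OF T, of i] part_zero[OF assms, of i] by auto
  qed
  show "finite {T. \<forall>i. (i \<in> {..<n} \<longrightarrow> T i \<in> Pow {1..n}) \<and> (i \<notin> {..<n} \<longrightarrow> T i = ({} :: nat set))}"
    by (rule finite_set_of_finite_funs) auto
qed

lemma tabloid_of_alt: "tabloid_of l t i = (\<lambda>j. t (i, j)) ` {..<l i}"
  by (auto simp: tabloid_of_def diagram_def)

lemma tabloid_of_in_tabloids:
  assumes "tableau n l t"
  shows "tabloid_of l t \<in> tabloids n l"
proof (rule tabloidsI)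
  show "card (tabloid_of l t i) = l i" for i
    unfolding tabloid_of_alt
    by (subst card_image) (auto simp: inj_on_def tableau_eq_iff[OF assms])
  show "\<exists>i. x \<in> tabloid_of l t i" if "x \<in> {1..n}" for x
    using tableau_cover[OF assms that] by (metis imageI lessThan_iff tabloid_of_alt)
  show "tabloid_of l t i \<subseteq> {1..n}" for i
    using tableau_in[OF assms] by (auto simp: tabloid_of_alt simp del: atLeastAtMost_iff)
qed (auto simp: tabloid_of_alt tableau_eq_iff[OF assms])

lemma col_tabloid_alt:
  assumes "l \<in> partitions n"
  shows "col_tabloid l t j = (\<lambda>i. t (i, j)) ` {..<conj_part l j}"
  by (auto simp: col_tabloid_def diagram_def less_conj_part[OF assms])

lemma mem_tabloid_of:
  assumes "tableau n l t" "j < l i"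
  shows "t (i, j) \<in> tabloid_of l t i' \<longleftrightarrow> i = i'"
  using assms by (auto simp: tabloid_of_alt tableau_eq_iff)

lemma mem_col_tabloid:
  assumes "tableau n l t" "j < l i"
  shows "t (i, j) \<in> col_tabloid l t j' \<longleftrightarrow> j = j'"
  using assms by (auto simp: col_tabloid_def diagram_def tableau_eq_iff)

lemma col_tabloid_in_tabloids:
  assumes "l \<in> partitions n" "tableau n l t"
  shows "col_tabloid l t \<in> tabloids n (conj_part l)"
proof (rule tabloidsI)
  show "card (col_tabloid l t i) = conj_part l i" for i
    unfolding col_tabloid_alt[OF assms(1)]
    by (subst card_image) (auto simp: inj_on_def tableau_eq_iff[OF assms(2)] less_conj_part[OF assms(1)])
  show "\<exists>i. x \<in> col_tabloid l t i" if "x \<in> {1..n}" for x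
    using tableau_cover[OF assms(2) that] by (metis assms(2) mem_col_tabloid)
  show "col_tabloid l t i \<subseteq> {1..n}" for i
    using tableau_in[OF assms(2)]
    by (auto simp: col_tabloid_alt[OF assms(1)] less_conj_part[OF assms(1)] simp del: atLeastAtMost_iff)
qed (auto simp: col_tabloid_def diagram_def tableau_eq_iff[OF assms(2)])

definition rank_in :: "nat set \<Rightarrow> nat \<Rightarrow> nat" where
  "rank_in A x = card {y \<in> A. y < x}"

lemma rank_in_less:
  assumes "finite A" "x \<in> A" "x < y"
  shows "rank_in A x < rank_in A y"
  unfolding rank_in_def by (rule psubset_card_mono) (use assms in auto)

lemma rank_in_less_iff:
  assumes "finite A" "x \<in> A" "y \<in> A"
  shows "rank_in A x < rank_in A y \<longleftrightarrow> x < y"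
  using rank_in_less[OF assms(1)] assms(2,3) by (metis linorder_neqE_nat order_less_asym)

lemma rank_in_bij:
  assumes "finite A"
  shows "bij_betw (rank_in A) A {..<card A}"
proof -
  have inj: "inj_on (rank_in A) A"
    using rank_in_less_iff[OF assms] by (intro inj_onI) (metis less_irrefl linorder_neqE_nat)
  have "rank_in A x < card A" if "x \<in> A" for x
    unfolding rank_in_def by (rule psubset_card_mono[OF assms]) (use that in auto)
  then have "rank_in A ` A = {..<card A}"
    by (intro card_subset_eq) (auto simp: card_image[OF inj])
  then show ?thesis using inj by (simp add: bij_betw_def)
qed

text \<open>The canonical tableau with rows \<open>T\<close>: each row is written in increasing
  order, so that a column consists of the entries of one rank.\<close>

definition sorted_tableau :: "tabloid \<Rightarrow> nat \<times> nat \<Rightarrow> nat" where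
  "sorted_tableau T = (\<lambda>(i, j). inv_into (T i) (rank_in (T i)) j)"

lemma sorted_tableau_row:
  assumes "T \<in> tabloids n l"
  shows "bij_betw (\<lambda>j. sorted_tableau T (i, j)) {..<l i} (T i)"
  using bij_betw_inv_into[OF rank_in_bij[OF tabloids_finite[OF assms, of i]]]
    tabloids_card[OF assms, of i]
  by (simp add: sorted_tableau_def)

lemma rank_sorted_tableau:
  assumes "T \<in> tabloids n l" "j < l i"
  shows "rank_in (T i) (sorted_tableau T (i, j)) = j"
  using rank_in_bij[OF tabloids_finite[OF assms(1), of i]] assms tabloids_card[OF assms(1), of i]
  by (simp add: sorted_tableau_def bij_betw_def f_inv_into_f)

lemma tableau_sorted_tableau:
  assumes "T \<in> tabloids n l"
  shows "tableau n l (sorted_tableau T)"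
  unfolding tableau_def bij_betw_def
proof
  note row = sorted_tableau_row[OF assms]
  have mem: "sorted_tableau T (i, j) \<in> T i" if "j < l i" for i j
    using row[of i] that by (auto simp: bij_betw_def)
  show "inj_on (sorted_tableau T) (diagram l)"
  proof (rule inj_onI, clarify)
    fix i j i' j'
    assume d: "(i, j) \<in> diagram l" "(i', j') \<in> diagram l"
      and eq: "sorted_tableau T (i, j) = sorted_tableau T (i', j')"
    have "i = i'"
      using mem[of j i] mem[of j' i'] d eq tabloids_disj[OF assms] by (auto simp: diagram_def)
    then show "i = i' \<and> j = j'"
      using row[of i] d eq by (auto simp: bij_betw_def inj_on_def diagram_def)
  qed
  show "sorted_tableau T ` diagram l = {1..n}"
  proof
    show "sorted_tableau T ` diagram l \<subseteq> {1..n}"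
      using mem tabloids_sub[OF assms] by (auto simp: diagram_def simp del: atLeastAtMost_iff)
    show "{1..n} \<subseteq> sorted_tableau T ` diagram l"
    proof
      fix x assume "x \<in> {1..n}"
      then obtain i where "x \<in> T i" using tabloids_cover[OF assms] by blast
      then obtain j where "j < l i" "x = sorted_tableau T (i, j)"
        using row[of i] by (auto simp: bij_betw_def)
      then show "x \<in> sorted_tableau T ` diagram l" by (auto simp: diagram_def)
    qed
  qed
qed

lemma tabloid_of_sorted_tableau:
  assumes "T \<in> tabloids n l"
  shows "tabloid_of l (sorted_tableau T) = T"
  using sorted_tableau_row[OF assms] by (auto simp: tabloid_of_alt bij_betw_def fun_eq_iff)

section \<open>The action of the symmetric group\<close>

lemma tabloid_act_comp: "tabloid_act (p \<circ> q) T = tabloid_act p (tabloid_act q T)"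
  by (simp add: tabloid_act_def image_comp)

lemma tabloid_act_id: "tabloid_act id T = T"
  by (simp add: tabloid_act_def)

lemma tabloid_act_inv:
  assumes "p permutes S"
  shows "tabloid_act (inv p) (tabloid_act p T) = T" "tabloid_act p (tabloid_act (inv p) T) = T"
  using permutes_inv_o[OF assms] by (simp_all add: tabloid_act_comp[symmetric] tabloid_act_id)

lemma tabloid_act_in_tabloids:
  assumes "p permutes {1..n}"
  shows "tabloid_act p T \<in> tabloids n l \<longleftrightarrow> T \<in> tabloids n l"
proof -
  have *: "tabloid_act p T \<in> tabloids n l" if "T \<in> tabloids n l" and p: "p permutes {1..n}" for p T
  proof (rule tabloidsI)
    have inj: "inj p" using p by (rule permutes_inj)
    show "card (tabloid_act p T i) = l i" for i
      unfolding tabloid_act_def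
      using card_image[of p "T i"] inj tabloids_card[OF that(1)] by (simp add: inj_on_def inj_def)
    show "i = j" if "x \<in> tabloid_act p T i" "x \<in> tabloid_act p T j" for x i j
      using that inj tabloids_disj[OF \<open>T \<in> tabloids n l\<close>] by (auto simp: tabloid_act_def dest: injD)
    show "tabloid_act p T i \<subseteq> {1..n}" for i
      using tabloids_sub[OF that(1), of i] permutes_image[OF p] by (auto simp: tabloid_act_def)
    show "\<exists>i. x \<in> tabloid_act p T i" if "x \<in> {1..n}" for x
    proof -
      have "inv p x \<in> {1..n}" using that permutes_in_image[OF permutes_inv[OF p]] by blast
      then obtain i where "inv p x \<in> T i" using tabloids_cover[OF \<open>T \<in> tabloids n l\<close>] by blast
      then have "x \<in> tabloid_act p T i"
        using imageI[OF \<open>inv p x \<in> T i\<close>, of p] permutes_inverses(1)[OF p, of x]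
        by (simp add: tabloid_act_def)
      then show ?thesis ..
    qed
  qed
  show ?thesis
    using *[OF _ assms] *[OF _ permutes_inv[OF assms]] tabloid_act_inv[OF assms] by metis
qed

lemma tabloid_of_perm: "tabloid_of l (p \<circ> t) = tabloid_act p (tabloid_of l t)"
  by (auto simp: tabloid_of_def tabloid_act_def fun_eq_iff)

lemma col_tabloid_perm: "col_tabloid l (p \<circ> t) = tabloid_act p (col_tabloid l t)"
  by (auto simp: col_tabloid_def tabloid_act_def fun_eq_iff)

lemma card_tabloid_act_Int:
  assumes "p permutes S"
  shows "card (tabloid_act p T i \<inter> tabloid_act p T' j) = card (T i \<inter> T' j)"
  using permutes_inj[OF assms]
  by (simp add: tabloid_act_def image_Int[symmetric] card_image inj_on_def inj_def)

lemma act_add: "act p (f + g) = act p f + act p g"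
  and act_scale: "act p (fscale c f) = fscale c (act p f)"
  and act_zero: "act p 0 = 0"
  and act_sum: "act p (\<Sum>x\<in>A. h x) = (\<Sum>x\<in>A. act p (h x))"
  by (simp_all add: act_def fscale_def fun_eq_iff sum_fun_apply)

lemma act_comp:
  assumes "p permutes S" "q permutes S"
  shows "act p (act q f) = act (p \<circ> q) f"
proof -
  have "inv (p \<circ> q) = inv q \<circ> inv p"
    using assms by (intro o_inv_distrib) (auto simp: permutes_bij)
  then show ?thesis by (simp add: act_def tabloid_act_comp)
qed

lemma act_id: "act id f = f"
  by (simp add: act_def tabloid_act_id)

lemma act_inv:
  assumes "p permutes S"
  shows "act p (act (inv p) f) = f" "act (inv p) (act p f) = f"
  using act_comp[OF assms permutes_inv[OF assms]] act_comp[OF permutes_inv[OF assms] assms]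
    permutes_inv_o[OF assms] by (simp_all add: act_id)

lemma act_span:
  assumes "f \<in> fun_vs.span B"
  shows "act p f \<in> fun_vs.span (act p ` B)"
  using assms
proof (induction rule: fun_vs.span_induct_alt)
  case base
  then show ?case using fun_vs.span_zero act_zero by metis
next
  case (step c x y)
  show ?case
    unfolding act_add act_scale
    by (intro fun_vs.span_add fun_vs.span_scale fun_vs.span_base imageI step)
qed

definition supported :: "'t set \<Rightarrow> ('t \<Rightarrow> 'k::field) set" where
  "supported X = {f. \<forall>x. x \<notin> X \<longrightarrow> f x = 0}"

lemma supportedD: "f \<in> supported X \<Longrightarrow> x \<notin> X \<Longrightarrow> f x = 0"
  by (simp add: supported_def)

lemma subspace_supported: "fun_vs.subspace (supported X)"
  by (auto simp: supported_def fun_vs.subspace_def fscale_def)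

definition delta :: "'t \<Rightarrow> 't \<Rightarrow> 'k::field" where
  "delta x = (\<lambda>y. if y = x then 1 else 0)"

lemma supported_expand:
  assumes "finite X" "f \<in> supported X"
  shows "f = (\<Sum>x\<in>X. fscale (f x) (delta x))"
proof
  fix y
  have "(\<Sum>x\<in>X. fscale (f x) (delta x)) y = (\<Sum>x\<in>X. if y = x then f x else 0)"
    by (simp add: sum_fun_apply fscale_def delta_def if_distrib cong: if_cong)
  then show "f y = (\<Sum>x\<in>X. fscale (f x) (delta x)) y"
    using assms by (auto simp: supportedD)
qed

section \<open>Column stabilizers and polytabloids\<close>

lemma column_stabilizer_alt:
  "column_stabilizer n l t =
     {p. p permutes {1..n} \<and> tabloid_act p (col_tabloid l t) = col_tabloid l t}"
  by (simp add: column_stabilizer_def col_tabloid_def tabloid_act_def fun_eq_iff)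

lemma column_stabilizer_permutes: "p \<in> column_stabilizer n l t \<Longrightarrow> p permutes {1..n}"
  by (simp add: column_stabilizer_def)

lemma finite_column_stabilizer: "finite (column_stabilizer n l t)"
  by (rule finite_subset[OF _ finite_permutations[of "{1..n}"]]) (auto simp: column_stabilizer_def)

lemma column_stabilizer_comp:
  "p \<in> column_stabilizer n l t \<Longrightarrow> q \<in> column_stabilizer n l t \<Longrightarrow> p \<circ> q \<in> column_stabilizer n l t"
  by (simp add: column_stabilizer_alt permutes_compose tabloid_act_comp)

lemma column_stabilizer_inv:
  "p \<in> column_stabilizer n l t \<Longrightarrow> inv p \<in> column_stabilizer n l t"
  by (simp add: column_stabilizer_alt permutes_inv) (metis tabloid_act_inv(1))

lemma column_stabilizer_id: "id \<in> column_stabilizer n l t"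
  by (simp add: column_stabilizer_alt permutes_id tabloid_act_id)

lemma sign_comp: "p permutes {1..n::nat} \<Longrightarrow> q permutes {1..n} \<Longrightarrow> sign (p \<circ> q) = sign p * sign q"
  by (intro sign_compose) (auto simp: permutation_permutes)

lemma sign_inv: "p permutes {1..n::nat} \<Longrightarrow> sign (inv p) = sign p"
  by (intro sign_inverse) (auto simp: permutation_permutes)

text \<open>The quotient of the two permutations preserves every row and every column of
  \<open>t\<close>. A row and a column meet in at most one entry, so it fixes all entries. Hence the
  tabloids occurring in a polytabloid are distinct and its coefficients are signs.\<close>

lemma column_stabilizer_inj:
  assumes t: "tableau n l t" and p: "p \<in> column_stabilizer n l t" "q \<in> column_stabilizer n l t"
    and eq: "tabloid_act p (tabloid_of l t) = tabloid_act q (tabloid_of l t)"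
  shows "p = q"
proof -
  define r where "r = inv q \<circ> p"
  have perm: "p permutes {1..n}" "q permutes {1..n}" using p by (auto simp: column_stabilizer_def)
  have r: "r \<in> column_stabilizer n l t"
    unfolding r_def using p by (intro column_stabilizer_comp column_stabilizer_inv)
  have row: "tabloid_act r (tabloid_of l t) = tabloid_of l t"
    unfolding r_def tabloid_act_comp eq using perm(2) by (rule tabloid_act_inv)
  have "r x = x" for x
  proof (cases "x \<in> {1..n}")
    case True
    then obtain i j where ij: "j < l i" "x = t (i, j)" using tableau_cover[OF t] by blast
    have "r x \<in> tabloid_act r (tabloid_of l t) i"
      unfolding tabloid_act_def using mem_tabloid_of[OF t ij(1)] ij by blast
    moreover have "r x \<in> tabloid_act r (col_tabloid l t) j"
      unfolding tabloid_act_def using mem_col_tabloid[OF t ij(1)] ij by blast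
    ultimately have rx: "r x \<in> tabloid_of l t i" "r x \<in> col_tabloid l t j"
      using row r by (simp_all add: column_stabilizer_alt)
    then obtain j' where "j' < l i" "r x = t (i, j')" by (auto simp: tabloid_of_alt)
    then show ?thesis using rx(2) mem_col_tabloid[OF t] ij by auto
  next
    case False
    then show ?thesis using r by (meson column_stabilizer_permutes permutes_not_in)
  qed
  then have "inv q \<circ> p = id" by (auto simp: r_def)
  then have "q \<circ> (inv q \<circ> p) = q" by simp
  then show ?thesis using permutes_inv_o(1)[OF perm(2)] by (simp add: comp_assoc[symmetric])
qed

lemma polytabloid_perm_value:
  assumes t: "tableau n l t" and q: "q \<in> column_stabilizer n l t"
  shows "polytabloid n l t (tabloid_act q (tabloid_of l t)) = (of_int (sign q) :: 'k::field)"
proof -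
  have "polytabloid n l t (tabloid_act q (tabloid_of l t)) =
    (\<Sum>p\<in>column_stabilizer n l t. if p = q then of_int (sign p) else (0 :: 'k))"
    unfolding polytabloid_def
    by (rule sum.cong) (use column_stabilizer_inj[OF t _ q] in \<open>auto\<close>)
  then show ?thesis using q finite_column_stabilizer by simp
qed

lemma polytabloid_zero:
  assumes "\<And>q. q \<in> column_stabilizer n l t \<Longrightarrow> T \<noteq> tabloid_act q (tabloid_of l t)"
  shows "polytabloid n l t T = 0"
  unfolding polytabloid_def using assms by (intro sum.neutral) auto

lemma polytabloid_supported:
  assumes t: "tableau n l t"
  shows "polytabloid n l t \<in> supported (tabloids n l)"
  unfolding supported_def
  using tabloid_act_in_tabloids tabloid_of_in_tabloids[OF t] column_stabilizer_permutes
  by (fastforce intro!: polytabloid_zero)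

lemma column_stabilizer_perm:
  assumes q: "q permutes {1..n}"
  shows "column_stabilizer n l (q \<circ> t) = (\<lambda>p. q \<circ> p \<circ> inv q) ` column_stabilizer n l t"
proof -
  have 1: "q \<circ> p \<circ> inv q \<in> column_stabilizer n l (q \<circ> t)"
    if "p \<in> column_stabilizer n l t" and q: "q permutes {1..n}" for p q t
    using that tabloid_act_inv[OF q]
    by (auto simp: column_stabilizer_alt col_tabloid_perm tabloid_act_comp
        intro!: permutes_compose permutes_inv)
  have "p \<in> (\<lambda>p. q \<circ> p \<circ> inv q) ` column_stabilizer n l t"
    if "p \<in> column_stabilizer n l (q \<circ> t)" for p
  proof
    have "inv q \<circ> p \<circ> inv (inv q) \<in> column_stabilizer n l (inv q \<circ> (q \<circ> t))"
      using that permutes_inv[OF q] by (rule 1)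
    then show "inv q \<circ> p \<circ> q \<in> column_stabilizer n l t"
      using permutes_inv_inv[OF q] permutes_inv_o(2)[OF q] by (simp add: comp_assoc[symmetric])
    show "p = q \<circ> (inv q \<circ> p \<circ> q) \<circ> inv q"
      using permutes_inv_o[OF q] by (simp add: fun_eq_iff o_def)
  qed
  then show ?thesis using 1[OF _ q] by blast
qed

lemma act_polytabloid:
  assumes q: "q permutes {1..n}"
  shows "act q (polytabloid n l t) = polytabloid n l (q \<circ> t)"
proof
  fix T
  have inj: "inj_on (\<lambda>p. q \<circ> p \<circ> inv q) (column_stabilizer n l t)"
  proof (rule inj_onI)
    fix p p' assume "q \<circ> p \<circ> inv q = q \<circ> p' \<circ> inv q"
    then have "inv q \<circ> (q \<circ> p \<circ> inv q) \<circ> q = inv q \<circ> (q \<circ> p' \<circ> inv q) \<circ> q" by simp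
    then show "p = p'"
      using permutes_inv_o[OF q] by (simp add: fun_eq_iff o_def)
  qed
  have "polytabloid n l (q \<circ> t) T = (\<Sum>p\<in>column_stabilizer n l t. of_int (sign (q \<circ> p \<circ> inv q)) *
      (if T = tabloid_act (q \<circ> p \<circ> inv q) (tabloid_of l (q \<circ> t)) then 1 else 0))"
    unfolding polytabloid_def column_stabilizer_perm[OF q] by (subst sum.reindex[OF inj]) simp
  also have "\<dots> = (\<Sum>p\<in>column_stabilizer n l t. of_int (sign p) *
      (if tabloid_act (inv q) T = tabloid_act p (tabloid_of l t) then 1 else 0))"
  proof (rule sum.cong)
    fix p assume p: "p \<in> column_stabilizer n l t"
    then have pp: "p permutes {1..n}" by (rule column_stabilizer_permutes)
    have "sign (q \<circ> p \<circ> inv q) = sign p"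
      using sign_comp[OF permutes_compose[OF pp q] permutes_inv[OF q]] sign_comp[OF q pp] sign_inv[OF q]
      by (simp add: sign_def)
    moreover have "T = tabloid_act (q \<circ> p \<circ> inv q) (tabloid_of l (q \<circ> t)) \<longleftrightarrow>
        tabloid_act (inv q) T = tabloid_act p (tabloid_of l t)"
      using tabloid_act_inv[OF q] by (metis tabloid_of_perm tabloid_act_comp)
    ultimately show "of_int (sign (q \<circ> p \<circ> inv q)) *
      (if T = tabloid_act (q \<circ> p \<circ> inv q) (tabloid_of l (q \<circ> t)) then 1 else 0) =
      of_int (sign p) * (if tabloid_act (inv q) T = tabloid_act p (tabloid_of l t) then 1 else 0)"
      by simp
  qed simp
  finally show "act q (polytabloid n l t) T = polytabloid n l (q \<circ> t) T"
    unfolding act_def polytabloid_def by (rule sym)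
qed

lemma polytabloid_cong:
  assumes "\<And>i j. j < l i \<Longrightarrow> t (i, j) = s (i, j)"
  shows "polytabloid n l t = polytabloid n l s"
proof -
  have "tabloid_of l t = tabloid_of l s" "col_tabloid l t = col_tabloid l s"
    using assms by (auto simp: tabloid_of_def col_tabloid_def diagram_def fun_eq_iff) metis+
  then show ?thesis by (simp add: polytabloid_def column_stabilizer_alt)
qed

lemma polytabloid_transitive:
  assumes "tableau n l t" "tableau n l s"
  obtains p where "p permutes {1..n}" "polytabloid n l s = act p (polytabloid n l t)"
proof -
  obtain p where p: "p permutes {1..n}" "\<And>i j. j < l i \<Longrightarrow> s (i, j) = p (t (i, j))"
    using tableau_transitive[OF assms] by blast
  then have "polytabloid n l s = polytabloid n l (p \<circ> t)"
    by (intro polytabloid_cong) simp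
  then show thesis using that[OF p(1)] act_polytabloid[OF p(1)] by metis
qed

section \<open>Specht modules\<close>

lemma submoduleD:
  assumes "submodule n U"
  shows "fun_vs.subspace U" "p permutes {1..n} \<Longrightarrow> f \<in> U \<Longrightarrow> act p f \<in> U"
  using assms by (auto simp: submodule_def)

lemma polytabloid_in_specht: "tableau n l t \<Longrightarrow> polytabloid n l t \<in> specht n l"
  unfolding specht_def by (rule fun_vs.span_base) auto

lemma submodule_specht: "submodule n (specht n l)"
  unfolding submodule_def
proof (intro conjI allI impI subsetI)
  show "fun_vs.subspace (specht n l)" unfolding specht_def by (rule fun_vs.subspace_span)
  fix p f assume p: "p permutes {1..n}" and "f \<in> act p ` specht n l"
  then have "f \<in> fun_vs.span (act p ` {polytabloid n l t | t. tableau n l t})"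
    unfolding specht_def by (auto intro: act_span)
  also have "\<dots> \<subseteq> specht n l"
    unfolding specht_def
    by (rule fun_vs.span_mono) (use act_polytabloid[OF p] tableau_perm[OF _ p] in force)
  finally show "f \<in> specht n l" .
qed

lemma specht_supported: "specht n l \<subseteq> supported (tabloids n l)"
  unfolding specht_def
  by (rule fun_vs.span_minimal) (auto simp: polytabloid_supported subspace_supported)

lemma specht_subset_submodule:
  fixes U :: "(tabloid \<Rightarrow> 'a::field) set"
  assumes "submodule n U" "tableau n l t" "polytabloid n l t \<in> U"
  shows "specht n l \<subseteq> U"
  unfolding specht_def
proof (rule fun_vs.span_minimal)
  show "{polytabloid n l t | t. tableau n l t} \<subseteq> U"
  proof clarify
    fix s assume "tableau n l s"
    then obtain p where "p permutes {1..n}"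
      "(polytabloid n l s :: tabloid \<Rightarrow> 'a) = act p (polytabloid n l t)"
      using polytabloid_transitive[OF assms(2)] by blast
    then show "polytabloid n l s \<in> U" using submoduleD(2)[OF assms(1) _ assms(3)] by simp
  qed
qed (rule submoduleD[OF assms(1)])

section \<open>Transversal tabloids\<close>

lemma sum_card_Int_tabloid:
  assumes W: "W \<in> tabloids n c" and c: "\<And>j. N \<le> j \<Longrightarrow> c j = 0" and A: "A \<subseteq> {1..n}"
  shows "(\<Sum>j<N. card (A \<inter> W j)) = card A"
proof -
  have "card (\<Union>j<N. A \<inter> W j) = (\<Sum>j<N. card (A \<inter> W j))"
    by (rule card_UN_disjoint) (use tabloids_finite[OF W] tabloids_disj[OF W] in auto)
  moreover have "(\<Union>j<N. A \<inter> W j) = A"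
  proof
    show "A \<subseteq> (\<Union>j<N. A \<inter> W j)"
    proof
      fix x assume x: "x \<in> A"
      then obtain j where j: "x \<in> W j" using tabloids_cover[OF W] A by blast
      then have "\<not> N \<le> j" using tabloids_empty[OF W c[of j]] by auto
      then show "x \<in> (\<Union>j<N. A \<inter> W j)" using x j by auto
    qed
  qed auto
  ultimately show ?thesis by simp
qed

lemma sum_of_bool_diagram:
  assumes "l \<in> partitions n" "n \<le> N"
  shows "(\<Sum>j<N. of_bool (j < l i)) = l i"
proof -
  have "l i \<le> N" using part_le[OF assms(1), of i] assms(2) by simp
  then have "{..<N} \<inter> {j. j < l i} = {..<l i}" by auto
  then show ?thesis by (simp add: of_bool_def sum.If_cases)
qed

text \<open>Necessity in the Gale--Ryser theorem, with its case of equality.\<close>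

lemma
  fixes d :: "nat \<Rightarrow> nat \<Rightarrow> bool"
  assumes l: "l \<in> partitions n" and N: "n \<le> N"
    and row: "\<And>i. i < N \<Longrightarrow> (\<Sum>j<N. of_bool (d i j)) = m i"
    and col: "\<And>j. j < N \<Longrightarrow> (\<Sum>i<N. of_bool (d i j)) = conj_part l j"
  shows zero_one_matrix_dominance: "I \<le> N \<Longrightarrow> (\<Sum>i<I. m i) \<le> (\<Sum>i<I. l i)"
    and zero_one_matrix_diagram:
      "(\<And>i. i < N \<Longrightarrow> m i = l i) \<Longrightarrow> i < N \<Longrightarrow> j < N \<Longrightarrow> d i j \<longleftrightarrow> j < l i"
proof -
  have le: "(\<Sum>i<I. of_bool (d i j)) \<le> (\<Sum>i<I. of_bool (j < l i) :: nat)" if "I \<le> N" "j < N" for I j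
  proof -
    have "{..<I} \<inter> {i. j < l i} = {..<min I (conj_part l j)}"
      by (auto simp: less_conj_part[OF l, symmetric])
    then have "(\<Sum>i<I. of_bool (j < l i)) = min I (conj_part l j)"
      by (simp add: of_bool_def sum.If_cases)
    moreover have "(\<Sum>i<I. of_bool (d i j)) \<le> (\<Sum>i<I. 1 :: nat)"
      by (rule sum_mono) simp
    moreover have "(\<Sum>i<I. of_bool (d i j)) \<le> (\<Sum>i<N. of_bool (d i j) :: nat)"
      by (rule sum_mono2) (use that in auto)
    ultimately show ?thesis using col[OF that(2)] by simp
  qed
  have m: "(\<Sum>i<I. m i) = (\<Sum>j<N. \<Sum>i<I. of_bool (d i j))" if "I \<le> N" for I
    using that row by (subst sum.swap) simp
  have lsum: "(\<Sum>i<I. l i) = (\<Sum>j<N. \<Sum>i<I. of_bool (j < l i))" for I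
    by (subst sum.swap) (simp add: sum_of_bool_diagram[OF l N])
  show "I \<le> N \<Longrightarrow> (\<Sum>i<I. m i) \<le> (\<Sum>i<I. l i)"
    unfolding lsum by (simp only: m) (intro sum_mono le, auto)
  assume eq: "\<And>i. i < N \<Longrightarrow> m i = l i" and i: "i < N" and j: "j < N"
  have *: "(\<Sum>i<I. of_bool (d i j)) = (\<Sum>i<I. of_bool (j < l i) :: nat)" if I: "I \<le> N" for I
  proof (rule ccontr)
    assume "(\<Sum>i<I. of_bool (d i j)) \<noteq> (\<Sum>i<I. of_bool (j < l i) :: nat)"
    then have "(\<Sum>i<I. of_bool (d i j)) < (\<Sum>i<I. of_bool (j < l i) :: nat)"
      using le[OF I j] by simp
    then have "(\<Sum>j<N. \<Sum>i<I. of_bool (d i j)) < (\<Sum>j<N. \<Sum>i<I. of_bool (j < l i) :: nat)"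
      using le[OF I] j by (intro sum_strict_mono_ex1) auto
    moreover have "(\<Sum>i<I. m i) = (\<Sum>i<I. l i)" using eq I by simp
    ultimately show False using m[OF I] lsum[of I] by simp
  qed
  show "d i j \<longleftrightarrow> j < l i"
    using *[of i] *[of "Suc i"] i by (simp split: if_splits) (simp add: of_bool_def split: if_splits)
qed

text \<open>For a tabloid of shape \<open>l\<close> and the columns of a tableau this describes the
  support of the polytabloid without reference to the column stabilizer.\<close>

definition transversal :: "(nat \<Rightarrow> nat) \<Rightarrow> tabloid \<Rightarrow> tabloid \<Rightarrow> bool" where
  "transversal l T W \<longleftrightarrow> (\<forall>i j. card (T i \<inter> W j) = of_bool (j < l i))"

text \<open>James's combinatorial lemma. The intersection numbers form a matrix of zeros and ones
  with row sums \<open>m\<close> and column sums \<open>conj_part l\<close>, so dominance and its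
  case of equality come from the Gale--Ryser argument.\<close>

lemma
  assumes l: "l \<in> partitions n" and m: "m \<in> partitions n"
    and T: "T \<in> tabloids n m" and W: "W \<in> tabloids n (conj_part l)"
    and one: "\<And>i j. card (T i \<inter> W j) \<le> 1"
  shows at_most_one_dominance: "(\<Sum>i<I. m i) \<le> (\<Sum>i<I. l i)"
    and at_most_one_transversal: "m = l \<Longrightarrow> transversal l T W"
proof -
  have bool: "of_bool (card (T i \<inter> W j) = 1) = card (T i \<inter> W j)" for i j
    using one[of i j] by (cases "card (T i \<inter> W j)") auto
  define N where "N = n + I"
  have row: "(\<Sum>j<N. of_bool (card (T i \<inter> W j) = 1)) = m i" if "n \<le> N" for i N
    unfolding bool using tabloids_card[OF T] that
    by (subst sum_card_Int_tabloid[OF W _ tabloids_sub[OF T]]) (auto simp: conj_part_zero[OF l])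
  have col: "(\<Sum>i<N. of_bool (card (T i \<inter> W j) = 1)) = conj_part l j" if "n \<le> N" for j N
    unfolding bool using tabloids_card[OF W] that sum_card_Int_tabloid[OF T _ tabloids_sub[OF W], of N j]
    by (simp add: part_zero[OF m] Int_commute)
  show "(\<Sum>i<I. m i) \<le> (\<Sum>i<I. l i)"
    by (rule zero_one_matrix_dominance[OF l, of N "\<lambda>i j. card (T i \<inter> W j) = 1"]) (use row[of N] col[of N] in \<open>auto simp: N_def\<close>)
  assume eq: "m = l"
  show "transversal l T W"
    unfolding transversal_def
  proof (intro allI)
    fix i j
    define N where "N = n + i + j + 1"
    have "card (T i \<inter> W j) = 1 \<longleftrightarrow> j < l i"
      by (rule zero_one_matrix_diagram[OF l, of N "\<lambda>i j. card (T i \<inter> W j) = 1" m])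
        (use row[of N] col[of N] eq in \<open>auto simp: N_def simp del: sum.lessThan_Suc sum_of_bool_eq\<close>)
    then show "card (T i \<inter> W j) = of_bool (j < l i)" using bool[of i j] by simp
  qed
qed

lemma transversal_tableau:
  assumes t: "tableau n l t"
  shows "transversal l (tabloid_of l t) (col_tabloid l t)"
  unfolding transversal_def
proof (intro allI)
  fix i j
  have "tabloid_of l t i \<inter> col_tabloid l t j = (if j < l i then {t (i, j)} else {})"
    by (auto simp: tabloid_of_def col_tabloid_def diagram_def tableau_eq_iff[OF t])
  then show "card (tabloid_of l t i \<inter> col_tabloid l t j) = of_bool (j < l i)" by simp
qed

lemma tableau_of_transversal:
  assumes T: "T \<in> tabloids n l" and W: "W \<in> tabloids n c" and tr: "transversal l T W"
  obtains t where "tableau n l t" "tabloid_of l t = T" "col_tabloid l t = W"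
proof
  define t where "t = (\<lambda>(i, j). the_elem (T i \<inter> W j))"
  have t: "T i \<inter> W j = {t (i, j)}" if "j < l i" for i j
  proof -
    have "card (T i \<inter> W j) = 1" using tr that by (simp add: transversal_def)
    then obtain x where "T i \<inter> W j = {x}" by (rule card_1_singletonE)
    then show ?thesis by (simp add: t_def)
  qed
  have cov: "j < l i \<and> x = t (i, j)" if "x \<in> T i" "x \<in> W j" for x i j
  proof -
    have "card (T i \<inter> W j) \<noteq> 0"
      using that tabloids_finite[OF T, of i] by auto
    then have "j < l i" using tr by (auto simp: transversal_def)
    then show ?thesis using t[of j i] that by auto
  qed
  show "tableau n l t"
    unfolding tableau_def bij_betw_def
  proof
    show "inj_on t (diagram l)"
    proof (rule inj_onI, clarify)
      fix i j i' j' assume "(i, j) \<in> diagram l" "(i', j') \<in> diagram l" and eq: "t (i, j) = t (i', j')"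
      then have "t (i, j) \<in> T i \<inter> W j" "t (i, j) \<in> T i' \<inter> W j'"
        unfolding eq using t[of j i] t[of j' i'] eq by (auto simp: diagram_def)
      then show "i = i' \<and> j = j'"
        using tabloids_disj[OF T] tabloids_disj[OF W] by blast
    qed
    show "t ` diagram l = {1..n}"
    proof
      show "t ` diagram l \<subseteq> {1..n}"
      proof clarify
        fix i j assume "(i, j) \<in> diagram l"
        then have "t (i, j) \<in> T i" using t[of j i] by (auto simp: diagram_def)
        then show "t (i, j) \<in> {1..n}" using tabloids_sub[OF T] by blast
      qed
      show "{1..n} \<subseteq> t ` diagram l"
      proof
        fix x assume "x \<in> {1..n}"
        then obtain i j where "x \<in> T i" "x \<in> W j"
          using tabloids_cover[OF T] tabloids_cover[OF W] by metis
        then show "x \<in> t ` diagram l" using cov by (force simp: diagram_def)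
      qed
    qed
  qed
  show "tabloid_of l t = T"
  proof (intro ext equalityI subsetI)
    fix i x assume "x \<in> tabloid_of l t i"
    then show "x \<in> T i" using t by (auto simp: tabloid_of_alt)
  next
    fix i x assume x: "x \<in> T i"
    then obtain j where "x \<in> W j"
      using tabloids_cover[OF W] tabloids_sub[OF T] by blast
    then show "x \<in> tabloid_of l t i" using cov[OF x] by (auto simp: tabloid_of_alt)
  qed
  show "col_tabloid l t = W"
  proof (intro ext equalityI subsetI)
    fix j x assume "x \<in> col_tabloid l t j"
    then show "x \<in> W j" using t by (auto simp: col_tabloid_def diagram_def)
  next
    fix j x assume x: "x \<in> W j"
    then obtain i where "x \<in> T i"
      using tabloids_cover[OF T] tabloids_sub[OF W] by blast
    then show "x \<in> col_tabloid l t j" using cov[OF _ x] by (auto simp: col_tabloid_def diagram_def)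
  qed
qed

lemma transversal_act:
  assumes "p permutes {1..n}"
  shows "transversal l (tabloid_act p T) (tabloid_act p W) \<longleftrightarrow> transversal l T W"
  by (simp add: transversal_def card_tabloid_act_Int[OF assms])

text \<open>A transversal tabloid together with the columns of \<open>t\<close> determines a
  tableau. The permutation carrying \<open>t\<close> to it preserves all columns, so it lies in the
  column stabilizer.\<close>

lemma transversal_iff_column_stabilizer:
  assumes l: "l \<in> partitions n" and t: "tableau n l t" and T: "T \<in> tabloids n l"
  shows "transversal l T (col_tabloid l t) \<longleftrightarrow>
    (\<exists>q\<in>column_stabilizer n l t. T = tabloid_act q (tabloid_of l t))"
proof
  assume "transversal l T (col_tabloid l t)"
  then obtain s where s: "tableau n l s" "tabloid_of l s = T" "col_tabloid l s = col_tabloid l t"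
    using tableau_of_transversal[OF T col_tabloid_in_tabloids[OF l t]] by blast
  obtain q where q: "q permutes {1..n}" "\<And>i j. j < l i \<Longrightarrow> s (i, j) = q (t (i, j))"
    using tableau_transitive[OF t s(1)] by blast
  then have "tabloid_of l s = tabloid_of l (q \<circ> t)" "col_tabloid l s = col_tabloid l (q \<circ> t)"
    by (auto simp: tabloid_of_def col_tabloid_def diagram_def fun_eq_iff) metis+
  then show "\<exists>q\<in>column_stabilizer n l t. T = tabloid_act q (tabloid_of l t)"
    using s q(1) by (intro bexI[of _ q]) (simp_all add: tabloid_of_perm col_tabloid_perm column_stabilizer_alt)
next
  assume "\<exists>q\<in>column_stabilizer n l t. T = tabloid_act q (tabloid_of l t)"
  then obtain q where q: "q permutes {1..n}" "T = tabloid_act q (tabloid_of l t)"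
    "tabloid_act q (col_tabloid l t) = col_tabloid l t"
    by (auto simp: column_stabilizer_alt)
  then show "transversal l T (col_tabloid l t)"
    using transversal_act[OF q(1), of l "tabloid_of l t" "col_tabloid l t"] transversal_tableau[OF t]
    by simp
qed

section \<open>Signed column sums\<close>

text \<open>The signed column sum as an element of the group algebra, acting on functions of any
  shape and not only on those of shape \<open>l\<close>.\<close>

definition column_sum ::
    "nat \<Rightarrow> (nat \<Rightarrow> nat) \<Rightarrow> (nat \<times> nat \<Rightarrow> nat) \<Rightarrow> (tabloid \<Rightarrow> 'k::field) \<Rightarrow> tabloid \<Rightarrow> 'k" where
  "column_sum n l t f = (\<Sum>p\<in>column_stabilizer n l t. fscale (of_int (sign p)) (act p f))"

lemma column_sum_apply:
  "column_sum n l t f R =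
     (\<Sum>p\<in>column_stabilizer n l t. of_int (sign p) * f (tabloid_act (inv p) R))"
  by (simp add: column_sum_def sum_fun_apply fscale_def act_def)

lemma column_sum_in_submodule:
  assumes "submodule n U" "f \<in> U"
  shows "column_sum n l t f \<in> U"
  unfolding column_sum_def
  by (intro fun_vs.subspace_sum fun_vs.subspace_scale submoduleD[OF assms(1)] assms
      column_stabilizer_permutes)

lemma polytabloid_column_sum:
  "(polytabloid n l t :: tabloid \<Rightarrow> 'a::field) = column_sum n l t (delta (tabloid_of l t))"
proof
  fix T
  show "(polytabloid n l t T :: 'a) = column_sum n l t (delta (tabloid_of l t)) T"
    unfolding polytabloid_def column_sum_apply delta_def
  proof (rule sum.cong)
    fix p assume "p \<in> column_stabilizer n l t"
    then have "p permutes {1..n}" by (rule column_stabilizer_permutes)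
    then have "T = tabloid_act p (tabloid_of l t) \<longleftrightarrow> tabloid_act (inv p) T = tabloid_of l t"
      using tabloid_act_inv by metis
    then show "of_int (sign p) * (if T = tabloid_act p (tabloid_of l t) then 1 else 0) =
      of_int (sign p) * (if tabloid_act (inv p) T = tabloid_of l t then 1 else (0::'a))" by simp
  qed simp
qed

text \<open>In characteristic two a sign-changing involution is not enough, because a term at a
  fixed point need not vanish. The predicate \<open>P\<close> cuts \<open>C\<close> into two halves
  exchanged by \<open>h\<close>, so the terms cancel in pairs in every characteristic.\<close>

lemma sum_flip_zero:
  fixes f :: "'b \<Rightarrow> 'a::ab_group_add"
  assumes "finite C" "\<And>p. p \<in> C \<Longrightarrow> h p \<in> C" "\<And>p. p \<in> C \<Longrightarrow> h (h p) = p"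
    "\<And>p. p \<in> C \<Longrightarrow> f (h p) = - f p" "\<And>p. p \<in> C \<Longrightarrow> P (h p) \<longleftrightarrow> \<not> P p"
  shows "(\<Sum>p\<in>C. f p) = 0"
proof -
  have "(\<Sum>p\<in>C. f p) = (\<Sum>p\<in>{p\<in>C. P p}. f p) + (\<Sum>p\<in>{p\<in>C. \<not> P p}. f p)"
    using assms(1) by (subst sum.union_disjoint[symmetric]) (auto intro!: sum.cong)
  also have "(\<Sum>p\<in>{p\<in>C. \<not> P p}. f p) = (\<Sum>p\<in>{p\<in>C. P p}. - f p)"
    by (rule sum.reindex_bij_witness[of _ h h]) (use assms in auto)
  finally show ?thesis by (simp add: sum_negf)
qed

lemma tabloid_act_transpose:
  assumes "T \<in> tabloids n l" "a \<in> T i" "b \<in> T i"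
  shows "tabloid_act (transpose a b) T = T"
proof
  fix j
  show "tabloid_act (transpose a b) T j = T j"
  proof (cases "j = i")
    case True
    then show ?thesis
      using assms(2,3) by (auto simp: tabloid_act_def transpose_def image_iff split: if_splits)
  next
    case False
    then have "a \<notin> T j" "b \<notin> T j" using assms tabloids_disj by metis+
    then show ?thesis by (auto simp: tabloid_act_def transpose_def image_iff)
  qed
qed

text \<open>Two entries \<open>a\<close>, \<open>b\<close> share a row of \<open>R\<close> and a
  column of \<open>t\<close>. Their transposition fixes \<open>R\<close> and reverses the sign, so
  the terms cancel in pairs; comparing \<open>inv p a\<close> with \<open>inv p b\<close> singles
  out one member of each pair.\<close>

lemma column_sum_zero:
  assumes l: "l \<in> partitions n" and t: "tableau n l t" and R: "R \<in> tabloids n m"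
    and two: "1 < card (R i \<inter> col_tabloid l t j)"
  shows "column_sum n l t f R = 0"
proof -
  let ?C = "column_stabilizer n l t"
  obtain a b where ab: "a \<noteq> b" "a \<in> R i" "b \<in> R i" "a \<in> col_tabloid l t j" "b \<in> col_tabloid l t j"
  proof -
    obtain a where a: "a \<in> R i \<inter> col_tabloid l t j"
      using two by (metis card.empty ex_in_conv not_less_zero)
    moreover have "R i \<inter> col_tabloid l t j \<noteq> {a}" using two by auto
    ultimately show thesis using that by blast
  qed
  define s where "s = transpose a b"
  have s: "s permutes {1..n}"
    unfolding s_def using ab tabloids_sub[OF R] by (intro permutes_swap_id) blast+
  have sC: "s \<in> ?C"
    using s tabloid_act_transpose[OF col_tabloid_in_tabloids[OF l t] ab(4,5)]
    by (simp add: column_stabilizer_alt s_def)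
  have sR: "tabloid_act s R = R"
    unfolding s_def using R ab(2,3) by (rule tabloid_act_transpose)
  have ss: "s \<circ> s = id" by (simp add: s_def)
  have inv_s: "inv (s \<circ> p) = inv p \<circ> s" if "p \<in> ?C" for p
  proof -
    have "inv s = s" using ss by (simp add: s_def)
    then show ?thesis
      using o_inv_distrib[of s p] permutes_bij[OF s] permutes_bij[OF column_stabilizer_permutes[OF that]]
      by simp
  qed
  show ?thesis
    unfolding column_sum_apply
  proof (rule sum_flip_zero[where h = "\<lambda>p. s \<circ> p" and P = "\<lambda>p. inv p a < inv p b"])
    fix p assume p: "p \<in> ?C"
    then have pp: "p permutes {1..n}" by (rule column_stabilizer_permutes)
    show "s \<circ> p \<in> ?C" using sC p by (rule column_stabilizer_comp)
    show "s \<circ> (s \<circ> p) = p" using ss by (simp add: comp_assoc[symmetric])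
    have "sign (s \<circ> p) = - sign p"
      using sign_comp[OF s pp] ab(1) by (simp add: s_def sign_swap_id)
    then show "of_int (sign (s \<circ> p)) * f (tabloid_act (inv (s \<circ> p)) R) =
        - (of_int (sign p) * f (tabloid_act (inv p) R))"
      by (simp add: inv_s[OF p] tabloid_act_comp sR)
    have "inv p a \<noteq> inv p b" using ab(1) permutes_inj[OF permutes_inv[OF pp]] by (auto dest: injD)
    then show "inv (s \<circ> p) a < inv (s \<circ> p) b \<longleftrightarrow> \<not> inv p a < inv p b"
      unfolding inv_s[OF p] by (auto simp: s_def)
  qed (rule finite_column_stabilizer)
qed

lemma column_sum_outside:
  assumes f: "f \<in> supported (tabloids n m)" and R: "R \<notin> tabloids n m"
  shows "column_sum n l t f R = 0"
  unfolding column_sum_apply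
proof (rule sum.neutral, rule ballI)
  fix p assume "p \<in> column_stabilizer n l t"
  then have "inv p permutes {1..n}" by (intro permutes_inv column_stabilizer_permutes)
  then have "tabloid_act (inv p) R \<notin> tabloids n m" using R tabloid_act_in_tabloids by blast
  then show "of_int (sign p) * f (tabloid_act (inv p) R) = 0" using supportedD[OF f] by simp
qed

lemma column_sum_dominance:
  assumes l: "l \<in> partitions n" and m: "m \<in> partitions n" and t: "tableau n l t"
    and f: "f \<in> supported (tabloids n m)" and nz: "column_sum n l t f \<noteq> 0"
  shows "(\<Sum>i<I. m i) \<le> (\<Sum>i<I. l i)"
proof -
  obtain R where R: "column_sum n l t f R \<noteq> 0" using nz by (auto simp: fun_eq_iff)
  have "R \<in> tabloids n m"
  proof (rule ccontr)
    assume "R \<notin> tabloids n m"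
    then have "column_sum n l t f R = 0"
      by (rule column_sum_outside[OF f])
    then show False using R by simp
  qed
  then show ?thesis
    using at_most_one_dominance[OF l m _ col_tabloid_in_tabloids[OF l t]] column_sum_zero[OF l t] R
    by (metis leI)
qed

text \<open>A nonzero value needs a tabloid none of whose rows meets a column of \<open>t\<close>
  twice. For equal shapes these are the images of \<open>tabloid_of l t\<close> under the column
  stabilizer, and the values there differ only by signs. The scalar is the pairing of
  \<open>f\<close> with the polytabloid, as \<open>form_polytabloid\<close> shows later.\<close>

lemma column_sum_same_shape:
  assumes l: "l \<in> partitions n" and t: "tableau n l t" and f: "f \<in> supported (tabloids n l)"
  shows "column_sum n l t f =
    fscale (\<Sum>p\<in>column_stabilizer n l t. of_int (sign p) * f (tabloid_act p (tabloid_of l t)))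
      (polytabloid n l t)"
proof
  fix R
  let ?C = "column_stabilizer n l t" and ?e = "polytabloid n l t"
  let ?c = "\<Sum>p\<in>?C. of_int (sign p) * f (tabloid_act p (tabloid_of l t))"
  show "column_sum n l t f R = fscale ?c ?e R"
  proof (cases "\<exists>q\<in>?C. R = tabloid_act q (tabloid_of l t)")
    case True
    then obtain q where q: "q \<in> ?C" and R: "R = tabloid_act q (tabloid_of l t)" by blast
    have qp: "q permutes {1..n}" using q by (rule column_stabilizer_permutes)
    have e: "?e R = of_int (sign q)" using polytabloid_perm_value[OF t q] R by simp
    have "column_sum n l t f R = (\<Sum>p\<in>?C. of_int (sign (q \<circ> inv p)) * f (tabloid_act p (tabloid_of l t)))"
      unfolding column_sum_apply
    proof (rule sum.reindex_bij_witness[where i = "\<lambda>p. q \<circ> inv p" and j = "\<lambda>p. inv p \<circ> q"])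
      fix p assume p: "p \<in> ?C"
      then have pp: "p permutes {1..n}" by (rule column_stabilizer_permutes)
      have io: "inv (inv p \<circ> q) = inv q \<circ> p" "inv (q \<circ> inv p) = p \<circ> inv q"
        using o_inv_distrib[of "inv p" q] o_inv_distrib[of q "inv p"] permutes_bij[OF qp]
          permutes_bij[OF permutes_inv[OF pp]] permutes_inv_inv[OF pp] by simp_all
      show "q \<circ> inv (inv p \<circ> q) = p"
        unfolding io using permutes_inv_o[OF qp] by (simp add: comp_assoc[symmetric])
      show "inv (q \<circ> inv p) \<circ> q = p"
        unfolding io using permutes_inv_o[OF qp] by (simp add: comp_assoc)
      show "inv p \<circ> q \<in> ?C" "q \<circ> inv p \<in> ?C"
        using p q by (auto intro: column_stabilizer_comp column_stabilizer_inv)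
      show "of_int (sign (q \<circ> inv (inv p \<circ> q))) * f (tabloid_act (inv p \<circ> q) (tabloid_of l t)) =
          of_int (sign p) * f (tabloid_act (inv p) R)"
        by (simp add: \<open>q \<circ> inv (inv p \<circ> q) = p\<close> tabloid_act_comp R)
    qed
    also have "\<dots> = (\<Sum>p\<in>?C. of_int (sign q) * (of_int (sign p) * f (tabloid_act p (tabloid_of l t))))"
      proof (rule sum.cong)
      fix p assume "p \<in> ?C"
      then have pp: "p permutes {1..n}" by (rule column_stabilizer_permutes)
      then have "sign (q \<circ> inv p) = sign q * sign p"
        using sign_comp[OF qp permutes_inv[OF pp]] sign_inv[OF pp] by simp
      then show "of_int (sign (q \<circ> inv p)) * f (tabloid_act p (tabloid_of l t)) =
        of_int (sign q) * (of_int (sign p) * f (tabloid_act p (tabloid_of l t)))" by simp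
    qed simp
    finally show ?thesis by (simp add: fscale_def e sum_distrib_left mult_ac)
  next
    case False
    then have e: "?e R = 0" by (intro polytabloid_zero) auto
    have "column_sum n l t f R = 0"
    proof (cases "R \<in> tabloids n l")
      case True
      then have "\<not> transversal l R (col_tabloid l t)"
        using transversal_iff_column_stabilizer[OF l t] False by blast
      then obtain i j where "\<not> card (R i \<inter> col_tabloid l t j) \<le> 1"
        using at_most_one_transversal[OF l l True col_tabloid_in_tabloids[OF l t]] by blast
      then show ?thesis using column_sum_zero[OF l t True] by (metis not_le)
    next
      case out: False
      then show ?thesis
        by (intro column_sum_outside[OF f])
    qed
    then show ?thesis by (simp add: fscale_def e)
  qed
qed

section \<open>Characteristic two: Garnir relations and the functions that satisfy them\<close>

section \<open>Specht modules in characteristic two\<close>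

definition incident :: "(nat \<Rightarrow> nat \<Rightarrow> nat) \<Rightarrow> tabloid \<Rightarrow> tabloid \<Rightarrow> bool" where
  "incident A T W \<longleftrightarrow> (\<forall>i j. card (T i \<inter> W j) = A i j)"

text \<open>One form for several families: polytabloids in characteristic two, the matrix of the
  idempotent on S(\<beta>), and the functions attached to strips and to frames.\<close>

definition incidence :: "nat \<Rightarrow> (nat \<Rightarrow> nat) \<Rightarrow> (nat \<Rightarrow> nat \<Rightarrow> nat) \<Rightarrow> tabloid \<Rightarrow> tabloid \<Rightarrow> 'k::field" where
  "incidence n l A W = (\<lambda>T. of_bool (T \<in> tabloids n l \<and> incident A T W))"

lemma transversal_incident: "transversal l = incident (\<lambda>i j. of_bool (j < l i))"
  by (simp add: transversal_def incident_def fun_eq_iff)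

lemma incident_act:
  assumes "p permutes {1..n}"
  shows "incident A (tabloid_act p T) (tabloid_act p W) \<longleftrightarrow> incident A T W"
  by (simp add: incident_def card_tabloid_act_Int[OF assms])

lemma incidence_supported: "incidence n l A W \<in> supported (tabloids n l)"
  by (simp add: incidence_def supported_def)

lemma act_incidence:
  assumes p: "p permutes {1..n}"
  shows "act p (incidence n l A W) = incidence n l A (tabloid_act p W)"
proof
  fix T
  show "act p (incidence n l A W) T = incidence n l A (tabloid_act p W) T"
    using incident_act[OF p, of A "tabloid_act (inv p) T" W] tabloid_act_inv[OF p]
      tabloid_act_in_tabloids[OF permutes_inv[OF p], of T l]
    by (simp add: act_def incidence_def)
qed

text \<open>A Garnir exchange between adjacent rows: the pool \<open>X \<union> Y\<close> is dealt
  out again, and \<open>Q\<close> is what row \<open>i\<close> receives.\<close>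

definition exchange :: "tabloid \<Rightarrow> nat \<Rightarrow> nat set \<Rightarrow> nat set \<Rightarrow> nat set \<Rightarrow> tabloid" where
  "exchange T i X Y Q = T(i := T i - X \<union> Q, Suc i := T (Suc i) - Y \<union> (X \<union> Y - Q))"

definition exchange_sets :: "nat set \<Rightarrow> nat set \<Rightarrow> nat set set" where
  "exchange_sets X Y = {Q. Q \<subseteq> X \<union> Y \<and> card Q = card X}"

text \<open>The pool has \<open>Suc (l i)\<close> entries, one more than the number of columns that
  reach row \<open>i\<close>. This excess is what makes the sums vanish on polytabloids.\<close>

definition garnir :: "nat \<Rightarrow> (nat \<Rightarrow> nat) \<Rightarrow> (tabloid \<Rightarrow> 'k::field) \<Rightarrow> bool" where
  "garnir n l h \<longleftrightarrow> (\<forall>T\<in>tabloids n l. \<forall>i X Y. X \<subseteq> T i \<longrightarrow> Y \<subseteq> T (Suc i) \<longrightarrow>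
     card X + card Y = Suc (l i) \<longrightarrow> (\<Sum>Q\<in>exchange_sets X Y. h (exchange T i X Y Q)) = 0)"

lemma exchange_in_tabloids:
  assumes T: "T \<in> tabloids n l" and X: "X \<subseteq> T i" and Y: "Y \<subseteq> T (Suc i)"
    and Q: "Q \<in> exchange_sets X Y"
  shows "exchange T i X Y Q \<in> tabloids n l"
proof (rule tabloidsI)
  have fin: "finite (T i)" "finite (T (Suc i))" using tabloids_finite[OF T] by auto
  have finXY: "finite X" "finite Y" using fin X Y finite_subset by auto
  have Qs: "Q \<subseteq> X \<union> Y" "card Q = card X" using Q by (auto simp: exchange_sets_def)
  have finQ: "finite Q" using Qs finXY finite_subset by blast
  have dis: "T i \<inter> T (Suc i) = {}" using tabloids_disj[OF T, of _ i "Suc i"] by auto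
  show "card (exchange T i X Y Q j) = l j" for j
  proof -
    have "card (T i - X \<union> Q) = card (T i - X) + card Q"
      by (rule card_Un_disjoint) (use fin finQ Qs X Y dis in auto)
    also have "\<dots> = l i"
      using Qs card_mono[OF fin(1) X] tabloids_card[OF T, of i] by (simp add: card_Diff_subset[OF finXY(1) X])
    finally have 1: "card (T i - X \<union> Q) = l i" .
    have "card (X \<union> Y - Q) = card (X \<union> Y) - card Q"
      by (rule card_Diff_subset[OF finQ Qs(1)])
    also have "card (X \<union> Y) = card X + card Y"
      by (rule card_Un_disjoint) (use finXY X Y dis in auto)
    finally have "card (X \<union> Y - Q) = card Y" using Qs(2) by simp
    moreover have "card (T (Suc i) - Y \<union> (X \<union> Y - Q)) = card (T (Suc i) - Y) + card (X \<union> Y - Q)"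
      by (rule card_Un_disjoint) (use fin finXY Qs X Y dis in auto)
    ultimately have 2: "card (T (Suc i) - Y \<union> (X \<union> Y - Q)) = l (Suc i)"
      using card_mono[OF fin(2) Y] tabloids_card[OF T, of "Suc i"]
      by (simp add: card_Diff_subset[OF finXY(2) Y])
    show ?thesis using 1 2 tabloids_card[OF T] by (simp add: exchange_def)
  qed
  have sub: "X \<subseteq> {1..n}" "Y \<subseteq> {1..n}" using X Y tabloids_sub[OF T] by blast+
  show "exchange T i X Y Q j \<subseteq> {1..n}" for j
    using tabloids_sub[OF T] sub Qs(1) by (auto simp: exchange_def simp del: atLeastAtMost_iff)
  show "\<exists>j. x \<in> exchange T i X Y Q j" if "x \<in> {1..n}" for x
  proof -
    from tabloids_cover[OF T that] obtain j where j: "x \<in> T j" .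
    show ?thesis
    proof (cases "x \<in> X \<union> Y")
      case True
      then have "x \<in> exchange T i X Y Q i \<or> x \<in> exchange T i X Y Q (Suc i)"
        by (auto simp: exchange_def)
      then show ?thesis by blast
    next
      case False
      then have "x \<in> exchange T i X Y Q j" using j by (auto simp: exchange_def)
      then show ?thesis ..
    qed
  qed
  have notin: "x \<notin> T j" if "x \<in> X \<union> Y" "j \<noteq> i" "j \<noteq> Suc i" for x j
    using that X Y tabloids_disj[OF T, of x j] by blast
  have cases: "x \<in> T j \<and> x \<notin> X \<union> Y \<or> x \<in> Q \<and> j = i \<or> x \<in> X \<union> Y - Q \<and> j = Suc i"
    if x: "x \<in> exchange T i X Y Q j" for x j
  proof -
    consider "j = i" | "j = Suc i" | "j \<noteq> i" "j \<noteq> Suc i" by blast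
    then show ?thesis
    proof cases
      case 1
      then have "x \<in> T i - X \<union> Q" using x by (simp add: exchange_def)
      then show ?thesis using 1 Y dis by blast
    next
      case 2
      then have "x \<in> T (Suc i) - Y \<union> (X \<union> Y - Q)" using x by (simp add: exchange_def)
      then show ?thesis using 2 X dis by blast
    next
      case 3
      then have "x \<in> T j" using x by (simp add: exchange_def)
      then show ?thesis using notin[of x j] 3 by blast
    qed
  qed
  show "j = j'" if "x \<in> exchange T i X Y Q j" "x \<in> exchange T i X Y Q j'" for x j j'
    using cases[OF that(1)] cases[OF that(2)] tabloids_disj[OF T, of x j j'] Qs(1) by blast
qed

lemma exchange_self:
  assumes "T \<in> tabloids n l" "X \<subseteq> T i" "Y \<subseteq> T (Suc i)"
  shows "exchange T i X Y X = T"
proof -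
  have "T i \<inter> T (Suc i) = {}" using tabloids_disj[OF assms(1), of _ i "Suc i"] by auto
  then have "T i - X \<union> X = T i" "T (Suc i) - Y \<union> (X \<union> Y - X) = T (Suc i)" using assms by auto
  then show ?thesis by (simp add: exchange_def)
qed

definition standard :: "tabloid \<Rightarrow> bool" where
  "standard T \<longleftrightarrow> (\<forall>i x y. x \<in> T i \<longrightarrow> y \<in> T (Suc i) \<longrightarrow>
     rank_in (T i) x = rank_in (T (Suc i)) y \<longrightarrow> x < y)"

lemma exchange_sum_less:
  assumes fin: "finite X" "finite Y" and Q: "Q \<in> exchange_sets X Y" "Q \<noteq> X"
    and X: "\<And>x. x \<in> X \<Longrightarrow> a \<le> x" and Y: "\<And>y. y \<in> Y \<Longrightarrow> y < (a::nat)"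
  shows "\<Sum>Q < \<Sum>X"
proof -
  have Qs: "Q \<subseteq> X \<union> Y" "card Q = card X" using Q by (auto simp: exchange_sets_def)
  have finQ: "finite Q" using Qs fin finite_subset by blast
  have "card (Q - X) + card (Q \<inter> X) = card Q" "card (X - Q) + card (X \<inter> Q) = card X"
    using card_Int_Diff[OF finQ, of X] card_Int_Diff[OF fin(1), of Q] by simp_all
  then have eq: "card (Q - X) = card (X - Q)" using Qs(2) by (simp add: Int_commute)
  have "X - Q \<noteq> {}"
  proof
    assume "X - Q = {}"
    then have "X \<subseteq> Q" by auto
    then show False using card_subset_eq[OF finQ] Qs(2) Q(2) by metis
  qed
  then have ne: "Q - X \<noteq> {}" using eq finQ fin by (metis card_eq_0_iff finite_Diff)
  have "\<Sum>Q = \<Sum>(Q - X) + \<Sum>(Q \<inter> X)" using sum.Int_Diff[OF finQ, of "\<lambda>x. x" X] by simp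
  also have "\<Sum>(Q - X) < (\<Sum>x\<in>Q - X. a)"
    by (rule sum_strict_mono) (use finQ ne Qs(1) Y in auto)
  also have "\<dots> = (\<Sum>x\<in>X - Q. a)" using eq by simp
  also have "\<dots> \<le> \<Sum>(X - Q)" by (rule sum_mono) (use X in auto)
  finally have "\<Sum>Q < \<Sum>(X - Q) + \<Sum>(Q \<inter> X)" by simp
  also have "\<dots> = \<Sum>X" using sum.Int_Diff[OF fin(1), of "\<lambda>x. x" Q] by (simp add: Int_commute)
  finally show ?thesis .
qed

lemma weighted_sum_exchange:
  assumes T: "T \<in> tabloids n l" and X: "X \<subseteq> T i" and Y: "Y \<subseteq> T (Suc i)" and i: "Suc i < N"
    and Q: "Q \<in> exchange_sets X Y" and less: "\<Sum>Q < \<Sum>X"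
  shows "(\<Sum>j<N. j * \<Sum>(T j)) < (\<Sum>j<N. j * \<Sum>(exchange T i X Y Q j))"
proof -
  let ?E = "exchange T i X Y Q"
  have fin: "finite (T i)" "finite (T (Suc i))" using tabloids_finite[OF T] by auto
  have finXY: "finite X" "finite Y" using fin X Y finite_subset by auto
  have Qs: "Q \<subseteq> X \<union> Y" using Q by (auto simp: exchange_sets_def)
  have finQ: "finite Q" using Qs finXY finite_subset by blast
  have dis: "T i \<inter> T (Suc i) = {}" using tabloids_disj[OF T, of _ i "Suc i"] by auto
  have "\<Sum>(?E i) = \<Sum>(T i - X) + \<Sum>Q"
    unfolding exchange_def using fin finQ Qs X Y dis by (simp, subst sum.union_disjoint) auto
  moreover have "\<Sum>(T i) = \<Sum>(T i - X) + \<Sum>X"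
    using sum.subset_diff[OF X fin(1), of "\<lambda>x. x"] by simp
  moreover have "\<Sum>(?E (Suc i)) = \<Sum>(T (Suc i) - Y) + \<Sum>(X \<union> Y - Q)"
    unfolding exchange_def using fin finXY Qs X Y dis by (simp, subst sum.union_disjoint) auto
  moreover have "\<Sum>(T (Suc i)) = \<Sum>(T (Suc i) - Y) + \<Sum>Y"
    using sum.subset_diff[OF Y fin(2), of "\<lambda>x. x"] by simp
  moreover have "\<Sum>(X \<union> Y - Q) + \<Sum>Q = \<Sum>X + \<Sum>Y"
  proof -
    have "\<Sum>(X \<union> Y - Q) + \<Sum>Q = \<Sum>(X \<union> Y)"
      using sum.subset_diff[OF Qs, of "\<lambda>x. x"] finXY by simp
    also have "\<dots> = \<Sum>X + \<Sum>Y"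
      by (rule sum.union_disjoint) (use finXY X Y dis in auto)
    finally show ?thesis .
  qed
  ultimately have i_eq: "\<Sum>(?E i) + \<Sum>X = \<Sum>(T i) + \<Sum>Q"
    and Si_eq: "\<Sum>(?E (Suc i)) + \<Sum>Q = \<Sum>(T (Suc i)) + \<Sum>X" by linarith+
  define d where "d = \<Sum>X - \<Sum>Q"
  have d: "\<Sum>X = \<Sum>Q + d" "d > 0" using less by (auto simp: d_def)
  have e: "\<Sum>(T i) = \<Sum>(?E i) + d" "\<Sum>(?E (Suc i)) = \<Sum>(T (Suc i)) + d"
    using i_eq Si_eq d by linarith+
  have split: "(\<Sum>j<N. g j) = g i + g (Suc i) + (\<Sum>j\<in>{..<N} - {i, Suc i}. g j)" for g :: "nat \<Rightarrow> nat"
  proof -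
    have "(\<Sum>j<N. g j) = (\<Sum>j\<in>{..<N} - {i, Suc i}. g j) + (\<Sum>j\<in>{i, Suc i}. g j)"
      by (rule sum.subset_diff) (use i in auto)
    then show ?thesis by simp
  qed
  have "(\<Sum>j\<in>{..<N} - {i, Suc i}. j * \<Sum>(?E j)) = (\<Sum>j\<in>{..<N} - {i, Suc i}. j * \<Sum>(T j))"
    by (rule sum.cong) (auto simp: exchange_def)
  then show ?thesis
    unfolding split using e d(2) by (simp add: algebra_simps)
qed

text \<open>Straightening. Where standardness fails, a single relation expresses \<open>h T\<close>
  by values at tabloids with larger entries further down. The weight, in which each entry is
  multiplied by its row index, increases and is bounded by
  \<open>n * (n * \<Sum>{1..n})\<close>.\<close>

lemma garnir_standard_zero:
  fixes h :: "tabloid \<Rightarrow> 'k::field"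
  assumes l: "l \<in> partitions n" and h: "garnir n l h"
    and std: "\<And>T. T \<in> tabloids n l \<Longrightarrow> standard T \<Longrightarrow> h T = 0"
  shows "T \<in> tabloids n l \<Longrightarrow> h T = 0"
proof (induction "n * (n * \<Sum>{1..n}) - (\<Sum>j<n. j * \<Sum>(T j))" arbitrary: T rule: less_induct)
  case less
  note T = less.prems
  show ?case
  proof (cases "standard T")
    case False
    then obtain i x y where x: "x \<in> T i" and y: "y \<in> T (Suc i)"
      and rk: "rank_in (T i) x = rank_in (T (Suc i)) y" and "\<not> x < y"
      by (auto simp: standard_def)
    then have yx: "y < x" using tabloids_disj[OF T x, of "Suc i"] by (metis n_not_Suc_n linorder_neqE_nat)
    \<comment> \<open>All entries of \<open>X\<close> exceed all entries of \<open>Y\<close>, so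
      every exchange except the trivial one lowers the entry sum of row \<open>i\<close>. The pool
      has the right size because the ranks agree: \<open>X\<close> has \<open>l i\<close> minus the
      rank many entries, \<open>Y\<close> the rank plus one.\<close>
    define X where "X = {z \<in> T i. x \<le> z}"
    define Y where "Y = {z \<in> T (Suc i). z \<le> y}"
    have XT: "X \<subseteq> T i" and YT: "Y \<subseteq> T (Suc i)" by (auto simp: X_def Y_def)
    have fin: "finite (T i)" "finite (T (Suc i))" using tabloids_finite[OF T] by auto
    have finXY: "finite X" "finite Y" using fin XT YT finite_subset by auto
    have "Y = insert y {z \<in> T (Suc i). z < y}" using y by (auto simp: Y_def)
    then have "card Y = Suc (rank_in (T (Suc i)) y)"
      unfolding rank_in_def using fin by simp
    moreover have "card X + rank_in (T i) x = l i"
    proof -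
      have "card X + card {z \<in> T i. z < x} = card (X \<union> {z \<in> T i. z < x})"
        by (rule card_Un_disjoint[symmetric]) (use fin in \<open>auto simp: X_def\<close>)
      also have "X \<union> {z \<in> T i. z < x} = T i" by (auto simp: X_def)
      finally show ?thesis using tabloids_card[OF T, of i] by (simp add: rank_in_def)
    qed
    ultimately have "card X + card Y = Suc (l i)" using rk by simp
    then have sum0: "(\<Sum>Q\<in>exchange_sets X Y. h (exchange T i X Y Q)) = 0"
      using h T XT YT by (simp add: garnir_def)
    have finE: "finite (exchange_sets X Y)"
      by (rule finite_subset[of _ "Pow (X \<union> Y)"]) (use finXY in \<open>auto simp: exchange_sets_def\<close>)
    have XE: "X \<in> exchange_sets X Y" by (auto simp: exchange_sets_def)
    have "l (Suc i) \<noteq> 0" using y tabloids_empty[OF T] by auto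
    then have Si: "Suc i < n" using part_zero[OF l] by (meson not_le)
    have zero: "h (exchange T i X Y Q) = 0" if Q: "Q \<in> exchange_sets X Y" "Q \<noteq> X" for Q
    proof (rule less.hyps)
      show E: "exchange T i X Y Q \<in> tabloids n l" using T XT YT Q(1) by (rule exchange_in_tabloids)
      have "\<Sum>Q < \<Sum>X"
        by (rule exchange_sum_less[OF finXY Q, of x]) (use yx in \<open>auto simp: X_def Y_def\<close>)
      then have less': "(\<Sum>j<n. j * \<Sum>(T j)) < (\<Sum>j<n. j * \<Sum>(exchange T i X Y Q j))"
        by (rule weighted_sum_exchange[OF T XT YT Si Q(1)])
      have "j * \<Sum>(R j) \<le> n * \<Sum>{1..n}" if "j < n" "R \<in> tabloids n l" for j R
        by (intro mult_mono sum_mono2 tabloids_sub[OF that(2)]) (use that in auto)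
      then have "(\<Sum>j<n. j * \<Sum>(exchange T i X Y Q j)) \<le> (\<Sum>j<n. n * \<Sum>{1..n})"
        using E by (intro sum_mono) auto
      then show "n * (n * \<Sum>{1..n}) - (\<Sum>j<n. j * \<Sum>(exchange T i X Y Q j)) <
          n * (n * \<Sum>{1..n}) - (\<Sum>j<n. j * \<Sum>(T j))"
        using less' by simp
    qed
    have "(\<Sum>Q\<in>exchange_sets X Y. h (exchange T i X Y Q)) = h (exchange T i X Y X)"
      using sum.remove[OF finE XE, of "\<lambda>Q. h (exchange T i X Y Q)"] zero by simp
    then show ?thesis using sum0 exchange_self[OF T XT YT] by simp
  qed (use std T in auto)
qed

section \<open>Triangularity\<close>

definition rank_of :: "tabloid \<Rightarrow> nat \<Rightarrow> nat" where
  "rank_of T x = rank_in (T (THE i. x \<in> T i)) x"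

lemma rank_of_eq:
  assumes "T \<in> tabloids n l" "x \<in> T i"
  shows "rank_of T x = rank_in (T i) x"
proof -
  have "(THE i. x \<in> T i) = i"
    by (rule the_equality) (use assms tabloids_disj[OF assms(1)] in auto)
  then show ?thesis by (simp add: rank_of_def)
qed

lemma col_sorted_tableau:
  assumes l: "l \<in> partitions n" and T: "T \<in> tabloids n l" and x: "x \<in> {1..n}"
  shows "x \<in> col_tabloid l (sorted_tableau T) j \<longleftrightarrow> rank_of T x = j"
proof -
  note t = tableau_sorted_tableau[OF T]
  obtain i j' where ij: "j' < l i" "x = sorted_tableau T (i, j')" using tableau_cover[OF t x] .
  then have "x \<in> T i" using mem_tabloid_of[OF t ij(1), of i] tabloid_of_sorted_tableau[OF T] by simp
  then have "rank_of T x = j'" using rank_of_eq[OF T] rank_sorted_tableau[OF T ij(1)] ij(2) by simp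
  then show ?thesis using mem_col_tabloid[OF t ij(1), of j] ij(2) by auto
qed

text \<open>Comparing codes compares the ranks of the entries lexicographically, the largest entry first.\<close>

definition code :: "nat \<Rightarrow> (nat \<Rightarrow> nat) \<Rightarrow> nat" where
  "code n f = (\<Sum>x\<in>{1..n}. f x * Suc n ^ x)"

text \<open>An expansion in base \<open>Suc n\<close>: the digits of \<open>f\<close> are at most
  \<open>n\<close>, so those below position \<open>x\<close> together stay under one unit at
  position \<open>x\<close>.\<close>

lemma code_less:
  assumes x: "x \<in> {1..n}" "f x < g x" and above: "\<And>y. y \<in> {1..n} \<Longrightarrow> x < y \<Longrightarrow> f y = g y"
    and bound: "\<And>y. y \<in> {1..n} \<Longrightarrow> f y \<le> n"
  shows "code n f < code n g"
proof -
  have low: "(\<Sum>y\<in>{1..<x}. f y * Suc n ^ y) < Suc n ^ x" if "x \<le> n + 1" for x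
    using that
  proof (induction x)
    case (Suc x)
    show ?case
    proof (cases "x = 0")
      case False
      then have "(\<Sum>y\<in>{1..<Suc x}. f y * Suc n ^ y) = (\<Sum>y\<in>{1..<x}. f y * Suc n ^ y) + f x * Suc n ^ x"
        by (simp add: atLeastLessThanSuc)
      also have "\<dots> < Suc n ^ x + n * Suc n ^ x"
        using Suc bound[of x] False by (intro add_less_le_mono mult_right_mono) auto
      finally show ?thesis by simp
    qed simp
  qed simp
  have split: "code n h = (\<Sum>y\<in>{1..<x}. h y * Suc n ^ y) + h x * Suc n ^ x + (\<Sum>y\<in>{x<..n}. h y * Suc n ^ y)" for h
  proof -
    have "{1..n} = {1..<x} \<union> ({x} \<union> {x<..n})" using x(1) by auto
    then have "code n h = (\<Sum>y\<in>{1..<x} \<union> ({x} \<union> {x<..n}). h y * Suc n ^ y)" by (simp add: code_def)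
    also have "\<dots> = (\<Sum>y\<in>{1..<x}. h y * Suc n ^ y) + (\<Sum>y\<in>{x} \<union> {x<..n}. h y * Suc n ^ y)"
      by (rule sum.union_disjoint) auto
    also have "(\<Sum>y\<in>{x} \<union> {x<..n}. h y * Suc n ^ y) = h x * Suc n ^ x + (\<Sum>y\<in>{x<..n}. h y * Suc n ^ y)"
      by (subst sum.union_disjoint) auto
    finally show ?thesis by simp
  qed
  have "(\<Sum>y\<in>{x<..n}. f y * Suc n ^ y) = (\<Sum>y\<in>{x<..n}. g y * Suc n ^ y)"
    using above x(1) by (intro sum.cong) auto
  moreover have "(\<Sum>y\<in>{1..<x}. f y * Suc n ^ y) < Suc n ^ x" using low x(1) by simp
  moreover have "Suc (f x) * Suc n ^ x \<le> g x * Suc n ^ x" using x(2) by (intro mult_right_mono) auto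
  ultimately show ?thesis unfolding split[of f] split[of g] by simp
qed

lemma rank_of_bound:
  assumes T: "T \<in> tabloids n l" and x: "x \<in> T i"
  shows "rank_of T x < l i"
  using rank_in_bij[OF tabloids_finite[OF T, of i]] x tabloids_card[OF T, of i] rank_of_eq[OF T x]
  by (auto simp: bij_betw_def)

text \<open>Of all ways to index the entries of a row of \<open>U\<close> bijectively, the rank is the largest when the
  indices of large entries are compared first.\<close>

lemma code_rank_le:
  assumes l: "l \<in> partitions n" and T: "T \<in> tabloids n l" and U: "U \<in> tabloids n l"
    and tr: "transversal l U (col_tabloid l (sorted_tableau T))"
  shows "code n (rank_of T) < code n (rank_of U) \<or> (\<forall>x\<in>{1..n}. rank_of T x = rank_of U x)"
proof (rule disjCI)
  assume "\<not> (\<forall>x\<in>{1..n}. rank_of T x = rank_of U x)"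
  then have ne: "{x \<in> {1..n}. rank_of T x \<noteq> rank_of U x} \<noteq> {}" (is "?D \<noteq> {}") by auto
  define x where "x = Max ?D"
  have "x \<in> ?D" unfolding x_def by (rule Max_in) (use ne in auto)
  then have x: "x \<in> {1..n}" "rank_of T x \<noteq> rank_of U x" by auto
  have above: "rank_of T y = rank_of U y" if "y \<in> {1..n}" "x < y" for y
  proof (rule ccontr)
    assume "rank_of T y \<noteq> rank_of U y"
    then have "y \<le> x" unfolding x_def using that(1) by (intro Max_ge) auto
    then show False using that(2) by simp
  qed
  obtain i where i: "x \<in> U i" using tabloids_cover[OF U x(1)] .
  have inj: "y = z" if "y \<in> U i" "z \<in> U i" "rank_of T y = rank_of T z" for y z
  proof -
    let ?W = "col_tabloid l (sorted_tableau T) (rank_of T y)"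
    have "y \<in> {1..n}" "z \<in> {1..n}" using that tabloids_sub[OF U] by blast+
    then have "{y, z} \<subseteq> U i \<inter> ?W" using col_sorted_tableau[OF l T] that by auto
    then have "card {y, z} \<le> card (U i \<inter> ?W)" by (rule card_mono[rotated]) (simp add: tabloids_finite[OF U])
    also have "\<dots> \<le> 1" using tr by (simp add: transversal_def)
    finally show ?thesis by (cases "y = z") auto
  qed
  have bound: "rank_of T x < l i"
  proof -
    have "x \<in> U i \<inter> col_tabloid l (sorted_tableau T) (rank_of T x)"
      using i col_sorted_tableau[OF l T x(1)] by simp
    then have "card (U i \<inter> col_tabloid l (sorted_tableau T) (rank_of T x)) \<noteq> 0"
      using tabloids_finite[OF U, of i] by auto
    then show ?thesis using tr by (auto simp: transversal_def split: if_splits)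
  qed
  have "rank_of T x \<le> rank_of U x"
  proof (rule ccontr)
    assume "\<not> rank_of T x \<le> rank_of U x"
    then have gt: "rank_of U x < rank_of T x" by simp
    have "rank_of T x \<in> rank_in (U i) ` U i"
      using rank_in_bij[OF tabloids_finite[OF U, of i]] bound tabloids_card[OF U, of i]
      by (auto simp: bij_betw_def)
    then obtain y where y: "y \<in> U i" "rank_of U y = rank_of T x" using rank_of_eq[OF U] by auto
    then have "x < y"
      using gt rank_in_less_iff[OF tabloids_finite[OF U], of x i y] i rank_of_eq[OF U] by simp
    moreover have "y \<in> {1..n}" using y(1) tabloids_sub[OF U] by blast
    ultimately have "rank_of T y = rank_of T x" using above y(2) by simp
    then show False using inj[OF y(1) i] \<open>x < y\<close> by simp
  qed
  then have "rank_of T x < rank_of U x" using x(2) by simp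
  moreover have "rank_of T y \<le> n" if "y \<in> {1..n}" for y
  proof -
    obtain j where "y \<in> T j" using tabloids_cover[OF T \<open>y \<in> {1..n}\<close>] .
    then show ?thesis using rank_of_bound[OF T] part_le[OF l, of j] by (meson less_imp_le less_le_trans)
  qed
  ultimately show "code n (rank_of T) < code n (rank_of U)"
    using code_less[OF x(1)] above by blast
qed

lemma standard_chain:
  assumes l: "l \<in> partitions n" and T: "T \<in> tabloids n l" and std: "standard T"
    and xy: "x \<in> T i" "y \<in> T j" "i < j" "rank_of T x = rank_of T y"
  shows "x < y"
  using xy
proof (induction "j - i" arbitrary: i x)
  case (Suc d)
  have "rank_of T y < l j" using rank_of_bound[OF T Suc.prems(2)] .
  also have "l j \<le> l (Suc i)" using part_antimono[OF l, of "Suc i" j] Suc.prems(3) by simp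
  finally have "rank_of T x \<in> rank_in (T (Suc i)) ` T (Suc i)"
    using rank_in_bij[OF tabloids_finite[OF T, of "Suc i"]] tabloids_card[OF T, of "Suc i"] Suc.prems(4)
    by (auto simp: bij_betw_def)
  then obtain z where z: "z \<in> T (Suc i)" "rank_of T z = rank_of T x"
    using rank_of_eq[OF T] by auto
  then have "rank_in (T i) x = rank_in (T (Suc i)) z"
    using rank_of_eq[OF T] Suc.prems(1) by simp
  then have xz: "x < z" using std Suc.prems(1) z(1) unfolding standard_def by blast
  show ?case
  proof (cases "Suc i = j")
    case True
    then have "rank_in (T j) z = rank_in (T j) y"
      using z Suc.prems rank_of_eq[OF T] by auto
    then have "z = y"
      using rank_in_bij[OF tabloids_finite[OF T, of j]] z(1) Suc.prems(2) True
      by (auto simp: bij_betw_def dest: inj_onD)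
    then show ?thesis using xz by simp
  next
    case False
    then have "z < y" using Suc.hyps(1)[of "Suc i" z] Suc.hyps(2) Suc.prems z by simp
    then show ?thesis using xz by simp
  qed
qed simp

text \<open>In a standard tabloid the entries of a given rank increase downwards, and every row
  above \<open>i\<close> is long enough to contain one. So the smaller entries of the same rank
  count the rows above \<open>x\<close>, and the ranks determine the tabloid.\<close>

lemma standard_row:
  assumes l: "l \<in> partitions n" and T: "T \<in> tabloids n l" and std: "standard T" and x: "x \<in> T i"
  shows "i = card {y \<in> {1..n}. rank_of T y = rank_of T x \<and> y < x}"
proof -
  define f where "f j = the_inv_into (T j) (rank_in (T j)) (rank_of T x)" for j
  have f: "f j \<in> T j \<and> rank_of T (f j) = rank_of T x" if "j \<le> i" for j
  proof -
    have "rank_of T x < l j" using rank_of_bound[OF T x] part_antimono[OF l that] by simp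
    then have "rank_of T x \<in> rank_in (T j) ` T j" "inj_on (rank_in (T j)) (T j)"
      using rank_in_bij[OF tabloids_finite[OF T, of j]] tabloids_card[OF T, of j]
      by (auto simp: bij_betw_def)
    then show ?thesis
      using the_inv_into_into[of "rank_in (T j)" "T j" "rank_of T x" "T j"] rank_of_eq[OF T]
        f_the_inv_into_f[of "rank_in (T j)" "T j" "rank_of T x"] by (simp add: f_def)
  qed
  have "{y \<in> {1..n}. rank_of T y = rank_of T x \<and> y < x} = f ` {..<i}"
  proof (intro equalityI subsetI)
    fix y assume y: "y \<in> {y \<in> {1..n}. rank_of T y = rank_of T x \<and> y < x}"
    then obtain j where j: "y \<in> T j" using tabloids_cover[OF T, of y] by auto
    have "\<not> i < j" using standard_chain[OF l T std x j] y by auto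
    moreover have "j \<noteq> i"
    proof
      assume "j = i"
      then have "rank_in (T i) y = rank_in (T i) x" using y j x rank_of_eq[OF T] by auto
      then show False using rank_in_less_iff[OF tabloids_finite[OF T], of y i x] x j \<open>j = i\<close> y by auto
    qed
    ultimately have "j < i" by simp
    have "rank_in (T j) y = rank_in (T j) (f j)"
      using y f[of j] \<open>j < i\<close> rank_of_eq[OF T j] rank_of_eq[OF T, of "f j" j] by simp
    then have "y = f j"
      using rank_in_bij[OF tabloids_finite[OF T, of j]] j f[of j] \<open>j < i\<close>
      by (auto simp: bij_betw_def dest: inj_onD)
    then show "y \<in> f ` {..<i}" using \<open>j < i\<close> by simp
  next
    fix y assume "y \<in> f ` {..<i}"
    then obtain j where j: "j < i" "y = f j" by auto
    then have y: "y \<in> T j" "rank_of T y = rank_of T x" using f[of j] by auto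
    then show "y \<in> {y \<in> {1..n}. rank_of T y = rank_of T x \<and> y < x}"
      using standard_chain[OF l T std y(1) x j(1)] tabloids_sub[OF T, of j] by auto
  qed
  moreover have "inj_on f {..<i}"
    using f tabloids_disj[OF T] by (intro inj_onI) (metis lessThan_iff less_imp_le)
  ultimately show ?thesis by (simp add: card_image)
qed

lemma standard_eqI:
  assumes l: "l \<in> partitions n" and T: "T \<in> tabloids n l" "standard T" and U: "U \<in> tabloids n l" "standard U"
    and eq: "\<forall>x\<in>{1..n}. rank_of T x = rank_of U x"
  shows "T = U"
proof -
  have sub: "T i \<subseteq> U i" if T: "T \<in> tabloids n l" "standard T" and U: "U \<in> tabloids n l" "standard U"
    and eq: "\<forall>x\<in>{1..n}. rank_of T x = rank_of U x" for i T U
  proof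
    fix x assume x: "x \<in> T i"
    then have xn: "x \<in> {1..n}" using tabloids_sub[OF T(1)] by blast
    then obtain j where j: "x \<in> U j" using tabloids_cover[OF U(1)] by blast
    have "i = j"
      unfolding standard_row[OF l T x] standard_row[OF l U j]
      by (rule arg_cong[of _ _ card]) (use eq xn in auto)
    then show "x \<in> U i" using j by simp
  qed
  show ?thesis using sub[OF T U eq] sub[OF U T] eq by (intro ext equalityI) auto
qed

locale char_two =
  fixes K :: "'k::field itself"
  assumes char: "CHAR('k) = 2"
begin

lemma of_nat_char_two: "(of_nat c :: 'k) = of_bool (odd c)"
proof (cases "even c")
  case False
  then obtain d where "c = Suc (2 * d)" by (metis odd_two_times_div_two_succ Suc_eq_plus1)
  moreover have "(of_nat (2 * d) :: 'k) = 0" using char by (subst of_nat_eq_0_iff_char_dvd) simp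
  ultimately show ?thesis by simp
qed (use char in \<open>simp add: of_nat_eq_0_iff_char_dvd\<close>)

lemma uminus_char_two: "- x = (x :: 'k)"
proof -
  have "x + x = of_nat 2 * x" by simp
  then have "x + x = 0" unfolding of_nat_char_two by simp
  then show ?thesis by (simp add: eq_neg_iff_add_eq_0 neg_eq_iff_add_eq_0)
qed

lemma of_int_sign: "of_int (sign p) = (1 :: 'k)"
  by (simp add: sign_def uminus_char_two)

lemma polytabloid_char_two:
  assumes l: "l \<in> partitions n" and t: "tableau n l t"
  shows "(polytabloid n l t :: tabloid \<Rightarrow> 'k) =
    incidence n l (\<lambda>i j. of_bool (j < l i)) (col_tabloid l t)"
proof
  fix T
  show "(polytabloid n l t T :: 'k) = incidence n l (\<lambda>i j. of_bool (j < l i)) (col_tabloid l t) T"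
  proof (cases "T \<in> tabloids n l \<and> transversal l T (col_tabloid l t)")
    case True
    then obtain q where "q \<in> column_stabilizer n l t" "T = tabloid_act q (tabloid_of l t)"
      using transversal_iff_column_stabilizer[OF l t] by blast
    then show ?thesis
      using True by (simp add: polytabloid_perm_value[OF t] of_int_sign incidence_def transversal_incident)
  next
    case False
    then have "(polytabloid n l t T :: 'k) = 0"
      using transversal_iff_column_stabilizer[OF l t] tabloid_act_in_tabloids tabloid_of_in_tabloids[OF t]
        column_stabilizer_permutes
      by (intro polytabloid_zero) blast
    then show ?thesis using False by (simp add: incidence_def transversal_incident)
  qed
qed

text \<open>Unitriangularity. The polytabloid of the sorted tableau of a standard \<open>T\<close>
  has value 1 at \<open>T\<close>, and every other standard tabloid in its support has a larger
  code. So the values can be prescribed in order of increasing code.\<close>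

lemma specht_standard_interpolation:
  assumes l: "l \<in> partitions n"
  shows "\<exists>g\<in>specht n l. \<forall>T\<in>tabloids n l. standard T \<longrightarrow> g T = (f T :: 'k)"
proof -
  let ?e = "\<lambda>T. polytabloid n l (sorted_tableau T) :: tabloid \<Rightarrow> 'k"
  let ?c = "\<lambda>T. code n (rank_of T)"
  have e: "?e T U = of_bool (transversal l U (col_tabloid l (sorted_tableau T)))"
    if "T \<in> tabloids n l" "U \<in> tabloids n l" for T U
    using that by (simp add: polytabloid_char_two[OF l tableau_sorted_tableau] incidence_def transversal_incident)
  have self: "?e T T = 1" if "T \<in> tabloids n l" for T
    using e[OF that that] transversal_tableau[OF tableau_sorted_tableau[OF that]]
      tabloid_of_sorted_tableau[OF that] by simp
  have "\<exists>g\<in>specht n l. \<forall>T\<in>tabloids n l. standard T \<and> ?c T < N \<longrightarrow> g T = f T" for N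
  proof (induction N)
    case 0
    have "0 \<in> specht n l" using submoduleD(1)[OF submodule_specht] by (rule fun_vs.subspace_0)
    then show ?case by auto
  next
    case (Suc N)
    then obtain g where g: "g \<in> specht n l"
      and gf: "\<And>T. T \<in> tabloids n l \<Longrightarrow> standard T \<Longrightarrow> ?c T < N \<Longrightarrow> g T = f T" by blast
    \<comment> \<open>The polytabloids of code \<open>N\<close> vanish at the standard tabloids of
      smaller code and at each other's tabloids, so all corrections at this level can be made at
      once.\<close>
    define S where "S = {T \<in> tabloids n l. standard T \<and> ?c T = N}"
    have finS: "finite S" using finite_tabloids[OF l] by (simp add: S_def)
    define g' where "g' = g + (\<Sum>T\<in>S. fscale (f T - g T) (?e T))"
    have "g' \<in> specht n l"
      unfolding g'_def
      by (intro fun_vs.subspace_add fun_vs.subspace_sum fun_vs.subspace_scale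
          submoduleD(1)[OF submodule_specht] g polytabloid_in_specht tableau_sorted_tableau)
        (auto simp: S_def)
    moreover have "g' U = f U" if U: "U \<in> tabloids n l" "standard U" "?c U < Suc N" for U
    proof -
      have zero: "?e T U = 0" if T: "T \<in> S" "T \<noteq> U" for T
      proof (rule ccontr)
        have T': "T \<in> tabloids n l" "standard T" "?c T = N" using T by (auto simp: S_def)
        assume "?e T U \<noteq> 0"
        then have "transversal l U (col_tabloid l (sorted_tableau T))" using e[OF T'(1) U(1)] by auto
        then have "?c T < ?c U \<or> (\<forall>x\<in>{1..n}. rank_of T x = rank_of U x)"
          by (rule code_rank_le[OF l T'(1) U(1)])
        then show False using standard_eqI[OF l T'(1,2) U(1,2)] T(2) T'(3) U(3) by auto
      qed
      have "(\<Sum>T\<in>S. fscale (f T - g T) (?e T)) U = (\<Sum>T\<in>S. if T = U then f U - g U else 0)"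
        unfolding sum_fun_apply fscale_def
        by (rule sum.cong) (use zero self in \<open>auto simp: S_def\<close>)
      also have "\<dots> = (if U \<in> S then f U - g U else 0)" using finS by simp
      finally show ?thesis
        using gf[OF U(1,2)] U by (auto simp: g'_def S_def)
    qed
    ultimately show ?case by blast
  qed
  from this[of "Suc (\<Sum>T\<in>tabloids n l. ?c T)"] obtain g where g: "g \<in> specht n l"
    and gf: "\<And>T. T \<in> tabloids n l \<Longrightarrow> standard T \<Longrightarrow> ?c T < Suc (\<Sum>T\<in>tabloids n l. ?c T) \<Longrightarrow> g T = f T"
    by blast
  have "?c T < Suc (\<Sum>T\<in>tabloids n l. ?c T)" if "T \<in> tabloids n l" for T
    using member_le_sum[OF that _ finite_tabloids[OF l], of ?c] by simp
  then show ?thesis using g gf by blast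
qed

text \<open>If two pooled entries share a column of \<open>t\<close>, exchanging them pairs off the
  terms. Otherwise a nonzero term would put \<open>Suc (l i)\<close> entries into distinct columns,
  all of them among the first \<open>l i\<close>.\<close>

lemma polytabloid_garnir:
  assumes l: "l \<in> partitions n" and t: "tableau n l t"
  shows "garnir n l (polytabloid n l t :: tabloid \<Rightarrow> 'k)"
  unfolding garnir_def
proof (intro ballI allI impI)
  fix T i X Y assume T: "T \<in> tabloids n l" and X: "X \<subseteq> T i" and Y: "Y \<subseteq> T (Suc i)"
    and card: "card X + card Y = Suc (l i)"
  let ?e = "polytabloid n l t :: tabloid \<Rightarrow> 'k" and ?W = "col_tabloid l t"
  let ?E = "exchange T i X Y"
  have W: "?W \<in> tabloids n (conj_part l)" using l t by (rule col_tabloid_in_tabloids)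
  have e: "?e (?E Q) = of_bool (transversal l (?E Q) ?W)" if "Q \<in> exchange_sets X Y" for Q
    using exchange_in_tabloids[OF T X Y that]
    by (simp add: polytabloid_char_two[OF l t] incidence_def transversal_incident)
  have finXY: "finite X" "finite Y" using tabloids_finite[OF T] X Y finite_subset by blast+
  have dis: "T i \<inter> T (Suc i) = {}" using tabloids_disj[OF T, of _ i "Suc i"] by auto
  have finE: "finite (exchange_sets X Y)"
    by (rule finite_subset[of _ "Pow (X \<union> Y)"]) (use finXY in \<open>auto simp: exchange_sets_def\<close>)
  show "(\<Sum>Q\<in>exchange_sets X Y. ?e (?E Q)) = 0"
  proof (cases "\<exists>x\<in>X \<union> Y. \<exists>y\<in>X \<union> Y. \<exists>c. x \<noteq> y \<and> x \<in> ?W c \<and> y \<in> ?W c")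
    case True
    then obtain x y c where xy: "x \<in> X \<union> Y" "y \<in> X \<union> Y" "x \<noteq> y" "x \<in> ?W c" "y \<in> ?W c" by blast
    define s where "s = transpose x y"
    have sub: "X \<union> Y \<subseteq> {1..n}" using X Y tabloids_sub[OF T] by blast
    have s: "s permutes {1..n}" unfolding s_def using xy sub by (intro permutes_swap_id) auto
    \<comment> \<open>If both entries are dealt to the same row, this row meets column
      \<open>c\<close> twice. Only the \<open>Q\<close> that separate \<open>x\<close> from
      \<open>y\<close> contribute, and on these the transposition has no fixed point.\<close>
    have two: "?e (?E Q) = 0" if Q: "Q \<in> exchange_sets X Y" and "x \<in> Q \<longleftrightarrow> y \<in> Q" for Q
    proof -
      have "\<exists>r. {x, y} \<subseteq> ?E Q r"
        using that xy by (cases "x \<in> Q") (auto simp: exchange_def intro: exI[of _ i] exI[of _ "Suc i"])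
      then obtain r where "{x, y} \<subseteq> ?E Q r \<inter> ?W c" using xy by auto
      then have "card {x, y} \<le> card (?E Q r \<inter> ?W c)"
        by (intro card_mono finite_Int) (use tabloids_finite[OF W] in auto)
      then have "\<not> transversal l (?E Q) ?W"
        using xy(3) unfolding transversal_def
        by (metis One_nat_def card_2_iff not_numeral_le_zero of_bool_eq(1,2) one_le_numeral
            order_antisym numeral_eq_one_iff semiring_norm(85))
      then show ?thesis using e[OF Q] by simp
    qed
    have "(\<Sum>Q\<in>exchange_sets X Y. ?e (?E Q)) =
        (\<Sum>Q\<in>{Q\<in>exchange_sets X Y. (x \<in> Q) \<noteq> (y \<in> Q)}. ?e (?E Q))"
      by (rule sum.mono_neutral_right[OF finE]) (use two in auto)
    also have "\<dots> = 0"
    proof (rule sum_flip_zero[where h = "image s" and P = "\<lambda>Q. x \<in> Q"])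
      show "finite {Q\<in>exchange_sets X Y. (x \<in> Q) \<noteq> (y \<in> Q)}" using finE by simp
      fix Q assume Q: "Q \<in> {Q\<in>exchange_sets X Y. (x \<in> Q) \<noteq> (y \<in> Q)}"
      have inj: "inj_on s A" for A using permutes_inj[OF s] by (rule inj_on_subset) simp
      have mem: "z \<in> s ` A \<longleftrightarrow> s z \<in> A" for z A
        unfolding s_def by (auto simp: image_iff) (metis transpose_involutory)
      have XYs: "s z \<in> X \<union> Y \<longleftrightarrow> z \<in> X \<union> Y" for z
        using xy(1,2) by (auto simp: s_def transpose_def)
      have sQ: "s ` Q \<in> exchange_sets X Y"
        using Q xy(1,2) card_image[OF inj, of Q]
        by (auto simp: exchange_sets_def s_def transpose_def)
      have sz: "s z = z" if "z \<notin> X \<union> Y" for z using that xy(1,2) by (auto simp: s_def transpose_def)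
      show "s ` Q \<in> {Q\<in>exchange_sets X Y. (x \<in> Q) \<noteq> (y \<in> Q)}"
        using sQ Q xy(3) by (auto simp: mem) (auto simp: s_def)
      show "s ` s ` Q = Q" by (auto simp: mem) (simp_all add: s_def)
      show "x \<in> s ` Q \<longleftrightarrow> x \<notin> Q" using Q by (auto simp: mem) (auto simp: s_def)
      have notin: "s z \<in> T j \<longleftrightarrow> z \<in> T j" if "j \<noteq> i" "j \<noteq> Suc i" for z j
        using that X Y xy(1,2) tabloids_disj[OF T, of _ j i] tabloids_disj[OF T, of _ j "Suc i"]
        by (auto simp: s_def transpose_def)
      have out: "s z \<in> T j - (X \<union> Y) \<longleftrightarrow> z \<in> T j - (X \<union> Y)" for z j
        using sz[of z] XYs[of z] by (cases "z \<in> X \<union> Y") auto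
      have TX: "T i - X = T i - (X \<union> Y)" "T (Suc i) - Y = T (Suc i) - (X \<union> Y)"
        using X Y dis by auto
      have "?E (s ` Q) = tabloid_act s (?E Q)"
      proof (intro ext set_eqI)
        fix j z
        show "z \<in> ?E (s ` Q) j \<longleftrightarrow> z \<in> tabloid_act s (?E Q) j"
          unfolding tabloid_act_def mem exchange_def TX
          using notin[of j z] out[of z] XYs[of z]
          by (auto simp: mem)
      qed
      moreover have "tabloid_act s ?W = ?W"
        unfolding s_def using W xy(4,5) by (rule tabloid_act_transpose)
      ultimately have "transversal l (?E (s ` Q)) ?W \<longleftrightarrow> transversal l (?E Q) ?W"
        using transversal_act[OF s, of l "?E Q" ?W] by simp
      then show "?e (?E (s ` Q)) = - ?e (?E Q)"
        using e[OF sQ] e[of Q] Q by (simp add: uminus_char_two)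
    qed
    finally show ?thesis .
  next
    case False
    show ?thesis
    proof (rule sum.neutral, rule ballI, rule ccontr)
      fix Q assume Q: "Q \<in> exchange_sets X Y" and nz: "?e (?E Q) \<noteq> 0"
      then have tr: "transversal l (?E Q) ?W" using e[OF Q] by auto
      define f where "f x = (THE c. x \<in> ?W c)" for x
      have f: "x \<in> ?W (f x) \<and> f x < l i" if x: "x \<in> X \<union> Y" for x
      proof -
        have "x \<in> {1..n}" using X Y tabloids_sub[OF T] x by blast
        then obtain c where c: "x \<in> ?W c" using tabloids_cover[OF W] by blast
        then have "f x = c"
          unfolding f_def using tabloids_disj[OF W] by (intro the_equality) auto
        moreover have "c < l i"
        proof -
          obtain r where r: "r = i \<or> r = Suc i" "x \<in> ?E Q r"
          proof (cases "x \<in> Q")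
            case True
            then show thesis using that[of i] by (simp add: exchange_def)
          next
            case False
            then show thesis using that[of "Suc i"] x by (simp add: exchange_def)
          qed
          then have "card (?E Q r \<inter> ?W c) \<noteq> 0"
            using c tabloids_finite[OF W, of c] by auto
          then have "c < l r" using tr by (auto simp: transversal_def split: if_splits)
          then show ?thesis using r(1) part_antimono[OF l, of i "Suc i"] by auto
        qed
        ultimately show ?thesis using c by simp
      qed
      have "inj_on f (X \<union> Y)"
        using False f by (intro inj_onI) metis
      moreover have "f ` (X \<union> Y) \<subseteq> {..<l i}" using f by auto
      ultimately have "card (X \<union> Y) \<le> card {..<l i}" by (rule card_inj_on_le) simp
      moreover have "card (X \<union> Y) = card X + card Y"
        by (rule card_Un_disjoint) (use finXY X Y dis in auto)
      ultimately show False using card by simp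
    qed
  qed
qed

text \<open>Instead of a dimension count, an element of the Specht module is matched with
  \<open>f\<close> on the standard tabloids. The difference satisfies the relations, so
  straightening makes it vanish everywhere.\<close>

lemma garnir_in_specht:
  assumes l: "l \<in> partitions n" and f: "f \<in> supported (tabloids n l)" "garnir n l (f :: tabloid \<Rightarrow> 'k)"
  shows "f \<in> specht n l"
proof -
  obtain g where g: "g \<in> specht n l" and gf: "\<And>T. T \<in> tabloids n l \<Longrightarrow> standard T \<Longrightarrow> g T = f T"
    using specht_standard_interpolation[OF l] by blast
  have sub: "fun_vs.subspace {h :: tabloid \<Rightarrow> 'k. garnir n l h}"
    unfolding fun_vs.subspace_def garnir_def fscale_def
    by (auto simp: sum.distrib sum_distrib_left[symmetric])
  have "specht n l \<subseteq> {h :: tabloid \<Rightarrow> 'k. garnir n l h}"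
    unfolding specht_def by (rule fun_vs.span_minimal[OF _ sub]) (auto simp: polytabloid_garnir[OF l])
  then have "garnir n l (g - f)" using fun_vs.subspace_diff[OF sub, of g f] g f(2) by auto
  then have "(g - f) T = 0" if "T \<in> tabloids n l" for T
    by (rule garnir_standard_zero[OF l _ _ that]) (simp add: gf)
  moreover have "g T = f T" if "T \<notin> tabloids n l" for T
    using that supportedD[OF f(1)] supportedD[of g] specht_supported g by (metis subsetD)
  ultimately have "g = f" by (metis eq_iff_diff_eq_0 ext minus_apply)
  then show ?thesis using g by simp
qed

end

section \<open>Carter's criterion\<close>

lemma less_power_ell2: "a < 2 ^ ell2 a"
  unfolding ell2_def by (rule LeastI_ex) (use less_exp in blast)

lemma ell2_0 [simp]: "ell2 0 = 0"
  unfolding ell2_def by (rule Least_eq_0) simp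

lemma ell2_1 [simp]: "ell2 (Suc 0) = Suc 0"
proof -
  have "ell2 (Suc 0) \<noteq> 0" using less_power_ell2[of "Suc 0"] by (cases "ell2 (Suc 0)") auto
  moreover have "ell2 (Suc 0) \<le> 1" unfolding ell2_def by (rule Least_le) simp
  ultimately show ?thesis by simp
qed

definition columns_carter :: "(nat \<Rightarrow> nat \<Rightarrow> nat) \<Rightarrow> bool" where
  "columns_carter A \<longleftrightarrow> (\<forall>i j. 2 ^ ell2 (A (Suc i) j) dvd Suc (A i j))"

text \<open>Vandermonde's identity splits the coefficient. The summand at \<open>k = 0\<close>
  vanishes because \<open>b < c\<close>. For \<open>0 < k < 2 ^ e\<close> the factor
  \<open>m choose k\<close> is even, since \<open>k * (m choose k)\<close> is a multiple of
  \<open>m\<close> while \<open>2 ^ e\<close> does not divide \<open>k\<close>.\<close>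

lemma even_binomial:
  assumes "2 ^ e dvd (m::nat)" "b < c" "c < 2 ^ e"
  shows "even ((m + b) choose c)"
proof -
  have even: "even (m choose k)" if k: "0 < k" "k < 2 ^ e" for k
  proof (rule ccontr)
    assume "odd (m choose k)"
    then have "coprime (2 ^ e) (m choose k)" by simp
    moreover have "2 ^ e dvd k * (m choose k)"
      using assms(1) times_binomial_minus1_eq[OF k(1), of m] by (metis dvd_mult2)
    ultimately have "2 ^ e dvd k" by (simp add: coprime_dvd_mult_left_iff)
    then show False using k dvd_imp_le by fastforce
  qed
  have "even ((m choose k) * (b choose (c - k)))" if "k \<le> c" for k
    using even[of k] that assms(2,3) by (cases "k = 0") (auto simp: binomial_eq_0)
  then have "even (\<Sum>k\<le>c. (m choose k) * (b choose (c - k)))" by (intro dvd_sum) auto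
  then show ?thesis by (simp add: vandermonde)
qed

text \<open>The sets are grouped by their part outside \<open>R\<close>. Within a group the part
  inside \<open>R\<close> runs through all subsets of size \<open>m\<close>, so each nonempty group
  has \<open>card (Z \<inter> R) choose m\<close> members.\<close>

lemma card_family_even:
  assumes fin: "finite Z"
    and dep: "\<And>Q Q'. Q \<subseteq> Z \<Longrightarrow> Q' \<subseteq> Z \<Longrightarrow> Q - R = Q' - R \<Longrightarrow> card (Q \<inter> R) = card (Q' \<inter> R) \<Longrightarrow>
      P Q \<Longrightarrow> P Q'"
    and m: "\<And>Q. Q \<subseteq> Z \<Longrightarrow> P Q \<Longrightarrow> card (Q \<inter> R) = m"
    and even: "even (card (Z \<inter> R) choose m)"
  shows "even (card {Q. Q \<subseteq> Z \<and> P Q})"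
proof -
  let ?F = "{Q. Q \<subseteq> Z \<and> P Q}"
  have finF: "finite ?F" by (rule finite_subset[of _ "Pow Z"]) (use fin in auto)
  have "card ?F = (\<Sum>Q\<in>?F. 1)" by simp
  also have "\<dots> = (\<Sum>S\<in>(\<lambda>Q. Q - R) ` ?F. \<Sum>Q\<in>{Q \<in> ?F. Q - R = S}. 1)"
    by (rule sum.group[symmetric]) (use finF in auto)
  finally have eq: "card ?F = (\<Sum>S\<in>(\<lambda>Q. Q - R) ` ?F. card {Q \<in> ?F. Q - R = S})" by simp
  have "even (card {Q \<in> ?F. Q - R = S})" if "S \<in> (\<lambda>Q. Q - R) ` ?F" for S
  proof -
    obtain Q0 where Q0: "Q0 \<subseteq> Z" "P Q0" "S = Q0 - R" using \<open>S \<in> _\<close> by auto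
    have "bij_betw (\<lambda>Q. Q \<inter> R) {Q \<in> ?F. Q - R = S} {B. B \<subseteq> Z \<inter> R \<and> card B = m}"
    proof (rule bij_betw_byWitness[where f' = "\<lambda>B. B \<union> S"])
      show "\<forall>Q\<in>{Q \<in> ?F. Q - R = S}. Q \<inter> R \<union> S = Q" by auto
      show "\<forall>B\<in>{B. B \<subseteq> Z \<inter> R \<and> card B = m}. (B \<union> S) \<inter> R = B" using Q0 by auto
      show "(\<lambda>Q. Q \<inter> R) ` {Q \<in> ?F. Q - R = S} \<subseteq> {B. B \<subseteq> Z \<inter> R \<and> card B = m}"
        using m by auto
      show "(\<lambda>B. B \<union> S) ` {B. B \<subseteq> Z \<inter> R \<and> card B = m} \<subseteq> {Q \<in> ?F. Q - R = S}"
      proof (rule image_subsetI)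
        fix B assume "B \<in> {B. B \<subseteq> Z \<inter> R \<and> card B = m}"
        then have B: "B \<subseteq> Z \<inter> R" "card B = m" by auto
        have 1: "B \<union> S \<subseteq> Z" "(B \<union> S) - R = S" "(B \<union> S) \<inter> R = B" using B Q0 by auto
        have "P (B \<union> S)"
          by (rule dep[OF Q0(1) 1(1) _ _ Q0(2)]) (use 1 Q0 m[OF Q0(1,2)] B in auto)
        then show "B \<union> S \<in> {Q \<in> ?F. Q - R = S}" using 1 by auto
      qed
    qed
    then have "card {Q \<in> ?F. Q - R = S} = card {B. B \<subseteq> Z \<inter> R \<and> card B = m}"
      by (rule bij_betw_same_card)
    then show ?thesis using even n_subsets[of "Z \<inter> R" m] fin by simp
  qed
  then show ?thesis unfolding eq by (rule dvd_sum)
qed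

context char_two
begin

text \<open>The sum counts the ways to deal out the pool with the prescribed intersections. For a
  suitable block \<open>W j\<close>, fixing what happens outside the block leaves a binomial
  coefficient of choices inside, and the congruence in column \<open>j\<close> makes it
  even.\<close>

lemma incidence_garnir:
  assumes A: "columns_carter A" and W: "W \<in> tabloids n c" and c: "\<And>j. N \<le> j \<Longrightarrow> c j = 0"
  shows "garnir n l (incidence n l A W :: tabloid \<Rightarrow> 'k)"
  unfolding garnir_def
proof (intro ballI allI impI)
  fix T i X Y assume T: "T \<in> tabloids n l" and X: "X \<subseteq> T i" and Y: "Y \<subseteq> T (Suc i)"
    and card: "card X + card Y = Suc (l i)"
  let ?E = "exchange T i X Y"
  have fin: "finite (T i)" "finite (T (Suc i))" using tabloids_finite[OF T] by auto
  have finXY: "finite X" "finite Y" using fin X Y finite_subset by auto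
  have dis: "T i \<inter> T (Suc i) = {}" using tabloids_disj[OF T, of _ i "Suc i"] by auto
  define Z where "Z = X \<union> Y"
  have finZ: "finite Z" using finXY by (simp add: Z_def)
  have finE: "finite (exchange_sets X Y)"
    by (rule finite_subset[of _ "Pow Z"]) (use finZ in \<open>auto simp: exchange_sets_def Z_def\<close>)
  define P where "P Q \<longleftrightarrow> card Q = card X \<and> incident A (?E Q) W" for Q
  have "(\<Sum>Q\<in>exchange_sets X Y. incidence n l A W (?E Q)) =
      (\<Sum>Q\<in>exchange_sets X Y. of_bool (incident A (?E Q) W) :: 'k)"
    by (rule sum.cong) (simp_all add: incidence_def exchange_in_tabloids[OF T X Y])
  also have "\<dots> = of_nat (card {Q. Q \<subseteq> Z \<and> P Q})"
  proof -
    have "exchange_sets X Y \<inter> {Q. incident A (?E Q) W} = {Q. Q \<subseteq> Z \<and> P Q}"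
      by (auto simp: exchange_sets_def P_def Z_def)
    then show ?thesis using finE by simp
  qed
  also have "even (card {Q. Q \<subseteq> Z \<and> P Q})"
  proof (cases "{Q. Q \<subseteq> Z \<and> P Q} = {}")
    case False
    then obtain Q0 where Q0: "Q0 \<subseteq> Z" "P Q0" by auto
    have i_card: "card (?E Q i \<inter> W j) = card ((T i - X) \<inter> W j) + card (Q \<inter> W j)" if "Q \<subseteq> Z" for Q j
    proof -
      have "?E Q i \<inter> W j = ((T i - X) \<inter> W j) \<union> (Q \<inter> W j)" by (auto simp: exchange_def)
      then show ?thesis
        using that fin finZ finite_subset[OF that finZ] X Y dis
        by (simp only:) (rule card_Un_disjoint, auto simp: Z_def)
    qed
    have Si_card: "card (?E Q (Suc i) \<inter> W j) = card ((T (Suc i) - Y) \<inter> W j) + card ((Z - Q) \<inter> W j)"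
      if "Q \<subseteq> Z" for Q j
    proof -
      have "?E Q (Suc i) \<inter> W j = ((T (Suc i) - Y) \<inter> W j) \<union> ((Z - Q) \<inter> W j)"
        by (auto simp: exchange_def Z_def)
      then show ?thesis
        using that fin finZ X Y dis by (simp only:) (rule card_Un_disjoint, auto simp: Z_def)
    qed
    have compl: "card ((Z - Q) \<inter> W j) + card (Q \<inter> W j) = card (Z \<inter> W j)" if "Q \<subseteq> Z" for Q j
    proof -
      have "card ((Z - Q) \<inter> W j) + card (Q \<inter> W j) = card (((Z - Q) \<inter> W j) \<union> (Q \<inter> W j))"
        by (rule card_Un_disjoint[symmetric]) (use finZ finite_subset[OF that finZ] in auto)
      also have "((Z - Q) \<inter> W j) \<union> (Q \<inter> W j) = Z \<inter> W j" using that by auto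
      finally show ?thesis .
    qed
    \<comment> \<open>Pigeonhole over the blocks: the pool exceeds the row length by one, so row
      \<open>Suc i\<close> receives one entry more than row \<open>i\<close> keeps.\<close>
    have "\<exists>j. card ((T i - X) \<inter> W j) < card ((Z - Q0) \<inter> W j)"
    proof (rule ccontr)
      assume "\<not> ?thesis"
      then have "(\<Sum>j<N. card ((Z - Q0) \<inter> W j)) \<le> (\<Sum>j<N. card ((T i - X) \<inter> W j))"
        by (intro sum_mono) (simp add: not_less)
      moreover have sub: "Z - Q0 \<subseteq> {1..n}" "T i - X \<subseteq> {1..n}"
        using X Y tabloids_sub[OF T, of i] tabloids_sub[OF T, of "Suc i"] unfolding Z_def by blast+
      ultimately have "card (Z - Q0) \<le> card (T i - X)"
        using sum_card_Int_tabloid[OF W c sub(1)] sum_card_Int_tabloid[OF W c sub(2)] by simp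
      moreover have "card (T i - X) = l i - card X"
        using card_Diff_subset[OF finXY(1) X] tabloids_card[OF T, of i] by simp
      moreover have "card (Z - Q0) = card Z - card Q0"
        using Q0(1) finite_subset[OF Q0(1) finZ] by (intro card_Diff_subset)
      moreover have "card Z = card X + card Y"
        unfolding Z_def by (rule card_Un_disjoint) (use finXY X Y dis in auto)
      moreover have "card X \<le> l i" using card_mono[OF fin(1) X] tabloids_card[OF T, of i] by simp
      ultimately show False using Q0(2) card by (simp add: P_def)
    qed
    then obtain j where j: "card ((T i - X) \<inter> W j) < card ((Z - Q0) \<inter> W j)" ..
    define p where "p = card ((T i - X) \<inter> W j)"
    define m where "m = card (Q0 \<inter> W j)"
    define b where "b = card ((Z - Q0) \<inter> W j)"
    have inc: "A i j = p + card (Q \<inter> W j)" "b' = card ((Z - Q) \<inter> W j) \<Longrightarrow> b' \<le> A (Suc i) j"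
      if "Q \<subseteq> Z" "P Q" for Q b'
      using i_card[OF that(1), of j] Si_card[OF that(1), of j] that(2)
      by (auto simp: P_def incident_def p_def)
    have Ai: "A i j = p + m" using inc(1)[OF Q0] by (simp add: m_def)
    have "b \<le> A (Suc i) j" using inc(2)[OF Q0 b_def] .
    then have b_less: "b < 2 ^ ell2 (A (Suc i) j)" using less_power_ell2 le_less_trans by blast
    \<comment> \<open>The pool meets the block in \<open>m + b\<close> entries, and
      \<open>A i j = p + m\<close>. The excess \<open>b - p - 1\<close> over
      \<open>Suc (A i j)\<close> is less than \<open>b\<close>, as \<open>even_binomial\<close>
      demands.\<close>
    have "card (Z \<inter> W j) = Suc (A i j) + (b - p - 1)"
      using compl[OF Q0(1), of j] Ai j by (simp add: m_def b_def p_def)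
    moreover have "even ((Suc (A i j) + (b - p - 1)) choose b)"
    proof (rule even_binomial)
      show "2 ^ ell2 (A (Suc i) j) dvd Suc (A i j)" using A by (auto simp: columns_carter_def)
    qed (use j b_less in \<open>auto simp: b_def\<close>)
    moreover have "card (Z \<inter> W j) choose b = card (Z \<inter> W j) choose m"
    proof -
      have "b \<le> card (Z \<inter> W j)" "card (Z \<inter> W j) - b = m"
        using compl[OF Q0(1), of j] by (simp_all add: m_def b_def flip: compl[OF Q0(1), of j])
      then show ?thesis using binomial_symmetric[of b "card (Z \<inter> W j)"] by simp
    qed
    ultimately have even: "even (card (Z \<inter> W j) choose m)" by simp
    show ?thesis
    proof (rule card_family_even[OF finZ _ _ even])
      fix Q assume "Q \<subseteq> Z" "P Q"
      then show "card (Q \<inter> W j) = m" using inc(1) Ai by simp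
    next
      fix Q Q' assume Q: "Q \<subseteq> Z" "Q' \<subseteq> Z" "Q - W j = Q' - W j" "card (Q \<inter> W j) = card (Q' \<inter> W j)" "P Q"
      have same: "card (Q \<inter> W j') = card (Q' \<inter> W j')" for j'
      proof (cases "j' = j")
        case False
        then have "W j' \<inter> W j = {}" using tabloids_disj[OF W] by auto
        then have "Q \<inter> W j' = Q' \<inter> W j'" using Q(3) by blast
        then show ?thesis by simp
      qed (use Q in simp)
      have "card Q = card Q'"
      proof -
        have "card Q = card (Q \<inter> W j) + card (Q - W j)" "card Q' = card (Q' \<inter> W j) + card (Q' - W j)"
          using card_Int_Diff finite_subset[OF _ finZ] Q(1,2) by blast+
        then show ?thesis using Q(3,4) by simp
      qed
      moreover have "card (?E Q r \<inter> W j') = card (?E Q' r \<inter> W j')" for r j'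
      proof -
        consider "r = i" | "r = Suc i" | "r \<noteq> i" "r \<noteq> Suc i" by blast
        then show ?thesis
        proof cases
          case 1
          then show ?thesis using i_card Q(1,2) same by simp
        next
          case 2
          have "card ((Z - Q) \<inter> W j') = card ((Z - Q') \<inter> W j')"
            using compl[OF Q(1), of j'] compl[OF Q(2), of j'] same[of j'] by simp
          then show ?thesis using 2 Si_card Q(1,2) by simp
        next
          case 3
          then show ?thesis by (simp add: exchange_def)
        qed
      qed
      ultimately show "P Q'" using Q(5) by (simp add: P_def incident_def)
    qed
  next
    case True
    then show ?thesis by (simp only: card.empty) simp
  qed
  then have "of_nat (card {Q. Q \<subseteq> Z \<and> P Q}) = (0 :: 'k)" by (simp add: of_nat_char_two)
  finally show "(\<Sum>Q\<in>exchange_sets X Y. incidence n l A W (?E Q)) = (0 :: 'k)" .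
qed

lemma incidence_in_specht:
  assumes "l \<in> partitions n" "columns_carter A" "W \<in> tabloids n c" "\<And>j. N \<le> j \<Longrightarrow> c j = 0"
  shows "(incidence n l A W :: tabloid \<Rightarrow> 'k) \<in> specht n l"
  by (rule garnir_in_specht[OF assms(1) incidence_supported incidence_garnir[OF assms(2-4)]])

end

section \<open>Carter partitions: a symmetric idempotent and simplicity of the Specht module\<close>

section \<open>The reversal matrix\<close>

text \<open>The number of entries moving from row \<open>i\<close> to row \<open>j\<close> when every column is turned upside down:
  these are the columns of length \<open>i + j + 1\<close>.\<close>

definition reversal :: "(nat \<Rightarrow> nat) \<Rightarrow> nat \<Rightarrow> nat \<Rightarrow> nat" where
  "reversal l i j = l (i + j) - l (Suc (i + j))"

lemma incident_reversal_sym: "incident (reversal l) T W \<longleftrightarrow> incident (reversal l) W T"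
proof -
  have "incident (reversal l) W T" if "incident (reversal l) T W" for T W
    using that by (auto simp: incident_def reversal_def Int_commute add.commute)
  then show ?thesis by blast
qed

text \<open>A column of the reversal matrix runs through consecutive differences of
  \<open>l\<close>, so the congruence needed at \<open>i\<close>, \<open>j\<close> is Carter's
  criterion at row \<open>i + j\<close>.\<close>

lemma columns_carter_reversal:
  assumes l: "l \<in> partitions n" and c: "carter l"
  shows "columns_carter (reversal l)"
  unfolding columns_carter_def
proof (intro allI)
  fix i j
  let ?e = "ell2 (l (i + j + 1) - l (i + j + 2))"
  have "[int (l (i + j)) - int (l (i + j + 1)) = -1] (mod 2 ^ ?e)"
    using c unfolding carter_def by blast
  then have "2 ^ ?e dvd (int (l (i + j)) - int (l (i + j + 1)) - -1)" by (simp add: cong_iff_dvd_diff)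
  moreover have "int (l (i + j)) - int (l (i + j + 1)) - -1 = int (Suc (l (i + j) - l (i + j + 1)))"
    using part_antimono[OF l, of "i + j" "i + j + 1"] by (simp add: of_nat_diff)
  ultimately have "(2 :: int) ^ ?e dvd int (Suc (l (i + j) - l (i + j + 1)))" by (simp only:)
  then have "int (2 ^ ?e) dvd int (Suc (l (i + j) - l (i + j + 1)))"
    by (simp only: of_nat_power of_nat_numeral)
  then have "2 ^ ?e dvd Suc (l (i + j) - l (i + j + 1))" by (simp only: of_nat_dvd_iff)
  then show "2 ^ ell2 (reversal l (Suc i) j) dvd Suc (reversal l i j)" by (simp add: reversal_def)
qed

definition flip :: "(nat \<Rightarrow> nat) \<Rightarrow> nat \<times> nat \<Rightarrow> nat \<times> nat" where
  "flip l = (\<lambda>(i, j). (conj_part l j - Suc i, j))"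

lemma flip_flip:
  assumes "l \<in> partitions n" "j < l i"
  shows "flip l (flip l (i, j)) = (i, j)"
  using less_conj_part[OF assms(1), of i j] assms(2) by (auto simp: flip_def)

lemma flip_diagram:
  assumes "l \<in> partitions n" "j < l i"
  shows "j < l (conj_part l j - Suc i)"
  using less_conj_part[OF assms(1), of i j] less_conj_part[OF assms(1), of "conj_part l j - Suc i" j] assms(2)
  by simp

lemma tableau_flip:
  assumes l: "l \<in> partitions n" and t: "tableau n l t"
  shows "tableau n l (t \<circ> flip l)"
  unfolding tableau_def
proof (rule bij_betw_trans)
  show "bij_betw (flip l) (diagram l) (diagram l)"
    by (rule bij_betw_byWitness[where f' = "flip l"])
      (use flip_flip[OF l] flip_diagram[OF l] in \<open>auto simp: diagram_def\<close>, auto simp: flip_def)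
qed (use t in \<open>simp add: tableau_def\<close>)

lemma col_tabloid_flip:
  assumes l: "l \<in> partitions n"
  shows "col_tabloid l (t \<circ> flip l) = col_tabloid l t"
proof (intro ext equalityI subsetI)
  fix j x assume "x \<in> col_tabloid l (t \<circ> flip l) j"
  then show "x \<in> col_tabloid l t j"
    using flip_diagram[OF l] by (auto simp: col_tabloid_def diagram_def flip_def)
next
  fix j x assume "x \<in> col_tabloid l t j"
  then obtain i where i: "j < l i" "x = t (i, j)" by (auto simp: col_tabloid_def diagram_def)
  have "x = (t \<circ> flip l) (conj_part l j - Suc i, j)"
    using flip_flip[OF l i(1)] i(2) by (simp add: flip_def)
  then show "x \<in> col_tabloid l (t \<circ> flip l) j"
    using flip_diagram[OF l i(1)] by (auto simp: col_tabloid_def diagram_def)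
qed

text \<open>Turning column \<open>c\<close> upside down exchanges rows \<open>a\<close> and
  \<open>i\<close> exactly when the column has length \<open>a + i + 1\<close>, and a difference of
  consecutive parts counts the columns of a given length.\<close>

lemma incident_flip:
  assumes l: "l \<in> partitions n" and t: "tableau n l t"
  shows "incident (reversal l) (tabloid_of l (t \<circ> flip l)) (tabloid_of l t)"
  unfolding incident_def
proof (intro allI)
  fix i a
  have eq: "tabloid_of l (t \<circ> flip l) i \<inter> tabloid_of l t a = (\<lambda>c. t (a, c)) ` {c. conj_part l c = Suc (a + i)}"
    (is "?L = ?R")
  proof (intro equalityI subsetI)
    fix x assume "x \<in> ?L"
    then obtain c c' where c: "c < l i" "x = t (conj_part l c - Suc i, c)" "c' < l a" "x = t (a, c')"
      by (auto simp: tabloid_of_alt flip_def)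
    then have "conj_part l c - Suc i = a" "c = c'"
      using tableau_eq_iff[OF t flip_diagram[OF l c(1)] c(3)] by auto
    then have "conj_part l c = Suc (a + i)" using less_conj_part[OF l, of i c] c(1) by auto
    then show "x \<in> ?R" using c(4) \<open>c = c'\<close> by auto
  next
    fix x assume "x \<in> ?R"
    then obtain c where c: "conj_part l c = Suc (a + i)" "x = t (a, c)" by auto
    then have "c < l a" "c < l i"
      using less_conj_part[OF l, of a c] less_conj_part[OF l, of i c] by auto
    then show "x \<in> ?L" using c by (auto simp: tabloid_of_alt flip_def intro!: image_eqI[of _ _ c])
  qed
  have set: "{c. conj_part l c = Suc (a + i)} = {l (Suc (a + i))..<l (a + i)}"
  proof (intro set_eqI)
    fix c
    have "conj_part l c = Suc (a + i) \<longleftrightarrow> a + i < conj_part l c \<and> \<not> Suc (a + i) < conj_part l c" by auto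
    then show "c \<in> {c. conj_part l c = Suc (a + i)} \<longleftrightarrow> c \<in> {l (Suc (a + i))..<l (a + i)}"
      unfolding less_conj_part[OF l] by auto
  qed
  have "inj_on (\<lambda>c. t (a, c)) {l (Suc (a + i))..<l (a + i)}"
    using tableau_eq_iff[OF t] part_antimono[OF l, of a "a + i"] by (auto intro!: inj_onI)
  then show "card (tabloid_of l (t \<circ> flip l) i \<inter> tabloid_of l t a) = reversal l i a"
    unfolding eq set by (simp add: card_image reversal_def add.commute)
qed

lemma tabloids_eqI:
  assumes T: "T \<in> tabloids n l" and U: "U \<in> tabloids n l" and sub: "\<And>i. T i \<subseteq> U i"
  shows "T = U"
proof
  fix i
  show "T i = U i"
    using card_subset_eq[OF tabloids_finite[OF U] sub] tabloids_card[OF T, of i] tabloids_card[OF U, of i]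
    by simp
qed

definition row_index :: "tabloid \<Rightarrow> nat \<Rightarrow> nat" where
  "row_index T x = (THE i. x \<in> T i)"

lemma row_index_eq:
  assumes "T \<in> tabloids n l" "x \<in> T i"
  shows "row_index T x = i"
  unfolding row_index_def
  by (rule the_equality) (use assms tabloids_disj[OF assms(1)] in auto)

lemma row_index_mem:
  assumes "T \<in> tabloids n l" "x \<in> {1..n}"
  shows "x \<in> T (row_index T x)"
  using assms tabloids_cover[OF assms] row_index_eq[OF assms(1)] by metis

text \<open>Intersection numbers determine the total row index over a set. Applied to a row of
  \<open>t\<close>, this is the total displacement used in the uniqueness argument below.\<close>

lemma sum_row_index:
  assumes l: "l \<in> partitions n" and T: "T \<in> tabloids n l" and A: "A \<subseteq> {1..n}"
  shows "(\<Sum>x\<in>A. row_index T x) = (\<Sum>i<n. i * card (T i \<inter> A))"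
proof -
  have finA: "finite A" using A finite_subset by blast
  have lt: "row_index T x \<in> {..<n}" if "x \<in> A" for x
  proof -
    have "x \<in> T (row_index T x)" using row_index_mem[OF T] A that by blast
    then have "l (row_index T x) \<noteq> 0" using tabloids_empty[OF T] by fastforce
    then show ?thesis using part_zero[OF l] by (meson lessThan_iff not_le)
  qed
  have "(\<Sum>x\<in>A. row_index T x) = (\<Sum>i<n. \<Sum>x\<in>{x \<in> A. row_index T x = i}. row_index T x)"
    by (rule sum.group[symmetric]) (use finA lt in auto)
  also have "\<dots> = (\<Sum>i<n. i * card (T i \<inter> A))"
  proof (rule sum.cong)
    fix i
    have "{x \<in> A. row_index T x = i} = T i \<inter> A"
      using A row_index_mem[OF T] row_index_eq[OF T] by blast
    moreover have "(\<Sum>x\<in>{x \<in> A. row_index T x = i}. row_index T x) = (\<Sum>x\<in>{x \<in> A. row_index T x = i}. i)"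
      by (rule sum.cong) auto
    ultimately show "(\<Sum>x\<in>{x \<in> A. row_index T x = i}. row_index T x) = i * card (T i \<inter> A)" by simp
  qed simp
  finally show ?thesis .
qed

text \<open>A column transversal meeting the rows of \<open>t\<close> as prescribed by the reversal matrix has to turn
  every column upside down: from the bottom row upwards, each entry goes at least as low as its mirror image,
  and the total displacement of the row is prescribed.\<close>

lemma reversal_transversal_unique:
  assumes l: "l \<in> partitions n" and t: "tableau n l t" and T: "T \<in> tabloids n l"
    and tr: "transversal l T (col_tabloid l t)" and inc: "incident (reversal l) T (tabloid_of l t)"
  shows "T = tabloid_of l (t \<circ> flip l)"
proof -
  let ?R = "tabloid_of l (t \<circ> flip l)"
  have t': "tableau n l (t \<circ> flip l)" using l t by (rule tableau_flip)
  have R: "?R \<in> tabloids n l" using t' by (rule tabloid_of_in_tabloids)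
  have Rmem: "t (a, c) \<in> ?R (conj_part l c - Suc a)" if "c < l a" for a c
  proof -
    have "t (a, c) = (t \<circ> flip l) (conj_part l c - Suc a, c)"
      using flip_flip[OF l that] by (simp add: flip_def)
    then show ?thesis using flip_diagram[OF l that] by (auto simp: tabloid_of_alt)
  qed
  have main: "row_index T (t (a, c)) = conj_part l c - Suc a" if "c < l a" for a c
    using that
  proof (induction "n - a" arbitrary: a c rule: less_induct)
    case less
    have "l a \<noteq> 0" using less.prems by auto
    then have an: "a < n" using part_zero[OF l] by (meson not_le)
    have ge: "conj_part l c - Suc a \<le> row_index T (t (a, c))" if c: "c < l a" for c
    proof (rule ccontr)
      define i where "i = row_index T (t (a, c))"
      assume "\<not> conj_part l c - Suc a \<le> row_index T (t (a, c))"
      then have i: "i < conj_part l c - Suc a" by (simp add: i_def)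
      \<comment> \<open>The row whose mirror image in column \<open>c\<close> is row
        \<open>i\<close>. It lies below \<open>a\<close>, so by induction its entry already occupies
        row \<open>i\<close> of \<open>T\<close>, which has no place for a second entry of this
        column.\<close>
      define a' where "a' = conj_part l c - Suc i"
      have a': "a < a'" "a' < conj_part l c" using i by (auto simp: a'_def)
      then have ca': "c < l a'" using less_conj_part[OF l] by blast
      have "row_index T (t (a', c)) = conj_part l c - Suc a'"
        by (rule less.hyps[OF _ ca']) (use a' an in auto)
      also have "\<dots> = i" using i by (simp add: a'_def)
      finally have "t (a', c) \<in> T i" "t (a, c) \<in> T i"
        using row_index_mem[OF T tableau_in[OF t ca']] row_index_mem[OF T tableau_in[OF t c]]
        by (simp_all add: i_def)
      moreover have "t (a', c) \<in> col_tabloid l t c" "t (a, c) \<in> col_tabloid l t c"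
        using mem_col_tabloid[OF t] c ca' by auto
      ultimately have "card {t (a, c), t (a', c)} \<le> card (T i \<inter> col_tabloid l t c)"
        by (intro card_mono) (use tabloids_finite[OF T] in auto)
      moreover have "t (a, c) \<noteq> t (a', c)" using tableau_eq_iff[OF t c ca'] a'(1) by simp
      ultimately have "2 \<le> card (T i \<inter> col_tabloid l t c)" by simp
      moreover have "card (T i \<inter> col_tabloid l t c) \<le> 1" using tr by (simp add: transversal_def)
      ultimately show False by simp
    qed
    have inj: "inj_on (\<lambda>c. t (a, c)) {..<l a}"
      using tableau_eq_iff[OF t] by (auto intro!: inj_onI)
    have sub: "tabloid_of l t a \<subseteq> {1..n}" using tabloids_sub[OF tabloid_of_in_tabloids[OF t]] .
    have sums: "(\<Sum>c<l a. row_index U (t (a, c))) = (\<Sum>i<n. i * reversal l i a)"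
      if U: "U \<in> tabloids n l" "incident (reversal l) U (tabloid_of l t)" for U
    proof -
      have "(\<Sum>x\<in>tabloid_of l t a. row_index U x) = (\<Sum>c<l a. row_index U (t (a, c)))"
        unfolding tabloid_of_alt by (subst sum.reindex[OF inj]) simp
      then show ?thesis
        using sum_row_index[OF l U(1) sub] U(2) by (simp add: incident_def)
    qed
    have "(\<Sum>c<l a. conj_part l c - Suc a) = (\<Sum>c<l a. row_index ?R (t (a, c)))"
      by (rule sum.cong) (simp_all add: row_index_eq[OF R Rmem] del: comp_apply)
    then have total: "(\<Sum>c<l a. conj_part l c - Suc a) = (\<Sum>c<l a. row_index T (t (a, c)))"
      using sums[OF T inc] sums[OF R incident_flip[OF l t]] by simp
    show ?case
    proof (rule ccontr)
      assume "row_index T (t (a, c)) \<noteq> conj_part l c - Suc a"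
      then have "conj_part l c - Suc a < row_index T (t (a, c))" using ge[OF less.prems] by simp
      then have "(\<Sum>c<l a. conj_part l c - Suc a) < (\<Sum>c<l a. row_index T (t (a, c)))"
        using ge less.prems by (intro sum_strict_mono_ex1) auto
      then show False using total by simp
    qed
  qed
  show ?thesis
  proof (rule tabloids_eqI[OF T R])
    show "T i \<subseteq> ?R i" for i
    proof
      fix x assume x: "x \<in> T i"
      then have "x \<in> {1..n}" using tabloids_sub[OF T] by blast
      then obtain a c where ac: "c < l a" "x = t (a, c)" using tableau_cover[OF t] by blast
      then have "i = conj_part l c - Suc a" using main[OF ac(1)] row_index_eq[OF T x] by simp
      then show "x \<in> ?R i" using Rmem[OF ac(1)] ac(2) by simp
    qed
  qed
qed

lemma reversal_transversal_iff:
  assumes l: "l \<in> partitions n" and t: "tableau n l t" and T: "T \<in> tabloids n l"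
  shows "transversal l T (col_tabloid l t) \<and> incident (reversal l) T (tabloid_of l t) \<longleftrightarrow>
    T = tabloid_of l (t \<circ> flip l)"
  using reversal_transversal_unique[OF l t T] incident_flip[OF l t]
    transversal_tableau[OF tableau_flip[OF l t]] col_tabloid_flip[OF l, of t] by auto

abbreviation perms :: "nat \<Rightarrow> (nat \<Rightarrow> nat) set" where
  "perms n \<equiv> {p. p permutes {1..n}}"

lemma finite_perms: "finite (perms n)"
  by (rule finite_permutations) simp

definition form :: "nat \<Rightarrow> (nat \<Rightarrow> nat) \<Rightarrow> (tabloid \<Rightarrow> 'k::field) \<Rightarrow> (tabloid \<Rightarrow> 'k) \<Rightarrow> 'k" where
  "form n l u v = (\<Sum>T\<in>tabloids n l. u T * v T)"

lemma form_commute: "form n l u v = form n l v u"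
  by (simp add: form_def mult.commute)

lemma sum_tabloids_act:
  assumes "p permutes {1..n}"
  shows "(\<Sum>T\<in>tabloids n l. f T) = (\<Sum>T\<in>tabloids n l. f (tabloid_act p T))"
  by (rule sum.reindex_bij_witness[of _ "tabloid_act p" "tabloid_act (inv p)"])
    (simp_all add: tabloid_act_inv[OF assms] tabloid_act_in_tabloids[OF assms]
      tabloid_act_in_tabloids[OF permutes_inv[OF assms]])

lemma sum_perms_left:
  assumes p: "p permutes {1..n}"
  shows "(\<Sum>g\<in>perms n. f g) = (\<Sum>g\<in>perms n. f (p \<circ> g))"
proof (rule sum.reindex_bij_witness[of _ "\<lambda>g. p \<circ> g" "\<lambda>g. inv p \<circ> g"])
  fix g :: "nat \<Rightarrow> nat"
  show "p \<circ> (inv p \<circ> g) = g" "inv p \<circ> (p \<circ> g) = g"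
    using permutes_inv_o[OF p] by (simp_all add: comp_assoc[symmetric])
  show "inv p \<circ> g \<in> perms n" "p \<circ> g \<in> perms n" if "g \<in> perms n"
    using that p by (auto intro: permutes_compose permutes_inv)
  show "f (p \<circ> (inv p \<circ> g)) = f g"
    using permutes_inv_o[OF p] by (simp add: comp_assoc[symmetric])
qed

lemma form_polytabloid:
  assumes l: "l \<in> partitions n" and t: "tableau n l t"
  shows "form n l f (polytabloid n l t) =
    (\<Sum>p\<in>column_stabilizer n l t. of_int (sign p) * f (tabloid_act p (tabloid_of l t)))"
proof -
  have "form n l f (polytabloid n l t) = (\<Sum>p\<in>column_stabilizer n l t. \<Sum>T\<in>tabloids n l.
      f T * (of_int (sign p) * (if T = tabloid_act p (tabloid_of l t) then 1 else 0)))"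
    unfolding form_def polytabloid_def by (simp add: sum_distrib_left sum.swap[of _ "tabloids n l"])
  also have "\<dots> = (\<Sum>p\<in>column_stabilizer n l t. of_int (sign p) * f (tabloid_act p (tabloid_of l t)))"
  proof (rule sum.cong)
    fix p assume "p \<in> column_stabilizer n l t"
    then have "tabloid_act p (tabloid_of l t) \<in> tabloids n l"
      using tabloid_act_in_tabloids tabloid_of_in_tabloids[OF t] column_stabilizer_permutes by blast
    then show "(\<Sum>T\<in>tabloids n l. f T * (of_int (sign p) * (if T = tabloid_act p (tabloid_of l t) then 1 else 0))) =
        of_int (sign p) * f (tabloid_act p (tabloid_of l t))"
      using finite_tabloids[OF l] by (simp add: if_distrib[of "\<lambda>x. _ * x"] mult.commute cong: if_cong)
  qed simp
  finally show ?thesis .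
qed

lemma column_sum_form:
  assumes "l \<in> partitions n" "tableau n l t" "f \<in> supported (tabloids n l)"
  shows "column_sum n l t f = fscale (form n l f (polytabloid n l t)) (polytabloid n l t)"
  unfolding form_polytabloid[OF assms(1,2)] by (rule column_sum_same_shape[OF assms])

lemma equivariant_column_sum:
  fixes h :: "(tabloid \<Rightarrow> 'k::field) \<Rightarrow> tabloid \<Rightarrow> 'k"
  assumes add: "\<And>f g. h (f + g) = h f + h g" and scale: "\<And>c f. h (fscale c f) = fscale c (h f)"
    and eqv: "\<And>p f. p permutes {1..n} \<Longrightarrow> h (act p f) = act p (h f)"
  shows "h (column_sum n l t f) = column_sum n l t (h f)"
proof -
  have zero: "h 0 = 0" using scale[of 0 0] by (simp add: fscale_def zero_fun_def)
  have "h (\<Sum>p\<in>A. g p) = (\<Sum>p\<in>A. h (g p))" for A and g :: "(nat \<Rightarrow> nat) \<Rightarrow> tabloid \<Rightarrow> 'k"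
    by (induction A rule: infinite_finite_induct) (simp_all only: zero add sum.infinite sum.empty sum.insert not_False_eq_True)
  then show ?thesis
    unfolding column_sum_def using eqv column_stabilizer_permutes by (auto simp: scale intro!: sum.cong)
qed

lemma linear_fixes_span:
  fixes h :: "('t \<Rightarrow> 'k::field) \<Rightarrow> 't \<Rightarrow> 'k"
  assumes add: "\<And>f g. h (f + g) = h f + h g" and scale: "\<And>c f. h (fscale c f) = fscale c (h f)"
    and fixed: "\<And>f. f \<in> B \<Longrightarrow> h f = f" and u: "u \<in> fun_vs.span B"
  shows "h u = u"
proof -
  have "h 0 = 0" using scale[of 0 0] by (simp add: fscale_def zero_fun_def)
  then have "fun_vs.subspace {u. h u = u}"
    by (intro fun_vs.subspaceI) (simp_all only: mem_Collect_eq add scale)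
  then have "fun_vs.span B \<subseteq> {u. h u = u}" using fixed by (intro fun_vs.span_minimal) auto
  then show ?thesis using u by auto
qed

text \<open>Functions on triples of tabloids stand for tensors, and this is the norm of a pure
  tensor. There is no division by the group order, which is zero in characteristic two once
  \<open>2 \<le> n\<close>.\<close>

definition orbit_sum :: "nat \<Rightarrow> (tabloid \<Rightarrow> 'k::field) \<Rightarrow> (tabloid \<Rightarrow> 'k) \<Rightarrow> (tabloid \<Rightarrow> 'k) \<Rightarrow>
    tabloid \<times> tabloid \<times> tabloid \<Rightarrow> 'k" where
  "orbit_sum n v1 v2 v3 = (\<lambda>(T1, T2, T3). \<Sum>p\<in>perms n. act p v1 T1 * act p v2 T2 * act p v3 T3)"

context char_two
begin

definition rev_vec :: "nat \<Rightarrow> (nat \<Rightarrow> nat) \<Rightarrow> tabloid \<Rightarrow> tabloid \<Rightarrow> 'k" where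
  "rev_vec n l T = incidence n l (reversal l) T"

text \<open>The operator whose matrix is the reversal incidence. The matrix is symmetric, so the
  operator is self-adjoint with respect to \<open>form\<close>.\<close>

definition rev_map :: "nat \<Rightarrow> (nat \<Rightarrow> nat) \<Rightarrow> (tabloid \<Rightarrow> 'k) \<Rightarrow> tabloid \<Rightarrow> 'k" where
  "rev_map n l f = (\<Sum>R\<in>tabloids n l. fscale (f R) (rev_vec n l R))"

lemma rev_vec_sym:
  assumes "T \<in> tabloids n l" "R \<in> tabloids n l"
  shows "rev_vec n l T R = rev_vec n l R T"
  using assms incident_reversal_sym[of l T R] by (simp add: rev_vec_def incidence_def)

lemma act_rev_vec: "p permutes {1..n} \<Longrightarrow> act p (rev_vec n l T) = rev_vec n l (tabloid_act p T)"
  unfolding rev_vec_def by (rule act_incidence)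

lemma rev_vec_supported: "rev_vec n l T \<in> supported (tabloids n l)"
  unfolding rev_vec_def by (rule incidence_supported)

lemma rev_map_apply: "rev_map n l f T = (\<Sum>R\<in>tabloids n l. f R * rev_vec n l R T)"
  by (simp add: rev_map_def sum_fun_apply fscale_def)

lemma rev_map_add: "rev_map n l (f + g) = rev_map n l f + rev_map n l g"
  and rev_map_scale: "rev_map n l (fscale c f) = fscale c (rev_map n l f)"
  by (auto simp: fun_eq_iff rev_map_apply fscale_def sum.distrib sum_distrib_left algebra_simps)

lemma rev_map_act:
  assumes p: "p permutes {1..n}"
  shows "rev_map n l (act p f) = act p (rev_map n l f)"
proof -
  have "rev_map n l (act p f) =
      (\<Sum>R\<in>tabloids n l. fscale (act p f (tabloid_act p R)) (rev_vec n l (tabloid_act p R)))"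
    unfolding rev_map_def by (rule sum_tabloids_act[OF p])
  then show ?thesis
    by (simp add: rev_map_def act_sum act_scale act_rev_vec[OF p] act_def[of p f] tabloid_act_inv[OF p])
qed

lemma rev_map_delta:
  assumes "l \<in> partitions n" "T \<in> tabloids n l"
  shows "rev_map n l (delta T) = rev_vec n l T"
proof
  fix U
  have "rev_map n l (delta T) U = (\<Sum>R\<in>tabloids n l. if R = T then rev_vec n l R U else 0)"
    unfolding rev_map_apply delta_def by (rule sum.cong) auto
  then show "rev_map n l (delta T) U = rev_vec n l T U"
    using assms finite_tabloids[OF assms(1)] by simp
qed

text \<open>By \<open>reversal_transversal_iff\<close> the two supports share a single tabloid, the
  columnwise reversal of \<open>t\<close>.\<close>

lemma form_rev_vec_polytabloid:
  assumes l: "l \<in> partitions n" and t: "tableau n l t"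
  shows "form n l (rev_vec n l (tabloid_of l t)) (polytabloid n l t) = 1"
proof -
  let ?R = "tabloid_of l (t \<circ> flip l)"
  have R: "?R \<in> tabloids n l" by (intro tabloid_of_in_tabloids tableau_flip l t)
  have "form n l (rev_vec n l (tabloid_of l t)) (polytabloid n l t) =
      (\<Sum>T\<in>tabloids n l. if T = ?R then 1 else 0)"
    unfolding form_def
  proof (rule sum.cong)
    fix T assume T: "T \<in> tabloids n l"
    show "rev_vec n l (tabloid_of l t) T * polytabloid n l t T = (if T = ?R then 1 else 0)"
      using reversal_transversal_iff[OF l t T] T
      by (auto simp: rev_vec_def polytabloid_char_two[OF l t] incidence_def transversal_incident)
  qed simp
  then show ?thesis using R finite_tabloids[OF l] by simp
qed

text \<open>A polytabloid is the column sum of one tabloid, and the operator commutes with column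
  sums. So the image is the column sum of a \<open>rev_vec\<close>, hence a multiple of the
  polytabloid; the factor is the pairing just shown to be 1.\<close>

lemma rev_map_polytabloid:
  assumes l: "l \<in> partitions n" and t: "tableau n l t"
  shows "rev_map n l (polytabloid n l t) = polytabloid n l t"
proof -
  have "rev_map n l (polytabloid n l t) = column_sum n l t (rev_map n l (delta (tabloid_of l t)))"
    unfolding polytabloid_column_sum
    by (intro equivariant_column_sum rev_map_add rev_map_scale rev_map_act)
  also have "\<dots> = polytabloid n l t"
    unfolding rev_map_delta[OF l tabloid_of_in_tabloids[OF t]]
      column_sum_form[OF l t rev_vec_supported] form_rev_vec_polytabloid[OF l t]
    by (simp add: fscale_def)
  finally show ?thesis .
qed

lemma rev_map_specht:
  assumes l: "l \<in> partitions n" and u: "u \<in> specht n l"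
  shows "rev_map n l u = u"
  by (rule linear_fixes_span[OF rev_map_add rev_map_scale _ u[unfolded specht_def]])
    (auto simp: rev_map_polytabloid[OF l])

text \<open>The operator fixes \<open>u\<close>, and the symmetry of its matrix turns a value into a
  pairing.\<close>

lemma specht_apply_form:
  assumes l: "l \<in> partitions n" and u: "u \<in> specht n l" and T: "T \<in> tabloids n l"
  shows "u T = form n l u (rev_vec n l T)"
proof -
  have "u T = rev_map n l u T" using rev_map_specht[OF l u] by simp
  also have "\<dots> = form n l u (rev_vec n l T)"
    unfolding rev_map_apply form_def using rev_vec_sym[OF T] by simp
  finally show ?thesis .
qed

lemma rev_vec_in_specht:
  assumes l: "l \<in> partitions n" and c: "carter l" and T: "T \<in> tabloids n l"
  shows "rev_vec n l T \<in> specht n l"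
  unfolding rev_vec_def
  by (rule incidence_in_specht[OF l columns_carter_reversal[OF l c] T, of n]) (rule part_zero[OF l])

text \<open>The value of \<open>u\<close> at a tabloid is its pairing with a \<open>rev_vec\<close>,
  which lies in the Specht module by Carter's criterion. So an element orthogonal to all
  polytabloids is zero.\<close>

lemma carter_form_nondegenerate:
  assumes l: "l \<in> partitions n" and c: "carter l" and u: "u \<in> specht n l" "u \<noteq> (0 :: tabloid \<Rightarrow> 'k)"
  obtains s where "tableau n l s" "form n l u (polytabloid n l s) \<noteq> 0"
proof -
  have "\<exists>s. tableau n l s \<and> form n l u (polytabloid n l s) \<noteq> 0"
  proof (rule ccontr)
    assume "\<not> ?thesis"
    then have zero: "form n l u (polytabloid n l s) = 0" if "tableau n l s" for s using that by blast
    have "fun_vs.subspace {v. form n l u v = 0}"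
      by (auto simp: fun_vs.subspace_def form_def fscale_def algebra_simps sum.distrib
          simp flip: sum_distrib_left)
    then have "specht n l \<subseteq> {v. form n l u v = 0}"
      unfolding specht_def by (intro fun_vs.span_minimal) (auto simp: zero)
    then have "u T = 0" if "T \<in> tabloids n l" for T
      using specht_apply_form[OF l u(1) that] rev_vec_in_specht[OF l c that] by auto
    moreover have "u T = 0" if "T \<notin> tabloids n l" for T
      using that u(1) specht_supported supportedD by (metis subsetD)
    ultimately show False using u(2) by (metis ext zero_fun_apply)
  qed
  then show thesis using that by blast
qed

text \<open>James's submodule argument: the column sum of an element of \<open>U\<close> is a
  multiple of a polytabloid, with a nonzero factor for a suitable tableau. So \<open>U\<close>
  contains a polytabloid, and one polytabloid generates the Specht module.\<close>

lemma carter_specht_simple: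
  assumes l: "l \<in> partitions n" and c: "carter l"
    and U: "submodule n U" "U \<subseteq> specht n l" "U \<noteq> {0 :: tabloid \<Rightarrow> 'k}"
  shows "U = specht n l"
proof -
  have sub: "fun_vs.subspace U" using U(1) by (rule submoduleD)
  then have "0 \<in> U" by (rule fun_vs.subspace_0)
  then obtain u where u: "u \<in> U" "u \<noteq> 0" using U(3) by blast
  then obtain s where s: "tableau n l s" "form n l u (polytabloid n l s) \<noteq> 0"
    using carter_form_nondegenerate[OF l c _ u(2)] U(2) by blast
  let ?c = "form n l u (polytabloid n l s)" and ?e = "polytabloid n l s :: tabloid \<Rightarrow> 'k"
  have "column_sum n l s u = fscale ?c ?e"
    by (rule column_sum_form[OF l s(1)]) (use u U(2) specht_supported in blast)
  then have "fscale ?c ?e \<in> U" using column_sum_in_submodule[OF U(1) u(1)] by metis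
  then have "fscale (inverse ?c) (fscale ?c ?e) \<in> U" by (rule fun_vs.subspace_scale[OF sub])
  then have "?e \<in> U" using s(2) by simp
  then show ?thesis using specht_subset_submodule[OF U(1) s(1)] U(2) by blast
qed

lemma polytabloid_nonzero:
  assumes "tableau n l t"
  shows "(polytabloid n l t :: tabloid \<Rightarrow> 'k) \<noteq> 0"
proof
  assume "(polytabloid n l t :: tabloid \<Rightarrow> 'k) = 0"
  then have "polytabloid n l t (tabloid_act id (tabloid_of l t)) = (0 :: 'k)" by simp
  then show False by (simp only: polytabloid_perm_value[OF assms column_stabilizer_id]) simp
qed

text \<open>By simplicity the zero module is a maximal submodule. Thus D(\<beta>) is S(\<beta>)
  itself, and a decomposition number counts factors isomorphic to a Specht module.\<close>

lemma carter_radical: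
  assumes l: "l \<in> partitions n" and c: "carter l"
  shows "radical n (specht n l :: (tabloid \<Rightarrow> 'k) set) = {0}"
proof -
  let ?S = "specht n l :: (tabloid \<Rightarrow> 'k) set"
  have zero_in: "0 \<in> U" if "submodule n U" for U :: "(tabloid \<Rightarrow> 'k) set"
    using submoduleD(1)[OF that] by (rule fun_vs.subspace_0)
  have sub0: "submodule n {0 :: tabloid \<Rightarrow> 'k}"
    by (auto simp: submodule_def fun_vs.subspace_def fscale_def zero_fun_def act_def)
  have "maximal_submodule n {0} ?S"
    unfolding maximal_submodule_def
  proof (intro conjI allI impI)
    obtain t where t: "tableau n l t" using tableau_exists[OF l] by blast
    show "{0} \<subset> ?S"
      using polytabloid_in_specht[OF t] polytabloid_nonzero[OF t] zero_in[OF submodule_specht] by blast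
    fix W :: "(tabloid \<Rightarrow> 'k) set" assume "submodule n W \<and> {0} \<subseteq> W \<and> W \<subseteq> ?S"
    then show "W = {0} \<or> W = ?S" using carter_specht_simple[OF l c] by blast
  qed (rule sub0 submodule_specht)+
  moreover have "0 \<in> U" if "maximal_submodule n U ?S" for U
    using that zero_in by (auto simp: maximal_submodule_def)
  ultimately show ?thesis
    unfolding radical_def using zero_in[OF submodule_specht] by blast
qed

end

section \<open>The staircase: projectivity of its Specht module and nonvanishing of norms\<close>

section \<open>Staircases\<close>

definition transposed :: "(nat \<times> nat \<Rightarrow> nat) \<Rightarrow> nat \<times> nat \<Rightarrow> nat" where
  "transposed t = (\<lambda>(i, j). t (j, i))"

lemma sum_staircase: "2 * (\<Sum>i<k. staircase k i) = k * (k + 1)"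
proof (induction k)
  case (Suc k)
  have "(\<Sum>i<Suc k. staircase (Suc k) i) = Suc k + (\<Sum>i<k. staircase k i)"
    by (simp add: sum.lessThan_Suc_shift staircase_def del: sum.lessThan_Suc)
  then show ?case using Suc by simp
qed simp

lemma staircase_partition:
  assumes "n = k * (k + 1) div 2"
  shows "staircase k \<in> partitions n"
  by (rule partitionsI[of _ k]) (use assms sum_staircase[of k] in \<open>auto simp: staircase_def\<close>)

lemma conj_staircase [simp]: "conj_part (staircase k) = staircase k"
  by (rule ext, rule conj_part_eq) (auto simp: staircase_def)

text \<open>Neighbouring parts differ by one until they are zero, so the reversal matrix is the
  diagram itself, and reversal incidence becomes transversality. As the staircase is its own
  conjugate, every \<open>rev_vec\<close> of a tabloid of this shape is then a polytabloid.\<close>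

lemma reversal_staircase: "reversal (staircase k) = (\<lambda>i j. of_bool (j < staircase k i))"
  by (auto simp: fun_eq_iff reversal_def staircase_def)

lemma tableau_transposed:
  assumes "tableau n (staircase k) t"
  shows "tableau n (staircase k) (transposed t)"
proof -
  have "bij_betw (\<lambda>(i, j). (j, i)) (diagram (staircase k)) (diagram (staircase k))"
    by (rule bij_betw_byWitness[where f' = "\<lambda>(i, j). (j, i)"]) (auto simp: diagram_def staircase_def)
  then have "bij_betw (t \<circ> (\<lambda>(i, j). (j, i))) (diagram (staircase k)) {1..n}"
    by (rule bij_betw_trans) (use assms in \<open>simp add: tableau_def\<close>)
  moreover have "t \<circ> (\<lambda>(i, j). (j, i)) = transposed t" by (auto simp: transposed_def fun_eq_iff)
  ultimately show ?thesis by (simp add: tableau_def)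
qed

lemma tabloid_of_transposed: "tabloid_of (staircase k) (transposed t) = col_tabloid (staircase k) t"
  and col_tabloid_transposed: "col_tabloid (staircase k) (transposed t) = tabloid_of (staircase k) t"
  by (auto simp: tabloid_of_def col_tabloid_def transposed_def diagram_def staircase_def fun_eq_iff)

locale staircase_char_two = char_two K for K :: "'k::field itself" +
  fixes k n :: nat and \<rho> :: "nat \<Rightarrow> nat"
  assumes n_eq: "n = k * (k + 1) div 2" and \<rho>_eq: "\<rho> = staircase k"
begin

lemma \<rho>_part: "\<rho> \<in> partitions n"
  unfolding \<rho>_eq using n_eq by (rule staircase_partition)

lemma polytabloid_rev_vec:
  assumes "tableau n \<rho> t"
  shows "polytabloid n \<rho> t = rev_vec n \<rho> (col_tabloid \<rho> t)"
  unfolding polytabloid_char_two[OF \<rho>_part assms] rev_vec_def by (simp add: \<rho>_eq reversal_staircase)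

lemma rev_vec_\<rho>_in_specht:
  assumes T: "T \<in> tabloids n \<rho>"
  shows "rev_vec n \<rho> T \<in> specht n \<rho>"
proof -
  have t: "tableau n \<rho> (transposed (sorted_tableau T))"
    using tableau_transposed tableau_sorted_tableau[OF T] by (simp add: \<rho>_eq)
  have "col_tabloid \<rho> (transposed (sorted_tableau T)) = T"
    using tabloid_of_sorted_tableau[OF T] by (simp add: \<rho>_eq col_tabloid_transposed)
  then show ?thesis using polytabloid_rev_vec[OF t] polytabloid_in_specht[OF t, where ?'a = 'k] by simp
qed

text \<open>One factor requires reversal numbers with the rows of \<open>t\<close>; the other, being
  a polytabloid, requires transversality to its columns. Only the columnwise reversal of
  \<open>t\<close> satisfies both.\<close>

lemma rev_vec_product:
  assumes t: "tableau n \<rho> t"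
  shows "rev_vec n \<rho> (tabloid_of \<rho> t) R * rev_vec n \<rho> (col_tabloid \<rho> t) R =
    delta (tabloid_of \<rho> (t \<circ> flip \<rho>)) R"
proof (cases "R \<in> tabloids n \<rho>")
  case True
  have "incident (reversal \<rho>) R (col_tabloid \<rho> t) \<longleftrightarrow> transversal \<rho> R (col_tabloid \<rho> t)"
    by (simp add: \<rho>_eq reversal_staircase transversal_incident)
  then show ?thesis
    using reversal_transversal_iff[OF \<rho>_part t True] True
    by (auto simp: rev_vec_def incidence_def delta_def)
next
  case False
  moreover have "tabloid_of \<rho> (t \<circ> flip \<rho>) \<in> tabloids n \<rho>"
    by (intro tabloid_of_in_tabloids tableau_flip \<rho>_part t)
  ultimately show ?thesis by (auto simp: rev_vec_def incidence_def delta_def)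
qed

text \<open>In a staircase, rows and columns of an arrangement have exactly one common transversal, its
  antidiagonals; so indicator functions of tabloids are products of two elements of the Specht module.\<close>

lemma delta_product:
  assumes s: "s \<in> tabloids n \<rho>"
  obtains v1 v2 where "v1 \<in> specht n \<rho>" "v2 \<in> specht n \<rho>" "\<And>R. v1 R * v2 R = (delta s R :: 'k)"
proof -
  \<comment> \<open>Reversed beforehand, so that the common transversal of the rows and columns of
    \<open>t\<close> is \<open>s\<close>.\<close>
  define t where "t = sorted_tableau s \<circ> flip \<rho>"
  have t: "tableau n \<rho> t"
    unfolding t_def by (intro tableau_flip \<rho>_part tableau_sorted_tableau s)
  have "tabloid_of \<rho> (t \<circ> flip \<rho>) = tabloid_of \<rho> (sorted_tableau s)"
    using flip_flip[OF \<rho>_part] by (auto simp: tabloid_of_alt t_def fun_eq_iff)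
  then have eq: "tabloid_of \<rho> (t \<circ> flip \<rho>) = s" using tabloid_of_sorted_tableau[OF s] by simp
  show thesis
  proof
    show "rev_vec n \<rho> (tabloid_of \<rho> t) \<in> specht n \<rho>"
      by (intro rev_vec_\<rho>_in_specht tabloid_of_in_tabloids t)
    show "rev_vec n \<rho> (col_tabloid \<rho> t) \<in> specht n \<rho>"
      using col_tabloid_in_tabloids[OF \<rho>_part t] by (intro rev_vec_\<rho>_in_specht) (simp add: \<rho>_eq)
    show "rev_vec n \<rho> (tabloid_of \<rho> t) R * rev_vec n \<rho> (col_tabloid \<rho> t) R = delta s R" for R
      using rev_vec_product[OF t, of R] eq by simp
  qed
qed

lemma form_transposed:
  assumes t: "tableau n \<rho> t"
  shows "form n \<rho> (polytabloid n \<rho> t) (polytabloid n \<rho> (transposed t)) = (1 :: 'k)"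
proof -
  have t': "tableau n \<rho> (transposed t)" using tableau_transposed t by (simp add: \<rho>_eq)
  have "form n \<rho> (polytabloid n \<rho> t) (polytabloid n \<rho> (transposed t)) =
      (\<Sum>R\<in>tabloids n \<rho>. delta (tabloid_of \<rho> (t \<circ> flip \<rho>)) R :: 'k)"
    unfolding form_def polytabloid_rev_vec[OF t] polytabloid_rev_vec[OF t']
    using rev_vec_product[OF t] by (simp add: \<rho>_eq col_tabloid_transposed mult.commute)
  also have "\<dots> = 1"
    using finite_tabloids[OF \<rho>_part] tabloid_of_in_tabloids[OF tableau_flip[OF \<rho>_part t]]
    by (simp add: delta_def)
  finally show ?thesis .
qed

text \<open>Higman's criterion: this exhibits the Specht module as a projective module.\<close>

lemma higman_identity:
  assumes t: "tableau n \<rho> t" and u: "u \<in> specht n \<rho>"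
  shows "(\<Sum>g\<in>perms n. fscale (u (tabloid_act g (tabloid_of \<rho> t))) (act g (polytabloid n \<rho> t))) =
    (u :: tabloid \<Rightarrow> 'k)"
proof -
  let ?T = "tabloid_of \<rho> t" and ?e = "polytabloid n \<rho> t :: tabloid \<Rightarrow> 'k"
  define h where "h u = (\<Sum>g\<in>perms n. fscale (u (tabloid_act g ?T)) (act g ?e))" for u :: "tabloid \<Rightarrow> 'k"
  have t': "tableau n \<rho> (transposed t)" using tableau_transposed t by (simp add: \<rho>_eq)
  let ?e' = "polytabloid n \<rho> (transposed t) :: tabloid \<Rightarrow> 'k"
  have add: "h (f + g) = h f + h g" and scale: "h (fscale c f) = fscale c (h f)" for f g c
    by (auto simp: h_def fun_eq_iff sum_fun_apply fscale_def sum.distrib sum_distrib_left algebra_simps)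
  have eqv: "h (act p f) = act p (h f)" if p: "p permutes {1..n}" for p f
  proof -
    have "h (act p f) = (\<Sum>g\<in>perms n. fscale (act p f (tabloid_act (p \<circ> g) ?T)) (act (p \<circ> g) ?e))"
      unfolding h_def
      by (rule sum_perms_left[OF p])
    also have "\<dots> = (\<Sum>g\<in>perms n. act p (fscale (f (tabloid_act g ?T)) (act g ?e)))"
      by (rule sum.cong)
        (simp_all add: act_scale act_comp[OF p] act_def[of p f] tabloid_act_comp tabloid_act_inv[OF p])
    finally show ?thesis by (simp add: h_def act_sum)
  qed
  \<comment> \<open>Only the row stabilizer of \<open>t\<close> contributes, which is the column
    stabilizer of the transposed tableau. Signs are trivial in characteristic two, so this is a
    column sum.\<close>
  have "h (delta ?T) = (\<Sum>g\<in>column_stabilizer n \<rho> (transposed t). act g ?e)"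
  proof -
    have "column_stabilizer n \<rho> (transposed t) = {g \<in> perms n. tabloid_act g ?T = ?T}"
      by (simp add: column_stabilizer_alt \<rho>_eq col_tabloid_transposed)
    moreover have "h (delta ?T) = (\<Sum>g\<in>perms n. if tabloid_act g ?T = ?T then act g ?e else 0)"
      unfolding h_def
    proof (rule sum.cong)
      fix g
      show "fscale (delta ?T (tabloid_act g ?T)) (act g ?e) = (if tabloid_act g ?T = ?T then act g ?e else 0)"
        by (cases "tabloid_act g ?T = ?T") (simp_all add: delta_def fscale_def zero_fun_def)
    qed simp
    ultimately show ?thesis by (simp only: sum.inter_filter[OF finite_perms])
  qed
  also have "\<dots> = column_sum n \<rho> (transposed t) ?e"
    unfolding column_sum_def of_int_sign by (simp add: fscale_def)
  also have "\<dots> = ?e'"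
    unfolding column_sum_form[OF \<rho>_part t' polytabloid_supported[OF t]] form_transposed[OF t]
    by (simp add: fscale_def)
  finally have 1: "h (delta ?T) = ?e'" .
  \<comment> \<open>The column sum of \<open>t\<close> leads back from \<open>?e'\<close> to
    \<open>?e\<close>, again with factor 1, because the pairing of the two polytabloids is
    symmetric.\<close>
  have "h ?e = column_sum n \<rho> t (h (delta ?T))"
    unfolding polytabloid_column_sum by (intro equivariant_column_sum add scale eqv)
  also have "\<dots> = ?e"
    unfolding 1 column_sum_form[OF \<rho>_part t polytabloid_supported[OF t']]
      form_commute[of n \<rho> ?e'] form_transposed[OF t]
    by (simp add: fscale_def)
  finally have he: "h ?e = ?e" .
  have "h (polytabloid n \<rho> s) = polytabloid n \<rho> s" if s: "tableau n \<rho> s" for s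
  proof -
    obtain p where "p permutes {1..n}" "(polytabloid n \<rho> s :: tabloid \<Rightarrow> 'k) = act p ?e"
      using polytabloid_transitive[OF t s] .
    then show ?thesis using eqv he by simp
  qed
  then have "h u = u"
    by (intro linear_fixes_span[OF add scale _ u[unfolded specht_def]]) auto
  then show ?thesis by (simp add: h_def)
qed

text \<open>The family \<open>Y\<close> is an equivariant map from the permutation module of \<rho>.
  With the delta function at \<open>s\<close> written as \<open>v1 * v2\<close> and
  \<open>v1\<close> expanded by Higman's identity, \<open>Y s\<close> becomes a combination of
  norms, so these cannot all vanish.\<close>

lemma orbit_sum_nonzero:
  fixes Y :: "tabloid \<Rightarrow> tabloid \<Rightarrow> 'k"
  assumes Y: "\<And>r p. r \<in> tabloids n \<rho> \<Longrightarrow> p permutes {1..n} \<Longrightarrow> Y (tabloid_act p r) = act p (Y r)"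
    and s: "s \<in> tabloids n \<rho>" "Y s \<noteq> 0"
  shows "\<exists>v1\<in>specht n \<rho>. \<exists>v2\<in>specht n \<rho>. \<exists>r\<in>tabloids n \<rho>. orbit_sum n v1 v2 (Y r) \<noteq> 0"
proof (rule ccontr)
  assume neg: "\<not> ?thesis"
  have zero: "(\<Sum>p\<in>perms n. act p v1 T1 * act p v2 T2 * act p (Y r) T3) = 0"
    if "v1 \<in> specht n \<rho>" "v2 \<in> specht n \<rho>" "r \<in> tabloids n \<rho>" for v1 v2 r T1 T2 T3
  proof -
    have "orbit_sum n v1 v2 (Y r) = 0" using neg that by blast
    then have "orbit_sum n v1 v2 (Y r) (T1, T2, T3) = 0" by simp
    then show ?thesis by (simp add: orbit_sum_def)
  qed
  let ?X = "tabloids n \<rho>"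
  obtain t where t: "tableau n \<rho> t" using tableau_exists[OF \<rho>_part] by blast
  let ?T = "tabloid_of \<rho> t" and ?e = "polytabloid n \<rho> t :: tabloid \<Rightarrow> 'k"
  have T: "?T \<in> ?X" using t by (rule tabloid_of_in_tabloids)
  obtain v1 v2 where v: "v1 \<in> specht n \<rho>" "v2 \<in> specht n \<rho>" "\<And>R. v1 R * v2 R = (delta s R :: 'k)"
    using delta_product[OF s(1)] by blast
  \<comment> \<open>Evaluation at a moved tabloid is rewritten as a pairing with a moved element of
    the Specht module. Only in this form does the assumption on orbit sums apply.\<close>
  have eval: "v (tabloid_act p r) = (\<Sum>R\<in>?X. v R * act p (rev_vec n \<rho> r) R)"
    if "v \<in> specht n \<rho>" "r \<in> ?X" "p permutes {1..n}" for v r p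
    using specht_apply_form[OF \<rho>_part that(1), of "tabloid_act p r"] that tabloid_act_in_tabloids
    by (simp add: form_def act_rev_vec)
  have Z: "(\<Sum>p\<in>perms n. v1 (tabloid_act p ?T) * v2 (tabloid_act p r) * act p (Y r) T3) = 0"
    if r: "r \<in> ?X" for r T3
  proof -
    have "(\<Sum>p\<in>perms n. v1 (tabloid_act p ?T) * v2 (tabloid_act p r) * act p (Y r) T3) =
      (\<Sum>p\<in>perms n. \<Sum>R\<in>?X. \<Sum>R'\<in>?X. v1 R * v2 R' *
        (act p (rev_vec n \<rho> ?T) R * act p (rev_vec n \<rho> r) R' * act p (Y r) T3))"
    proof (rule sum.cong)
      fix p assume "p \<in> perms n"
      then have p: "p permutes {1..n}" by simp
      show "v1 (tabloid_act p ?T) * v2 (tabloid_act p r) * act p (Y r) T3 =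
        (\<Sum>R\<in>?X. \<Sum>R'\<in>?X. v1 R * v2 R' *
          (act p (rev_vec n \<rho> ?T) R * act p (rev_vec n \<rho> r) R' * act p (Y r) T3))"
        unfolding eval[OF v(1) T p] eval[OF v(2) r p] unfolding sum_product unfolding sum_distrib_right
        by (intro sum.cong refl) (simp add: mult_ac)
    qed simp
    also have "\<dots> = (\<Sum>R\<in>?X. \<Sum>R'\<in>?X. \<Sum>p\<in>perms n. v1 R * v2 R' *
        (act p (rev_vec n \<rho> ?T) R * act p (rev_vec n \<rho> r) R' * act p (Y r) T3))"
      by (subst sum.swap, intro sum.cong refl, rule sum.swap)
    also have "\<dots> = 0"
      using zero[OF rev_vec_\<rho>_in_specht[OF T] rev_vec_\<rho>_in_specht[OF r] r]
      by (simp flip: sum_distrib_left)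
    finally show ?thesis .
  qed
  have "Y s T3 = 0" for T3
  proof -
    have "Y s T3 = (\<Sum>r\<in>?X. delta s r * Y r T3)"
      using s(1) finite_tabloids[OF \<rho>_part] by (simp add: delta_def if_distrib[of "\<lambda>x. x * _"] cong: if_cong)
    also have "\<dots> = (\<Sum>r\<in>?X. \<Sum>p\<in>perms n. v1 (tabloid_act p ?T) * act p ?e r * v2 r * Y r T3)"
    proof (rule sum.cong)
      fix r
      have "v1 r = (\<Sum>p\<in>perms n. v1 (tabloid_act p ?T) * act p ?e r)"
        by (subst higman_identity[OF t v(1), symmetric]) (simp add: sum_fun_apply fscale_def)
      then show "delta s r * Y r T3 = (\<Sum>p\<in>perms n. v1 (tabloid_act p ?T) * act p ?e r * v2 r * Y r T3)"
        by (simp add: v(3)[symmetric] sum_distrib_right)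
    qed simp
    also have "\<dots> = (\<Sum>p\<in>perms n. \<Sum>r\<in>?X. v1 (tabloid_act p ?T) * act p ?e r * v2 r * Y r T3)"
      by (rule sum.swap)
    \<comment> \<open>Substituting \<open>tabloid_act p r\<close> for \<open>r\<close> and using
      equivariance of \<open>Y\<close> frees \<open>?e r\<close> from \<open>p\<close>. What depends
      on \<open>p\<close> is the sum that vanishes by \<open>Z\<close>.\<close>
    also have "\<dots> = (\<Sum>p\<in>perms n. \<Sum>r\<in>?X. ?e r *
        (v1 (tabloid_act p ?T) * v2 (tabloid_act p r) * act p (Y r) T3))"
    proof (rule sum.cong)
      fix p assume "p \<in> perms n"
      then have p: "p permutes {1..n}" by simp
      show "(\<Sum>r\<in>?X. v1 (tabloid_act p ?T) * act p ?e r * v2 r * Y r T3) = (\<Sum>r\<in>?X. ?e r *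
        (v1 (tabloid_act p ?T) * v2 (tabloid_act p r) * act p (Y r) T3))"
        by (subst sum_tabloids_act[OF p], rule sum.cong)
          (simp_all add: Y[OF _ p] act_def[of p ?e] tabloid_act_inv[OF p] mult_ac)
    qed simp
    also have "\<dots> = (\<Sum>r\<in>?X. ?e r *
        (\<Sum>p\<in>perms n. v1 (tabloid_act p ?T) * v2 (tabloid_act p r) * act p (Y r) T3))"
      by (subst sum.swap) (simp add: sum_distrib_left)
    also have "\<dots> = 0" using Z by simp
    finally show ?thesis .
  qed
  then show False using s(2) by auto
qed

end

section \<open>Equivariant families indexed by tabloids of staircase shape\<close>

section \<open>Chains of horizontal strips\<close>

definition strict_part :: "(nat \<Rightarrow> nat) \<Rightarrow> bool" where
  "strict_part l \<longleftrightarrow> (\<forall>i. l i \<noteq> 0 \<longrightarrow> l (Suc i) < l i)"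

text \<open>After a difference 0 the criterion makes a power of two divide 1, so the next difference
  is 0 as well. Two equal nonzero parts would therefore be repeated forever.\<close>

lemma carter_strict:
  assumes l: "l \<in> partitions n" and c: "carter l"
  shows "strict_part l"
  unfolding strict_part_def
proof (intro allI impI, rule ccontr)
  fix i assume nz: "l i \<noteq> 0" and "\<not> l (Suc i) < l i"
  then have eq: "l (Suc i) = l i" using part_antimono[OF l, of i "Suc i"] by simp
  have step: "l (Suc (Suc j)) = l (Suc j)" if "l (Suc j) = l j" for j
  proof -
    have "2 ^ ell2 (reversal l (Suc j) 0) dvd Suc (reversal l j 0)"
      using columns_carter_reversal[OF l c] by (simp add: columns_carter_def)
    then have "ell2 (reversal l (Suc j) 0) = 0" using that by (simp add: reversal_def)
    then have "reversal l (Suc j) 0 < 1" using less_power_ell2[of "reversal l (Suc j) 0"] by simp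
    then show ?thesis using part_antimono[OF l, of "Suc j" "Suc (Suc j)"] by (simp add: reversal_def)
  qed
  have "l (Suc (i + d)) = l (i + d) \<and> l (i + d) = l i" for d
    by (induction d) (use eq step in auto)
  then have "l (i + n) = l i" by blast
  then show False using nz part_zero[OF l, of "i + n"] by simp
qed

text \<open>Cells are removed one at a time, always from the lowest row where the interlacing
  condition leaves room. This choice keeps the nonzero parts distinct.\<close>

lemma remove_strip:
  assumes l: "l \<in> partitions N" "strict_part l" and c: "c \<le> l 0"
  shows "\<exists>g. g \<in> partitions (N - c) \<and> strict_part g \<and> (\<forall>i. l (Suc i) \<le> g i \<and> g i \<le> l i)"
  using c
proof (induction c)
  case 0
  then show ?case using l part_antimono[OF l(1)] by (intro exI[of _ l]) auto
next
  case (Suc c)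
  then obtain g where g: "g \<in> partitions (N - c)" "strict_part g" "\<And>i. l (Suc i) \<le> g i" "\<And>i. g i \<le> l i"
    by auto
  have lN: "l 0 \<le> N" using l(1) by (rule part_le)
  have gz: "g i = 0" if "N \<le> i" for i using g(4)[of i] part_zero[OF l(1) that] by simp
  have gsum: "(\<Sum>i<N. g i) = N - c" using part_sum[OF g(1), of N] by simp
  \<comment> \<open>The rows that may still lose a cell. If there were none, \<open>g\<close> would
    be \<open>l\<close> without its first row, and \<open>l 0\<close> cells would already be
    gone.\<close>
  define B where "B = {i. l (Suc i) < g i}"
  have Bsub: "B \<subseteq> {..<N}"
  proof
    fix i assume "i \<in> B"
    then have "g i \<noteq> 0" by (auto simp: B_def)
    then show "i \<in> {..<N}" using gz[of i] by (meson lessThan_iff not_le)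
  qed
  have finB: "finite B" using Bsub by (rule finite_subset) simp
  have "B \<noteq> {}"
  proof
    assume "B = {}"
    then have "\<not> l (Suc i) < g i" for i unfolding B_def by blast
    then have "g i = l (Suc i)" for i using g(3)[of i] by (simp add: le_antisym not_less)
    then have "N - c = (\<Sum>i<N. l (Suc i))" using gsum by simp
    moreover have "(\<Sum>i<Suc N. l i) = l 0 + (\<Sum>i<N. l (Suc i))" by (rule sum.lessThan_Suc_shift)
    moreover have "(\<Sum>i<Suc N. l i) = N" using part_sum[OF l(1), of "Suc N"] by simp
    ultimately show False using Suc.prems lN by simp
  qed
  define i where "i = Max B"
  have iB: "i \<in> B" unfolding i_def using finB \<open>B \<noteq> {}\<close> by (rule Max_in)
  then have i: "l (Suc i) < g i" "i < N" using Bsub by (auto simp: B_def)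
  have above: "g j = l (Suc j)" if "i < j" for j
  proof -
    have "j \<notin> B" using Max_ge[OF finB, of j] that by (auto simp: i_def)
    then show ?thesis using g(3)[of j] by (simp add: B_def)
  qed
  define g' where "g' = g(i := g i - 1)"
  \<comment> \<open>Below row \<open>i\<close> the parts of \<open>g\<close> are those of
    \<open>l\<close> shifted by one row. So \<open>g (Suc i)\<close> is
    \<open>l (Suc (Suc i))\<close>, which is zero or smaller than \<open>l (Suc i)\<close>, and
    \<open>l (Suc i)\<close> is at most \<open>g i - 1\<close>.\<close>
  have dec: "g (Suc i) < g i - 1 \<or> g (Suc i) = 0"
  proof -
    have "g (Suc i) = l (Suc (Suc i))" using above[of "Suc i"] by simp
    moreover have "l (Suc i) \<noteq> 0 \<longrightarrow> l (Suc (Suc i)) < l (Suc i)" using l(2) by (simp add: strict_part_def)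
    moreover have "l (Suc (Suc i)) \<le> l (Suc i)" using part_antimono[OF l(1)] by simp
    ultimately show ?thesis using i(1) by linarith
  qed
  have "g' \<in> partitions (N - Suc c)"
  proof (rule partitionsI[of _ N])
    show "g' (Suc j) \<le> g' j" for j
      using part_antimono[OF g(1), of j "Suc j"] dec by (auto simp: g'_def)
    show "g' j = 0" if "N \<le> j" for j using gz[OF that] i(2) that by (simp add: g'_def)
    have "(\<Sum>j<N. g' j) = g' i + (\<Sum>j\<in>{..<N} - {i}. g' j)" using i(2) by (intro sum.remove) auto
    also have "(\<Sum>j\<in>{..<N} - {i}. g' j) = (\<Sum>j\<in>{..<N} - {i}. g j)" by (rule sum.cong) (auto simp: g'_def)
    also have "g' i = g i - 1" by (simp add: g'_def)
    finally have "(\<Sum>j<N. g' j) = g i - 1 + (\<Sum>j\<in>{..<N} - {i}. g j)" .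
    moreover have "(\<Sum>j<N. g j) = g i + (\<Sum>j\<in>{..<N} - {i}. g j)" using i(2) by (intro sum.remove) auto
    ultimately show "(\<Sum>j<N. g' j) = N - Suc c" using gsum i(1) by simp
  qed
  moreover have "strict_part g'"
    unfolding strict_part_def
  proof (intro allI impI)
    fix j assume nz: "g' j \<noteq> 0"
    show "g' (Suc j) < g' j"
    proof (cases "j = i")
      case True
      then show ?thesis using dec nz by (auto simp: g'_def)
    next
      case False
      then have "g (Suc j) < g j" using nz g(2) by (simp add: g'_def strict_part_def)
      then show ?thesis using False by (auto simp: g'_def)
    qed
  qed
  moreover have "l (Suc j) \<le> g' j \<and> g' j \<le> l j" for j
    using g(3)[of j] g(4)[of j] i(1) by (auto simp: g'_def)
  ultimately show ?case by blast
qed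

text \<open>Distinct parts with first part \<open>l 0\<close> fit into the staircase of
  \<open>l 0\<close>, which has too few cells if \<open>l 0 < k\<close>.\<close>

lemma strict_first_part:
  assumes l: "l \<in> partitions n" "strict_part l" and n: "n = k * (k + 1) div 2"
  shows "k \<le> l 0"
proof (rule ccontr)
  assume "\<not> k \<le> l 0"
  have le: "l i \<le> staircase (l 0) i" for i
  proof (induction i)
    case (Suc i)
    have "l (Suc i) \<le> l i" using part_antimono[OF l(1)] by simp
    moreover have "l i = 0 \<or> l (Suc i) < l i" using l(2) by (auto simp: strict_part_def)
    ultimately show ?case using Suc by (auto simp: staircase_def)
  qed (simp add: staircase_def)
  have "n = (\<Sum>i<n + l 0. l i)" using part_sum[OF l(1)] by simp
  also have "\<dots> \<le> (\<Sum>i<n + l 0. staircase (l 0) i)" by (intro sum_mono le)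
  also have "\<dots> = (\<Sum>i<l 0. staircase (l 0) i)"
    by (rule sum.mono_neutral_right) (auto simp: staircase_def)
  finally have "2 * n \<le> l 0 * (l 0 + 1)" using sum_staircase[of "l 0"] by simp
  moreover have "2 * n = k * (k + 1)" using n by simp
  moreover have "l 0 * (l 0 + 1) < k * (k + 1)" using \<open>\<not> k \<le> l 0\<close> by (intro mult_strict_mono) auto
  ultimately show False by simp
qed

text \<open>Removing a strip of size \<open>k\<close> leaves a partition of the next smaller
  triangular number. Its parts are again distinct, so its first part is long enough for the next
  strip.\<close>

lemma strip_chain:
  assumes "l \<in> partitions (k * (k + 1) div 2)" "strict_part l"
  shows "\<exists>g. g 0 = l \<and> (\<forall>m. g m \<in> partitions ((k - m) * (k - m + 1) div 2)) \<and>
    (\<forall>m i. g (Suc m) i \<le> g m i \<and> g m (Suc i) \<le> g (Suc m) i)"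
  using assms
proof (induction k arbitrary: l)
  case 0
  then have "l i = 0" for i using part_le[of l 0 i] by simp
  then show ?case using 0 by (intro exI[of _ "\<lambda>m. l"]) simp
next
  case (Suc k)
  let ?N = "Suc k * (Suc k + 1) div 2"
  have "Suc k \<le> l 0" using Suc.prems by (intro strict_first_part) auto
  from remove_strip[OF Suc.prems this] obtain l' where
    l': "l' \<in> partitions (?N - Suc k)" "strict_part l'" "\<And>i. l (Suc i) \<le> l' i" "\<And>i. l' i \<le> l i"
    by blast
  have "?N - Suc k = k * (k + 1) div 2" by simp
  then obtain g where g: "g 0 = l'" "\<And>m. g m \<in> partitions ((k - m) * (k - m + 1) div 2)"
    "\<And>m i. g (Suc m) i \<le> g m i" "\<And>m i. g m (Suc i) \<le> g (Suc m) i"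
    using Suc.IH[of l'] l' by auto
  define h where "h m = (case m of 0 \<Rightarrow> l | Suc m \<Rightarrow> g m)" for m
  have "h m \<in> partitions ((Suc k - m) * (Suc k - m + 1) div 2)" for m
    using Suc.prems(1) g(2) by (cases m) (simp_all add: h_def)
  moreover have "h (Suc m) i \<le> h m i \<and> h m (Suc i) \<le> h (Suc m) i" for m i
    using g l' by (cases m) (simp_all add: h_def)
  ultimately show ?case by (intro exI[of _ h]) (auto simp: h_def)
qed

text \<open>A chain of horizontal strips cuts a tableau of shape \<open>\<beta>\<close> into a tabloid: the entries in the
  \<open>m\<close>-th strip form its row \<open>m\<close>.\<close>

locale strips =
  fixes n :: nat and \<beta> :: "nat \<Rightarrow> nat" and g :: "nat \<Rightarrow> nat \<Rightarrow> nat" and s :: "nat \<Rightarrow> nat" and k :: nat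
    and t :: "nat \<times> nat \<Rightarrow> nat"
  assumes \<beta>: "\<beta> \<in> partitions n" and g0: "g 0 = \<beta>" and g_part: "\<And>m. g m \<in> partitions (s m)"
    and g_end: "\<And>i. g k i = 0"
    and g_dec: "\<And>m i. g (Suc m) i \<le> g m i" and g_inter: "\<And>m i. g m (Suc i) \<le> g (Suc m) i"
    and t: "tableau n \<beta> t"
begin

definition strip_matrix :: "nat \<Rightarrow> nat \<Rightarrow> nat" where
  "strip_matrix i m = g m i - g (Suc m) i"

definition strip_tabloid :: tabloid where
  "strip_tabloid m = t ` (diagram (g m) - diagram (g (Suc m)))"

lemma g_le: "m \<le> m' \<Longrightarrow> g m' i \<le> g m i"
  by (induction rule: dec_induct) (use g_dec order_trans in blast)+

lemma g_le_\<beta>: "g m i \<le> \<beta> i"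
  using g_le[of 0 m i] g0 by simp

lemma diagram_sub: "diagram (g m) \<subseteq> diagram \<beta>"
  using g_le_\<beta> by (auto simp: diagram_def intro: less_le_trans)

lemma t_inj: "inj_on t (diagram \<beta>)"
  using t by (simp add: tableau_def bij_betw_def)

lemma mem_strip_tabloid:
  assumes "j < \<beta> i"
  shows "t (i, j) \<in> strip_tabloid m \<longleftrightarrow> g (Suc m) i \<le> j \<and> j < g m i"
proof -
  have "t (i, j) \<in> strip_tabloid m \<longleftrightarrow> (i, j) \<in> diagram (g m) - diagram (g (Suc m))"
    unfolding strip_tabloid_def
    by (rule inj_on_image_mem_iff[OF t_inj]) (use assms diagram_sub[of m] in \<open>auto simp: diagram_def\<close>)
  then show ?thesis by (auto simp: diagram_def)
qed

lemma strip_tabloid_in_tabloids: "strip_tabloid \<in> tabloids n (\<lambda>m. s m - s (Suc m))"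
proof (rule tabloidsI)
  fix m
  have "card (strip_tabloid m) = card (diagram (g m) - diagram (g (Suc m)))"
    unfolding strip_tabloid_def
    by (rule card_image, rule inj_on_subset[OF t_inj]) (use diagram_sub[of m] in auto)
  also have "\<dots> = card (diagram (g m)) - card (diagram (g (Suc m)))"
    by (rule card_Diff_subset)
      (use finite_diagram[OF g_part] g_dec in \<open>auto simp: diagram_def intro: less_le_trans\<close>)
  finally show "card (strip_tabloid m) = s m - s (Suc m)" by (simp add: card_diagram[OF g_part])
  show "strip_tabloid m \<subseteq> {1..n}"
    using t diagram_sub[of m] unfolding strip_tabloid_def tableau_def bij_betw_def by blast
next
  fix x m m' assume x: "x \<in> strip_tabloid m" "x \<in> strip_tabloid m'"
  then obtain i j where ij: "(i, j) \<in> diagram (g m)" "x = t (i, j)" by (auto simp: strip_tabloid_def)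
  then have "j < \<beta> i" using diagram_sub[of m] by (auto simp: diagram_def)
  then have *: "g (Suc m) i \<le> j" "j < g m i" "g (Suc m') i \<le> j" "j < g m' i"
    using x mem_strip_tabloid ij(2) by auto
  have "\<not> m < m'" using g_le[of "Suc m" m' i] * by auto
  moreover have "\<not> m' < m" using g_le[of "Suc m'" m i] * by auto
  ultimately show "m = m'" by simp
next
  fix x assume "x \<in> {1..n}"
  then obtain i j where ij: "j < \<beta> i" "x = t (i, j)" using tableau_cover[OF t] by blast
  have "\<exists>m. j < g m i \<and> \<not> j < g (Suc m) i"
  proof (rule ccontr)
    assume "\<not> ?thesis"
    then have "j < g m i" for m by (induction m) (use ij(1) g0 in auto)
    then show False using g_end[of i] by (metis not_less_zero)
  qed
  then show "\<exists>m. x \<in> strip_tabloid m" using mem_strip_tabloid[OF ij(1)] ij(2) by (auto simp: not_less)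
qed

lemma incident_strip: "incident strip_matrix (tabloid_of \<beta> t) strip_tabloid"
  unfolding incident_def
proof (intro allI)
  fix i m
  have "tabloid_of \<beta> t i \<inter> strip_tabloid m = (\<lambda>j. t (i, j)) ` {g (Suc m) i..<g m i}"
  proof (intro equalityI subsetI)
    fix x assume "x \<in> tabloid_of \<beta> t i \<inter> strip_tabloid m"
    then show "x \<in> (\<lambda>j. t (i, j)) ` {g (Suc m) i..<g m i}"
      using mem_strip_tabloid by (auto simp: tabloid_of_alt)
  next
    fix x assume "x \<in> (\<lambda>j. t (i, j)) ` {g (Suc m) i..<g m i}"
    then obtain j where j: "g (Suc m) i \<le> j" "j < g m i" "x = t (i, j)" by auto
    moreover have "j < \<beta> i" using j(2) g_le_\<beta>[of m i] by simp
    ultimately show "x \<in> tabloid_of \<beta> t i \<inter> strip_tabloid m"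
      using mem_strip_tabloid by (auto simp: tabloid_of_alt)
  qed
  moreover have "inj_on (\<lambda>j. t (i, j)) {g (Suc m) i..<g m i}"
    using tableau_eq_iff[OF t] g_le_\<beta>[of m i] by (auto intro!: inj_onI)
  ultimately show "card (tabloid_of \<beta> t i \<inter> strip_tabloid m) = strip_matrix i m"
    by (simp add: card_image strip_matrix_def)
qed

text \<open>The prescribed intersections with the strips from \<open>m\<close> on telescope to the
  row lengths of \<open>g m\<close>.\<close>

lemma card_upper:
  assumes T: "incident strip_matrix T strip_tabloid" and fin: "finite (T i)"
  shows "card (T i \<inter> t ` diagram (g m)) = g m i"
proof (cases "m \<le> k")
  case True
  then show ?thesis
  proof (induction rule: inc_induct)
    case base
    have "t ` diagram (g k) = {}" using g_end by (auto simp: diagram_def)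
    then have "card (T i \<inter> t ` diagram (g k)) = 0" by (simp only: Int_empty_right card.empty)
    then show ?case unfolding g_end .
  next
    case (step m)
    have "T i \<inter> t ` diagram (g m) = (T i \<inter> strip_tabloid m) \<union> (T i \<inter> t ` diagram (g (Suc m)))"
      using g_dec unfolding strip_tabloid_def by (auto simp: diagram_def intro: less_le_trans)
    moreover have "strip_tabloid m \<inter> t ` diagram (g (Suc m)) = {}"
      unfolding strip_tabloid_def
      using inj_on_image_Int[OF t_inj, of "diagram (g m) - diagram (g (Suc m))" "diagram (g (Suc m))"]
        diagram_sub by auto
    ultimately have "card (T i \<inter> t ` diagram (g m)) =
        card (T i \<inter> strip_tabloid m) + card (T i \<inter> t ` diagram (g (Suc m)))"
      using fin by (simp add: card_Un_disjoint disjoint_iff)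
    also have "\<dots> = g m i"
      using T step.IH g_dec[of m i] by (simp add: incident_def strip_matrix_def)
    finally show ?case .
  qed
next
  case False
  then have "g m i = 0" for i using g_le[of k m i] g_end[of i] by simp
  then have "g m = (\<lambda>_. 0)" by auto
  then show ?thesis by (simp add: diagram_def)
qed

text \<open>For each \<open>m\<close>, the entries of \<open>t\<close> inside the shape
  \<open>g m\<close> give a matrix of zeros and ones with the row and column sums of
  \<open>g m\<close>, and equality in Gale--Ryser fixes which rows of \<open>T\<close> they occupy
  in each column. Successive shapes differ by at most one cell per column, so the position of each
  single entry is determined.\<close>

lemma strip_transversal_unique:
  assumes T: "T \<in> tabloids n \<beta>" and tr: "transversal \<beta> T (col_tabloid \<beta> t)"
    and inc: "incident strip_matrix T strip_tabloid"
  shows "T = tabloid_of \<beta> t"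
proof -
  let ?W = "col_tabloid \<beta> t"
  have W: "?W \<in> tabloids n (conj_part \<beta>)" using \<beta> t by (rule col_tabloid_in_tabloids)
  have colU: "?W j \<inter> t ` diagram (g m) = (\<lambda>a. t (a, j)) ` {a. j < g m a}" for m j
  proof (intro equalityI subsetI)
    fix x assume "x \<in> ?W j \<inter> t ` diagram (g m)"
    then obtain a j' where x: "x = t (a, j')" "j' < g m a" "x \<in> ?W j" by (auto simp: diagram_def)
    then have "j' < \<beta> a" using g_le_\<beta>[of m a] by simp
    then have "j' = j" using mem_col_tabloid[OF t] x by simp
    then show "x \<in> (\<lambda>a. t (a, j)) ` {a. j < g m a}" using x by auto
  next
    fix x assume "x \<in> (\<lambda>a. t (a, j)) ` {a. j < g m a}"
    then obtain a where a: "x = t (a, j)" "j < g m a" by auto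
    then have "j < \<beta> a" using g_le_\<beta>[of m a] by simp
    then show "x \<in> ?W j \<inter> t ` diagram (g m)"
      using a mem_col_tabloid[OF t] by (auto simp: diagram_def)
  qed
  have main: "(\<exists>a. j < g m a \<and> t (a, j) \<in> T i) \<longleftrightarrow> j < g m i" for i j m
  proof -
    let ?U = "t ` diagram (g m)"
    define N where "N = n + s m + i + j + 1"
    have Usub: "?U \<subseteq> {1..n}"
      using t diagram_sub[of m] unfolding tableau_def bij_betw_def by blast
    have one: "of_bool (T i \<inter> ?W j \<inter> ?U \<noteq> {}) = card (T i \<inter> ?W j \<inter> ?U)" for i j
    proof -
      have "card (T i \<inter> ?W j \<inter> ?U) \<le> card (T i \<inter> ?W j)"
        by (rule card_mono) (use tabloids_finite[OF T] in auto)
      also have "\<dots> \<le> 1" using tr by (simp add: transversal_def)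
      finally have "card (T i \<inter> ?W j \<inter> ?U) \<le> 1" .
      then show ?thesis
        using tabloids_finite[OF T, of i] by (cases "T i \<inter> ?W j \<inter> ?U = {}") (auto simp: le_Suc_eq card_gt_0_iff)
    qed
    have row: "(\<Sum>j<N. of_bool (T i \<inter> ?W j \<inter> ?U \<noteq> {})) = g m i" for i
    proof -
      have "(\<Sum>j<N. card (T i \<inter> ?U \<inter> ?W j)) = card (T i \<inter> ?U)"
        by (rule sum_card_Int_tabloid[OF W]) (use conj_part_zero[OF \<beta>] Usub in \<open>auto simp: N_def\<close>)
      moreover have "T i \<inter> ?U \<inter> ?W j = T i \<inter> ?W j \<inter> ?U" for j by blast
      ultimately show ?thesis unfolding one using card_upper[OF inc tabloids_finite[OF T]] by simp
    qed
    have col: "(\<Sum>i<N. of_bool (T i \<inter> ?W j \<inter> ?U \<noteq> {})) = conj_part (g m) j" for j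
    proof -
      have "(\<Sum>i<N. card (?W j \<inter> ?U \<inter> T i)) = card (?W j \<inter> ?U)"
        by (rule sum_card_Int_tabloid[OF T]) (use part_zero[OF \<beta>] Usub in \<open>auto simp: N_def\<close>)
      moreover have "?W j \<inter> ?U \<inter> T i = T i \<inter> ?W j \<inter> ?U" for i by blast
      moreover have "card (?W j \<inter> ?U) = conj_part (g m) j"
        unfolding colU conj_part_def
        by (rule card_image, rule inj_onI) (use tableau_eq_iff[OF t] g_le_\<beta>[of m] less_le_trans in \<open>metis mem_Collect_eq\<close>)
      ultimately show ?thesis unfolding one by simp
    qed
    have "T i \<inter> ?W j \<inter> ?U \<noteq> {} \<longleftrightarrow> j < g m i"
      by (rule zero_one_matrix_diagram[OF g_part[of m], of N "\<lambda>i j. T i \<inter> ?W j \<inter> ?U \<noteq> {}" "g m"])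
        (simp_all only: row col, simp_all add: N_def)
    moreover have "T i \<inter> ?W j \<inter> ?U \<noteq> {} \<longleftrightarrow> (\<exists>a. j < g m a \<and> t (a, j) \<in> T i)"
      unfolding Int_assoc colU by blast
    ultimately show ?thesis by blast
  qed
  have diag: "t (a, j) \<in> T a" if ja: "j < \<beta> a" for a j
  proof -
    have "\<exists>m. j < g m a \<and> \<not> j < g (Suc m) a"
    proof (rule ccontr)
      assume "\<not> ?thesis"
      then have "j < g m a" for m by (induction m) (use ja g0 in auto)
      then show False using g_end[of a] by (metis not_less_zero)
    qed
    then obtain m where m: "j < g m a" "\<not> j < g (Suc m) a" by blast
    then obtain a' where a': "j < g m a'" "t (a', j) \<in> T a" using main[of j m a] by blast
    \<comment> \<open>Row \<open>a\<close> is not yet occupied in column \<open>j\<close> by the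
      smaller shape, so \<open>(a', j)\<close> lies in the same strip as \<open>(a, j)\<close>. By
      interlacing the two cells of this column coincide.\<close>
    have m': "\<not> j < g (Suc m) a'" using main[of j "Suc m" a] a'(2) m(2) by blast
    have "\<not> a' < a"
      using part_antimono[OF g_part, of "Suc a'" a m] g_inter[of m a'] m(1) m' by auto
    moreover have "\<not> a < a'"
      using part_antimono[OF g_part, of "Suc a" a' m] g_inter[of m a] m(2) a'(1) by auto
    ultimately show ?thesis using a'(2) by (metis linorder_neqE_nat)
  qed
  have "tabloid_of \<beta> t = T"
    by (rule tabloids_eqI[OF tabloid_of_in_tabloids[OF t] T]) (use diag in \<open>auto simp: tabloid_of_alt\<close>)
  then show ?thesis by simp
qed

end

section \<open>Arrangements with prescribed intersections\<close>

lemma split_set: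
  fixes N :: nat
  assumes fin: "finite S" and card: "card S = (\<Sum>i<N. f i)" and f: "\<And>i. N \<le> i \<Longrightarrow> f i = 0"
  shows "\<exists>P. (\<forall>i. card (P i) = f i) \<and> (\<forall>i j x. x \<in> P i \<longrightarrow> x \<in> P j \<longrightarrow> i = j) \<and> (\<Union>i. P i) = S"
proof -
  have "card (SIGMA i:{..<N}. {..<f i}) = (\<Sum>i<N. card {..<f i})" by (rule card_SigmaI) simp_all
  then have "card (SIGMA i:{..<N}. {..<f i}) = card S" using card by simp
  then obtain h where h: "bij_betw h (SIGMA i:{..<N}. {..<f i}) S"
    using finite_same_card_bij[of "SIGMA i:{..<N}. {..<f i}" S] fin by auto
  define P where "P i = (\<lambda>j. h (i, j)) ` {..<f i}" for i
  have mem: "(i, j) \<in> (SIGMA i:{..<N}. {..<f i}) \<longleftrightarrow> j < f i" for i j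
    using f[of i] by (cases "N \<le> i") auto
  have inj: "i = i' \<and> j = j'" if "j < f i" "j' < f i'" "h (i, j) = h (i', j')" for i j i' j'
    using h that mem unfolding bij_betw_def by (metis inj_onD prod.inject)
  have "card (P i) = f i" for i
    unfolding P_def using inj by (subst card_image) (auto intro!: inj_onI)
  moreover have "i = j" if "x \<in> P i" "x \<in> P j" for i j x
    using that inj by (auto simp: P_def)
  moreover have "(\<Union>i. P i) = S"
    using h mem unfolding bij_betw_def P_def by (auto simp: image_iff)+
  ultimately show ?thesis by blast
qed

text \<open>Each block \<open>W j\<close> is cut into pieces of sizes \<open>A i j\<close>, and
  pieces with the same \<open>i\<close> are collected. This serves to show that an
  \<open>incidence\<close> function is nonzero.\<close>

lemma tabloid_with_intersections:
  assumes W: "W \<in> tabloids n c" and row: "\<And>i. (\<Sum>j<M. A i j) = l i" "\<And>i j. M \<le> j \<Longrightarrow> A i j = 0"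
    and col: "\<And>j. (\<Sum>i<N. A i j) = c j" "\<And>i j. N \<le> i \<Longrightarrow> A i j = 0"
  shows "\<exists>T\<in>tabloids n l. incident A T W"
proof -
  have "\<exists>P. (\<forall>i. card (P i) = A i j) \<and> (\<forall>i i' x. x \<in> P i \<longrightarrow> x \<in> P i' \<longrightarrow> i = i') \<and> (\<Union>i. P i) = W j"
    for j
    by (rule split_set[where N = N]) (use tabloids_finite[OF W] tabloids_card[OF W] col in auto)
  then obtain P where P: "\<And>i j. card (P j i) = A i j"
    "\<And>i i' j x. x \<in> P j i \<Longrightarrow> x \<in> P j i' \<Longrightarrow> i = i'" "\<And>j. (\<Union>i. P j i) = W j"
    by metis
  have sub: "P j i \<subseteq> W j" for i j using P(3)[of j] by blast
  define T where "T i = (\<Union>j. P j i)" for i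
  have TW: "T i \<inter> W j = P j i" for i j
  proof (intro equalityI subsetI)
    fix x assume "x \<in> T i \<inter> W j"
    then obtain j' where "x \<in> P j' i" "x \<in> W j" by (auto simp: T_def)
    then show "x \<in> P j i" using sub[of j' i] tabloids_disj[OF W, of x j j'] by auto
  qed (use sub in \<open>auto simp: T_def\<close>)
  have "T \<in> tabloids n l"
  proof (rule tabloidsI)
    show Tsub: "T i \<subseteq> {1..n}" for i using sub tabloids_sub[OF W] by (fastforce simp: T_def)
    have c0: "c j = 0" if "M \<le> j" for j using col(1)[of j] row(2)[OF that] by simp
    show "card (T i) = l i" for i
      using sum_card_Int_tabloid[OF W c0 Tsub[of i]] row(1)[of i] by (simp add: TW P(1))
    show "i = i'" if "x \<in> T i" "x \<in> T i'" for x i i'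
    proof -
      obtain j j' where j: "x \<in> P j i" "x \<in> P j' i'" using \<open>x \<in> T i\<close> \<open>x \<in> T i'\<close> by (auto simp: T_def)
      then have "j = j'" using sub[of j i] sub[of j' i'] tabloids_disj[OF W, of x j j'] by blast
      then show ?thesis using P(2) j by blast
    qed
    show "\<exists>i. x \<in> T i" if "x \<in> {1..n}" for x
    proof -
      from tabloids_cover[OF W that] obtain j where "x \<in> W j" .
      then show ?thesis using P(3)[of j] unfolding T_def by blast
    qed
  qed
  moreover have "incident A T W" by (simp add: incident_def TW P(1))
  ultimately show ?thesis by blast
qed

section \<open>Framed staircases\<close>

lemma staircase_frame_eq:
  "staircase_frame j (row_part a) (col_part b) i = of_bool (i < j + 2 * b) + (j - Suc i) + of_bool (i = 0) * (2 * a)"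
proof -
  have cp: "conj_part (col_part b) = (\<lambda>r. if r = 0 then b else 0)"
  proof
    fix r
    show "conj_part (col_part b) r = (if r = 0 then b else 0)"
      by (rule conj_part_eq) (auto simp: col_part_def)
  qed
  have "{r. i < staircase j r + 2 * (if r = 0 then b else 0)} =
      (if i < j + 2 * b then {0} else {}) \<union> {1..<j - i}"
    by (auto simp: staircase_def split: if_splits)
  then have "conj_part (\<lambda>r. staircase j r + 2 * conj_part (col_part b) r) i =
      card ((if i < j + 2 * b then {0} else {}) \<union> {1..<j - i})"
    by (simp only: cp conj_part_def[of "\<lambda>r. staircase j r + 2 * (if r = 0 then b else 0)"])
  also have "\<dots> = of_bool (i < j + 2 * b) + (j - Suc i)"
    by (subst card_Un_disjoint) auto
  finally show ?thesis by (simp add: staircase_frame_def row_part_def)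
qed

text \<open>Column 0 collects the long first column of the frame and the \<open>2 * a\<close> extra
  cells of the first row; the others are the remaining columns of the staircase. Below the top row
  all entries are 0 or 1, and a 1 stands under an odd entry because \<open>2 * a\<close> is even,
  which gives the congruences.\<close>

definition frame_matrix :: "nat \<Rightarrow> nat \<Rightarrow> nat \<Rightarrow> nat \<Rightarrow> nat \<Rightarrow> nat" where
  "frame_matrix j a b i m = (if m = 0 then of_bool (i < j + 2 * b) + of_bool (i = 0) * (2 * a)
     else of_bool (i + m < j))"

lemma columns_carter_frame: "columns_carter (frame_matrix j a b)"
  unfolding columns_carter_def
proof (intro allI)
  fix i m
  have "frame_matrix j a b (Suc i) m = 0 \<or> frame_matrix j a b (Suc i) m = Suc 0 \<and> odd (frame_matrix j a b i m)"
    by (auto simp: frame_matrix_def)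
  then show "2 ^ ell2 (frame_matrix j a b (Suc i) m) dvd Suc (frame_matrix j a b i m)" by auto
qed

lemma frame_matrix_row:
  assumes "j \<le> M" "M \<noteq> 0"
  shows "(\<Sum>m<M. frame_matrix j a b i m) = staircase_frame j (row_part a) (col_part b) i"
proof -
  obtain M' where M': "M = Suc M'" using assms(2) by (cases M) auto
  have "(\<Sum>m<M. frame_matrix j a b i m) =
      frame_matrix j a b i 0 + (\<Sum>m<M'. frame_matrix j a b i (Suc m))"
    unfolding M' by (rule sum.lessThan_Suc_shift)
  also have "(\<Sum>m<M'. frame_matrix j a b i (Suc m)) = card {m. m < M' \<and> m < j - Suc i}"
    by (simp add: frame_matrix_def of_bool_def less_diff_conv add.commute sum.If_cases Collect_conj_eq lessThan_def)
  also have "{m. m < M' \<and> m < j - Suc i} = {..<j - Suc i}" using assms(1) M' by auto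
  finally show ?thesis by (simp add: frame_matrix_def staircase_frame_eq)
qed

text \<open>For a tabloid of shape \<rho>(k), merging the top \<open>k - j + 1\<close> rows leaves
  further blocks of sizes \<open>j - 1\<close>, ..., 1, the column sums of the frame matrix outside
  column 0.\<close>

definition merge_rows :: "nat \<Rightarrow> nat \<Rightarrow> tabloid \<Rightarrow> tabloid" where
  "merge_rows k j r = (\<lambda>m. if m = 0 then \<Union>i\<le>k - j. r i else r (k - j + m))"

lemma merge_rows_act: "merge_rows k j (tabloid_act p r) = tabloid_act p (merge_rows k j r)"
  by (auto simp: merge_rows_def tabloid_act_def fun_eq_iff)

lemma merge_rows_in_tabloids:
  assumes r: "r \<in> tabloids n l"
  shows "merge_rows k j r \<in> tabloids n (\<lambda>m. card (merge_rows k j r m))"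
proof (rule tabloidsI)
  show "merge_rows k j r i \<subseteq> {1..n}" for i
    unfolding merge_rows_def using tabloids_sub[OF r] by (auto simp del: atLeastAtMost_iff)
  show "i = i'" if "x \<in> merge_rows k j r i" "x \<in> merge_rows k j r i'" for x i i'
    using that tabloids_disj[OF r, of x] by (fastforce simp: merge_rows_def split: if_splits)
  show "\<exists>i. x \<in> merge_rows k j r i" if "x \<in> {1..n}" for x
  proof -
    from tabloids_cover[OF r that] obtain i where i: "x \<in> r i" .
    show ?thesis
    proof (cases "i \<le> k - j")
      case True
      then show ?thesis using i by (intro exI[of _ 0]) (auto simp: merge_rows_def)
    next
      case False
      then show ?thesis using i by (intro exI[of _ "i - (k - j)"]) (simp add: merge_rows_def)
    qed
  qed
qed simp

context staircase_char_two
begin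

text \<open>The functions counting strip intersections form an equivariant family in the permutation
  module of \<beta>, and \<open>rev_map\<close> carries it into the Specht module. At the strips of
  \<open>t\<close> the result pairs with the polytabloid to 1: \<open>rev_map\<close> is
  self-adjoint and fixes the polytabloid, and only \<open>tabloid_of \<beta> t\<close> lies in both
  supports.\<close>

lemma carter_orbit_sum_nonzero:
  assumes \<beta>: "\<beta> \<in> partitions n" and c: "carter \<beta>"
  shows "\<exists>v1\<in>specht n \<rho>. \<exists>v2\<in>specht n \<rho>. \<exists>x\<in>specht n \<beta>. orbit_sum n v1 v2 x \<noteq> (0 :: _ \<Rightarrow> 'k)"
proof -
  obtain g where g: "g 0 = \<beta>" "\<And>m. g m \<in> partitions ((k - m) * (k - m + 1) div 2)"
    "\<And>m i. g (Suc m) i \<le> g m i" "\<And>m i. g m (Suc i) \<le> g (Suc m) i"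
    using strip_chain[of \<beta> k] \<beta> carter_strict[OF \<beta> c] n_eq by auto
  obtain t where t: "tableau n \<beta> t" using tableau_exists[OF \<beta>] by blast
  have g_end: "g k i = 0" for i using part_le[OF g(2)[of k], of i] by simp
  interpret strips n \<beta> g "\<lambda>m. (k - m) * (k - m + 1) div 2" k t
    by unfold_locales (use \<beta> g g_end t in auto)
  have "(\<lambda>m. (k - m) * (k - m + 1) div 2 - (k - Suc m) * (k - Suc m + 1) div 2) = \<rho>"
  proof
    fix m
    show "(k - m) * (k - m + 1) div 2 - (k - Suc m) * (k - Suc m + 1) div 2 = \<rho> m"
    proof (cases "m < k")
      case True
      then obtain d where d: "k - m = Suc d" by (metis Suc_diff_Suc)
      then have "k - Suc m = d" by simp
      then show ?thesis using d by (simp add: \<rho>_eq staircase_def)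
    qed (simp add: \<rho>_eq staircase_def)
  qed
  then have s: "strip_tabloid \<in> tabloids n \<rho>" using strip_tabloid_in_tabloids by simp
  define z where "z r = (incidence n \<beta> strip_matrix r :: tabloid \<Rightarrow> 'k)" for r
  define Y where "Y r = rev_map n \<beta> (z r)" for r
  have "Y (tabloid_act p r) = act p (Y r)" if "p permutes {1..n}" for p r
    unfolding Y_def z_def by (simp only: act_incidence[OF that, symmetric] rev_map_act[OF that])
  moreover have "Y strip_tabloid \<noteq> 0"
  proof
    assume 0: "Y strip_tabloid = 0"
    have "form n \<beta> (Y strip_tabloid) (polytabloid n \<beta> t) =
        form n \<beta> (z strip_tabloid) (rev_map n \<beta> (polytabloid n \<beta> t))"
    proof -
      have "form n \<beta> (rev_map n \<beta> f) h = form n \<beta> f (rev_map n \<beta> h)" for f h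
      proof -
        have "form n \<beta> (rev_map n \<beta> f) h =
            (\<Sum>T\<in>tabloids n \<beta>. \<Sum>R\<in>tabloids n \<beta>. f R * rev_vec n \<beta> R T * h T)"
          by (simp add: form_def rev_map_apply sum_distrib_right)
        also have "\<dots> = (\<Sum>R\<in>tabloids n \<beta>. \<Sum>T\<in>tabloids n \<beta>. f R * rev_vec n \<beta> R T * h T)"
          by (rule sum.swap)
        also have "\<dots> = (\<Sum>R\<in>tabloids n \<beta>. \<Sum>T\<in>tabloids n \<beta>. f R * (h T * rev_vec n \<beta> T R))"
          by (intro sum.cong refl) (simp add: rev_vec_sym mult_ac)
        finally show ?thesis by (simp add: form_def rev_map_apply sum_distrib_left)
      qed
      then show ?thesis by (simp add: Y_def)
    qed
    also have "\<dots> = form n \<beta> (z strip_tabloid) (polytabloid n \<beta> t)"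
      by (simp only: rev_map_polytabloid[OF \<beta> t])
    also have "\<dots> = (\<Sum>T\<in>tabloids n \<beta>. if T = tabloid_of \<beta> t then 1 else 0)"
      unfolding form_def
    proof (rule sum.cong)
      fix T assume T: "T \<in> tabloids n \<beta>"
      have "incident strip_matrix T strip_tabloid \<and> transversal \<beta> T (col_tabloid \<beta> t) \<longleftrightarrow> T = tabloid_of \<beta> t"
        using strip_transversal_unique[OF T] incident_strip transversal_tableau[OF t] by blast
      then show "z strip_tabloid T * polytabloid n \<beta> t T = (if T = tabloid_of \<beta> t then 1 else 0)"
        using T by (auto simp: z_def polytabloid_char_two[OF \<beta> t] incidence_def transversal_incident)
    qed simp
    also have "\<dots> = 1" using tabloid_of_in_tabloids[OF t] finite_tabloids[OF \<beta>] by simp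
    finally show False using 0 by (simp add: form_def)
  qed
  ultimately have "\<exists>v1\<in>specht n \<rho>. \<exists>v2\<in>specht n \<rho>. \<exists>r\<in>tabloids n \<rho>. orbit_sum n v1 v2 (Y r) \<noteq> 0"
    using s by (intro orbit_sum_nonzero[of Y strip_tabloid]) auto
  moreover have "Y r \<in> specht n \<beta>" for r
    unfolding Y_def rev_map_def
    by (intro fun_vs.subspace_sum fun_vs.subspace_scale submoduleD(1)[OF submodule_specht]
        rev_vec_in_specht[OF \<beta> c])
  ultimately show ?thesis by blast
qed

text \<open>The frame matrix satisfies the column congruences, so its incidence functions already
  lie in the Specht module of \<alpha>. A tabloid with the required intersections exists because the
  column sums are the sizes of the merged rows.\<close>

lemma frame_orbit_sum_nonzero:
  assumes \<alpha>_eq: "\<alpha> = staircase_frame j (row_part a) (col_part b)" and \<alpha>: "\<alpha> \<in> partitions n"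
  shows "\<exists>v1\<in>specht n \<rho>. \<exists>v2\<in>specht n \<rho>. \<exists>x\<in>specht n \<alpha>. orbit_sum n v1 v2 x \<noteq> (0 :: _ \<Rightarrow> 'k)"
proof -
  have jk: "j \<le> k"
  proof (rule ccontr)
    assume "\<not> j \<le> k"
    have "staircase j i \<le> \<alpha> i" for i by (auto simp: \<alpha>_eq staircase_frame_eq staircase_def)
    then have "(\<Sum>i<j. staircase j i) \<le> (\<Sum>i<j. \<alpha> i)" by (intro sum_mono) simp
    also have "\<dots> \<le> (\<Sum>i<n + j. \<alpha> i)" by (intro sum_mono2) auto
    also have "\<dots> = n" using part_sum[OF \<alpha>] by simp
    finally have "j * (j + 1) \<le> 2 * n" using sum_staircase[of j] by simp
    moreover have "2 * n = k * (k + 1)" using n_eq by simp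
    moreover have "k * (k + 1) < j * (j + 1)" using \<open>\<not> j \<le> k\<close> by (intro mult_strict_mono) auto
    ultimately show False by simp
  qed
  obtain t where t: "tableau n \<rho> t" using tableau_exists[OF \<rho>_part] by blast
  let ?r = "tabloid_of \<rho> t" and ?A = "frame_matrix j a b"
  have r: "?r \<in> tabloids n \<rho>" using t by (rule tabloid_of_in_tabloids)
  define c where "c r m = card (merge_rows k j r m)" for r m
  have merge: "merge_rows k j r \<in> tabloids n (c r)" if "r \<in> tabloids n \<rho>" for r
    using merge_rows_in_tabloids[OF that] unfolding c_def .
  have c0: "c r m = 0" if "r \<in> tabloids n \<rho>" "Suc k \<le> m" for r m
    using that(2) tabloids_card[OF that(1), of "k - j + m"] jk
    by (simp add: c_def merge_rows_def \<rho>_eq staircase_def)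
  define Y where "Y r = (incidence n \<alpha> ?A (merge_rows k j r) :: tabloid \<Rightarrow> 'k)" for r
  have "Y (tabloid_act p r) = act p (Y r)" if "p permutes {1..n}" for p r
    unfolding Y_def merge_rows_act by (rule act_incidence[OF that, symmetric])
  moreover have "Y ?r \<noteq> 0"
  proof -
    have row: "(\<Sum>m<Suc k. ?A i m) = \<alpha> i" for i
      unfolding \<alpha>_eq by (rule frame_matrix_row) (use jk in auto)
    have A0: "?A i m = 0" if "Suc k \<le> m" for i m
      using that jk by (auto simp: frame_matrix_def)
    have A0': "?A i m = 0" if "n + j + 2 * b + 1 \<le> i" for i m
      using that by (auto simp: frame_matrix_def)
    let ?N = "n + j + 2 * b + 1"
    have col_pos: "(\<Sum>i<?N. ?A i m) = c ?r m" if "m \<noteq> 0" for m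
    proof -
      have "{..<?N} \<inter> {i. i + m < j} = {..<j - m}" by auto
      then have "card ({..<?N} \<inter> {i. i + m < j}) = j - m" by (simp only: card_lessThan)
      then have "(\<Sum>i<?N. ?A i m) = j - m"
        using that by (simp add: frame_matrix_def of_bool_def sum.If_cases del: sum.lessThan_Suc)
      moreover have "c ?r m = k - (k - j + m)"
        using that tabloids_card[OF r, of "k - j + m"] by (simp add: c_def merge_rows_def \<rho>_eq staircase_def)
      ultimately show ?thesis using jk by simp
    qed
    \<comment> \<open>The sum of column 0 is forced: the column sums and the block sizes both add up
      to \<open>n\<close> and agree in all other places.\<close>
    have "(\<Sum>m<Suc k. \<Sum>i<?N. ?A i m) = (\<Sum>i<?N. \<alpha> i)"
      by (subst sum.swap) (simp only: row)
    also have "\<dots> = n" by (rule part_sum[OF \<alpha>]) simp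
    also have "n = (\<Sum>m<Suc k. c ?r m)"
      using sum_card_Int_tabloid[OF merge[OF r] c0[OF r], where A = "{1..n}" and N = "Suc k"]
        tabloids_sub[OF merge[OF r]]
      by (simp add: Int_absorb1 c_def del: sum.lessThan_Suc)
    finally have "(\<Sum>m<Suc k. \<Sum>i<?N. ?A i m) = (\<Sum>m<Suc k. c ?r m)" .
    then have "(\<Sum>i<?N. ?A i 0) + (\<Sum>m<k. \<Sum>i<?N. ?A i (Suc m)) = c ?r 0 + (\<Sum>m<k. c ?r (Suc m))"
      unfolding sum.lessThan_Suc_shift .
    then have col: "(\<Sum>i<?N. ?A i m) = c ?r m" for m
      using col_pos by (cases "m = 0") simp_all
    obtain T where "T \<in> tabloids n \<alpha>" "incident ?A T (merge_rows k j ?r)"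
      using tabloid_with_intersections[OF merge[OF r] row A0 col A0'] by blast
    then have "Y ?r T = 1" by (simp add: Y_def incidence_def)
    then show ?thesis by auto
  qed
  ultimately have "\<exists>v1\<in>specht n \<rho>. \<exists>v2\<in>specht n \<rho>. \<exists>r\<in>tabloids n \<rho>. orbit_sum n v1 v2 (Y r) \<noteq> 0"
    using r by (intro orbit_sum_nonzero[of Y ?r]) auto
  moreover have "Y r \<in> specht n \<alpha>" if "r \<in> tabloids n \<rho>" for r
    unfolding Y_def
    by (rule incidence_in_specht[OF \<alpha> columns_carter_frame merge[OF that] c0[OF that]])
  ultimately show ?thesis by blast
qed

end

section \<open>Comparing dimensions in characteristic two with dimensions over the complex
  numbers\<close>

section \<open>Dimensions\<close>

lemma supported_span:
  assumes "finite X"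
  shows "supported X \<subseteq> (fun_vs.span (delta ` X) :: ('t \<Rightarrow> 'k::field) set)"
proof
  fix f :: "'t \<Rightarrow> 'k" assume "f \<in> supported X"
  then have f: "f = (\<Sum>x\<in>X. fscale (f x) (delta x))" by (rule supported_expand[OF assms])
  show "f \<in> fun_vs.span (delta ` X)"
    by (subst f) (intro fun_vs.span_sum fun_vs.span_scale fun_vs.span_base imageI)
qed

text \<open>The space of all functions may have infinite dimension. A finite common support puts
  \<open>V\<close> into the span of finitely many delta functions, which restores the usual
  facts.\<close>

lemma card_independent_le_dim:
  assumes "finite X" "V \<subseteq> (supported X :: ('t \<Rightarrow> 'k::field) set)"
    and "B \<subseteq> V" "fun_vs.independent B"
  shows "finite B" "card B \<le> fun_vs.dim V"
proof -
  obtain C where C: "B \<subseteq> C" "C \<subseteq> V" "fun_vs.independent C" "V \<subseteq> fun_vs.span C"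
    using fun_vs.maximal_independent_subset_extend[OF assms(3,4)] by blast
  have "C \<subseteq> fun_vs.span (delta ` X)" using C(2) assms(2) supported_span[OF assms(1)] by blast
  then have fin: "finite C" using fun_vs.independent_span_bound[OF _ C(3)] assms(1) by blast
  then show "finite B" using C(1) finite_subset by blast
  show "card B \<le> fun_vs.dim V"
    using card_mono[OF fin C(1)] fun_vs.basis_card_eq_dim[OF C(2,4,3)] by simp
qed

lemma dim_mono:
  assumes "finite X" "V \<subseteq> (supported X :: ('t \<Rightarrow> 'k::field) set)" "U \<subseteq> V"
  shows "fun_vs.dim U \<le> fun_vs.dim V"
proof -
  obtain B where "B \<subseteq> U" "fun_vs.independent B" "U \<subseteq> fun_vs.span B" "card B = fun_vs.dim U"
    by (rule fun_vs.basis_exists)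
  then show ?thesis using card_independent_le_dim(2)[OF assms(1,2), of B] assms(3) by auto
qed

lemma dim_less:
  assumes "finite X" "V \<subseteq> (supported X :: ('t \<Rightarrow> 'k::field) set)"
    and "fun_vs.subspace U" "U \<subset> V"
  shows "fun_vs.dim U < fun_vs.dim V"
proof -
  obtain B where B: "B \<subseteq> U" "fun_vs.independent B" "U \<subseteq> fun_vs.span B" "card B = fun_vs.dim U"
    by (rule fun_vs.basis_exists)
  obtain v where v: "v \<in> V" "v \<notin> U" using assms(4) by blast
  have span: "fun_vs.span B \<subseteq> U" using B(1) assms(3) by (rule fun_vs.span_minimal)
  then have ind: "fun_vs.independent (insert v B)" using v(2) B(2) by (intro fun_vs.independent_insertI) auto
  have sub: "insert v B \<subseteq> V" using v(1) B(1) assms(4) by blast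
  have "v \<notin> B" using v(2) B(1) by blast
  then have "card (insert v B) = Suc (card B)"
    using card_independent_le_dim(1)[OF assms(1,2) sub ind] by simp
  then show ?thesis using card_independent_le_dim(2)[OF assms(1,2) sub ind] B(4) by simp
qed

lemma dim_positive:
  assumes "finite X" "V \<subseteq> (supported X :: ('t \<Rightarrow> 'k::field) set)" "v \<in> V" "v \<noteq> 0"
  shows "0 < fun_vs.dim V"
  using card_independent_le_dim[OF assms(1,2), of "{v}"] assms(3,4) by auto

section \<open>Integer vectors modulo two\<close>

lemma common_denominator:
  assumes "finite J"
  shows "\<exists>d::int. d \<noteq> 0 \<and> (\<forall>j\<in>J. \<exists>b::int. of_int d * (q j :: rat) = of_int b)"
  using assms
proof (induction J rule: finite_induct)
  case (insert i J)
  then obtain d where d: "d \<noteq> 0" "\<And>j. j \<in> J \<Longrightarrow> \<exists>b::int. of_int d * q j = of_int b" by blast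
  obtain a c where ac: "q i = Fract a c" "c > 0" by (cases "q i") auto
  have "of_int (c * d) * q i = of_int (d * a)"
    using ac by (simp add: Fract_of_int_quotient)
  then have "\<exists>b::int. of_int (c * d) * q i = of_int b" by blast
  moreover have "\<exists>b::int. of_int (c * d) * q j = of_int b" if "j \<in> J" for j
  proof -
    obtain b :: int where "of_int d * q j = of_int b" using d(2) \<open>j \<in> J\<close> by blast
    then have "of_int (c * d) * q j = of_int (c * b)" by (simp add: mult.assoc)
    then show ?thesis by blast
  qed
  moreover have "c * d \<noteq> 0" using d(1) ac(2) by simp
  ultimately show ?case by (metis insert_iff)
qed (auto intro: exI[of _ 1])

interpretation rat_complex: vector_space "\<lambda>(q::rat) (z::complex). of_rat q * z"
  by unfold_locales (simp_all add: algebra_simps of_rat_add of_rat_mult)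

interpretation rat_rat: vector_space "\<lambda>(q::rat) (z::rat). q * z"
  by unfold_locales (simp_all add: algebra_simps)

interpretation rat_complex_rat: vector_space_pair "\<lambda>(q::rat) (z::complex). of_rat q * z"
  "\<lambda>(q::rat) (z::rat). q * z"
  by unfold_locales

text \<open>Over the rationals, \<open>c\<close> extends to a basis of the complex numbers and can
  be sent to 1. Applied to coefficients, such a functional turns a complex relation between integer
  vectors into a rational one that is still nontrivial.\<close>

lemma rational_functional:
  assumes "(c::complex) \<noteq> 0"
  obtains f :: "complex \<Rightarrow> rat" where "\<And>x y. f (x + y) = f x + f y"
    "\<And>x (m::int). f (x * of_int m) = f x * of_int m" "f c \<noteq> 0"
proof -
  have "rat_complex.independent {c}" using assms by simp
  then obtain g where g: "Vector_Spaces.linear (\<lambda>(q::rat) (z::complex). of_rat q * z) (\<lambda>q z. q * z) g"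
    "g c = (1 :: rat)"
    using rat_complex_rat.linear_independent_extend[of "{c}" "\<lambda>_. 1"] by auto
  interpret g: Vector_Spaces.linear "\<lambda>(q::rat) (z::complex). of_rat q * z" "\<lambda>(q::rat) (z::rat). q * z" g
    by (rule g(1))
  show thesis
  proof
    show "g (x + y) = g x + g y" for x y by (rule g.add)
    show "g (x * of_int m) = g x * of_int m" for x and m :: int
      using g.scale[of "of_int m" x] by (simp add: mult.commute)
    show "g c \<noteq> 0" using g(2) by simp
  qed
qed

text \<open>The coefficients are halved as long as all of them are even, which lowers the sum of
  their absolute values. The odd coefficient reached in the end survives reduction modulo
  two.\<close>

lemma integer_relation_primitive:
  fixes z :: "'i \<Rightarrow> 't \<Rightarrow> int"
  assumes fin: "finite J" and rel: "\<And>x. (\<Sum>j\<in>J. b j * z j x) = 0" and nz: "\<exists>j\<in>J. b j \<noteq> 0"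
  shows "\<exists>a. (\<forall>x. (\<Sum>j\<in>J. a j * z j x) = 0) \<and> (\<exists>j\<in>J. odd (a j))"
  using rel nz
proof (induction "\<Sum>j\<in>J. nat \<bar>b j\<bar>" arbitrary: b rule: less_induct)
  case less
  show ?case
  proof (cases "\<exists>j\<in>J. odd (b j)")
    case False
    define b' where "b' j = b j div 2" for j
    have b: "b j = 2 * b' j" if "j \<in> J" for j using False that by (simp add: b'_def)
    have rel': "(\<Sum>j\<in>J. b' j * z j x) = 0" for x
    proof -
      have "2 * (\<Sum>j\<in>J. b' j * z j x) = (\<Sum>j\<in>J. b j * z j x)"
        unfolding sum_distrib_left by (rule sum.cong) (simp_all add: b)
      then show ?thesis using less.prems(1) by simp
    qed
    obtain i where i: "i \<in> J" "b i \<noteq> 0" using less.prems(2) by blast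
    have "(\<Sum>j\<in>J. nat \<bar>b' j\<bar>) < (\<Sum>j\<in>J. nat \<bar>b j\<bar>)"
      by (rule sum_strict_mono_ex1[OF fin]) (use b i in \<open>auto intro!: bexI[of _ i]\<close>)
    then show ?thesis using less.hyps[of b'] rel' i b by force
  qed (use less.prems in blast)
qed

lemma complex_relation_integer:
  fixes z :: "'i \<Rightarrow> 't \<Rightarrow> int" and c :: "'i \<Rightarrow> complex"
  assumes fin: "finite J" and rel: "\<And>x. (\<Sum>j\<in>J. c j * of_int (z j x)) = 0" and nz: "\<exists>j\<in>J. c j \<noteq> 0"
  shows "\<exists>a. (\<forall>x. (\<Sum>j\<in>J. a j * z j x) = 0) \<and> (\<exists>j\<in>J. odd (a j))"
proof -
  obtain i where i: "i \<in> J" "c i \<noteq> 0" using nz by blast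
  obtain f :: "complex \<Rightarrow> rat" where f: "\<And>x y. f (x + y) = f x + f y"
    "\<And>x (m::int). f (x * of_int m) = f x * of_int m" "f (c i) \<noteq> 0"
    using rational_functional[OF i(2)] by blast
  have f0: "f 0 = 0" using f(1)[of 0 0] by simp
  have fsum: "f (\<Sum>j\<in>A. h j) = (\<Sum>j\<in>A. f (h j))" for A and h :: "'i \<Rightarrow> complex"
    by (induction A rule: infinite_finite_induct) (simp_all add: f0 f(1))
  have rel1: "(\<Sum>j\<in>J. f (c j) * of_int (z j x)) = 0" for x
    using fsum[of "\<lambda>j. c j * of_int (z j x)" J] rel[of x] by (simp add: f0 f(2))
  obtain d where d: "d \<noteq> 0" "\<And>j. j \<in> J \<Longrightarrow> \<exists>b::int. of_int d * f (c j) = of_int b"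
    using common_denominator[OF fin, of "\<lambda>j. f (c j)"] by blast
  then obtain b where b: "\<And>j. j \<in> J \<Longrightarrow> of_int d * f (c j) = of_int (b j)" by metis
  have "(\<Sum>j\<in>J. b j * z j x) = 0" for x
  proof -
    have "of_int (\<Sum>j\<in>J. b j * z j x) = (\<Sum>j\<in>J. of_int d * (f (c j) * of_int (z j x)))"
      unfolding of_int_sum
    proof (rule sum.cong)
      fix j assume "j \<in> J"
      then show "(of_int (b j * z j x) :: rat) = of_int d * (f (c j) * of_int (z j x))"
        using b[of j] by (metis mult.assoc of_int_mult)
    qed simp
    also have "\<dots> = of_int d * (\<Sum>j\<in>J. f (c j) * of_int (z j x))" by (simp add: sum_distrib_left)
    finally have "(of_int (\<Sum>j\<in>J. b j * z j x) :: rat) = 0" by (simp add: rel1)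
    then show ?thesis by (simp only: of_int_eq_0_iff)
  qed
  moreover have "b i \<noteq> 0"
    using b[OF i(1)] d(1) f(3) by (metis mult_eq_0_iff of_int_0 of_int_eq_0_iff)
  ultimately show ?thesis using integer_relation_primitive[OF fin, of b z] i(1) by blast
qed

text \<open>Vectors independent modulo two are independent over the complex numbers: a complex
  relation would yield an integer relation with an odd coefficient, which is nontrivial modulo
  two.\<close>

lemma (in char_two) dim_mod_two_le:
  fixes z :: "'i \<Rightarrow> 't \<Rightarrow> int"
  assumes fin: "finite X" and supp: "\<And>i x. i \<in> I \<Longrightarrow> x \<notin> X \<Longrightarrow> z i x = 0"
  shows "fun_vs.dim ((\<lambda>i x. of_int (z i x) :: 'k) ` I) \<le> fun_vs.dim ((\<lambda>i x. of_int (z i x) :: complex) ` I)"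
proof -
  let ?k = "\<lambda>i x. of_int (z i x) :: 'k" and ?c = "\<lambda>i x. of_int (z i x) :: complex"
  obtain B where B: "B \<subseteq> ?k ` I" "fun_vs.independent B" "?k ` I \<subseteq> fun_vs.span B"
    "card B = fun_vs.dim (?k ` I)"
    by (rule fun_vs.basis_exists)
  have "?k ` I \<subseteq> supported X" using supp by (auto simp: supported_def)
  then have finB: "finite B" using card_independent_le_dim(1)[OF fin _ B(1,2)] by blast
  obtain J where J: "J \<subseteq> I" "inj_on ?k J" "B = ?k ` J" using B(1) by (meson subset_image_inj)
  have finJ: "finite J" using finB J(2,3) by (simp add: finite_image_iff)
  have no_rel: "\<not> (\<exists>j\<in>J. odd (a j))" if "\<forall>x. (\<Sum>j\<in>J. a j * z j x) = 0" for a
  proof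
    assume "\<exists>j\<in>J. odd (a j)"
    then obtain j where j: "j \<in> J" "odd (a j)" by blast
    have "(\<Sum>v\<in>B. fscale (of_int (a (the_inv_into J ?k v))) v) = (\<Sum>j\<in>J. fscale (of_int (a j)) (?k j))"
      unfolding J(3) by (simp add: sum.reindex[OF J(2)] the_inv_into_f_f[OF J(2)])
    also have "\<dots> = 0"
    proof
      fix x
      have "(\<Sum>j\<in>J. fscale (of_int (a j)) (?k j)) x = of_int (\<Sum>j\<in>J. a j * z j x)"
        by (simp add: sum_fun_apply fscale_def)
      then show "(\<Sum>j\<in>J. fscale (of_int (a j)) (?k j)) x = 0 x" using that by simp
    qed
    finally have sum0: "(\<Sum>v\<in>B. fscale (of_int (a (the_inv_into J ?k v))) v) = 0" .
    have "?k j \<in> B" using j(1) J(3) by blast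
    then have "of_int (a (the_inv_into J ?k (?k j))) = (0 :: 'k)"
      using fun_vs.independentD[OF B(2) finB order_refl sum0] by blast
    then have "of_int (a j) = (0 :: 'k)" by (simp add: the_inv_into_f_f[OF J(2) j(1)])
    moreover obtain m where "a j = 2 * m + 1" using j(2) by (elim oddE)
    moreover have "(2 :: 'k) = 0" using of_nat_char_two[of 2] by simp
    ultimately show False by simp
  qed
  have indep_c: "c j = 0" if "(\<Sum>j\<in>J. fscale (c j) (?c j)) = 0" "j \<in> J" for c j
  proof (rule ccontr)
    assume "c j \<noteq> 0"
    have "(\<Sum>j\<in>J. c j * of_int (z j x)) = 0" for x
      using fun_cong[OF that(1), of x] by (simp add: sum_fun_apply fscale_def)
    then show False using complex_relation_integer[OF finJ, of c z] no_rel \<open>c j \<noteq> 0\<close> that(2) by blast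
  qed
  have inj: "inj_on ?c J"
  proof (rule inj_onI, rule ccontr)
    fix i j assume ij: "i \<in> J" "j \<in> J" "?c i = ?c j" "i \<noteq> j"
    then have "z i x = z j x" for x by (metis of_int_eq_iff)
    then have "?k i = ?k j" by simp
    then show False using J(2) ij by (auto dest: inj_onD)
  qed
  have "fun_vs.independent (?c ` J)"
  proof (rule fun_vs.independent_if_scalars_zero)
    show "finite (?c ` J)" using finJ by simp
    fix f v assume "(\<Sum>v\<in>?c ` J. fscale (f v) v) = 0" "v \<in> ?c ` J"
    then show "f v = 0"
      using indep_c[of "\<lambda>j. f (?c j)"] by (auto simp: sum.reindex[OF inj])
  qed
  then have "card (?c ` J) \<le> fun_vs.dim (?c ` I)"
    by (intro card_independent_le_dim(2)[OF fin]) (use supp J(1) in \<open>auto simp: supported_def\<close>)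
  then show ?thesis using B(4) J(2,3) inj by (simp add: card_image)
qed

section \<open>Orbit sums\<close>

lemma orbit_sum_apply:
  "orbit_sum n v1 v2 v3 (T1, T2, T3) = (\<Sum>p\<in>perms n. act p v1 T1 * act p v2 T2 * act p v3 T3)"
  by (simp add: orbit_sum_def)

lemma orbit_sum_add:
  "orbit_sum n (v1 + w1) v2 v3 = orbit_sum n v1 v2 v3 + orbit_sum n w1 v2 v3"
  "orbit_sum n v1 (v2 + w2) v3 = orbit_sum n v1 v2 v3 + orbit_sum n v1 w2 v3"
  "orbit_sum n v1 v2 (v3 + w3) = orbit_sum n v1 v2 v3 + orbit_sum n v1 v2 w3"
  by (auto simp: orbit_sum_def fun_eq_iff act_def algebra_simps sum.distrib)

lemma orbit_sum_scale:
  "orbit_sum n (fscale c v1) v2 v3 = fscale c (orbit_sum n v1 v2 v3)"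
  "orbit_sum n v1 (fscale c v2) v3 = fscale c (orbit_sum n v1 v2 v3)"
  "orbit_sum n v1 v2 (fscale c v3) = fscale c (orbit_sum n v1 v2 v3)"
  by (auto simp: orbit_sum_def fun_eq_iff act_def fscale_def sum_distrib_left mult_ac)

lemma linear_span_into:
  assumes add: "\<And>f g. h (f + g) = h f + h g" and scale: "\<And>c f. h (fscale c f) = fscale c (h f)"
    and sub: "fun_vs.subspace S" and gen: "\<And>b. b \<in> B \<Longrightarrow> h b \<in> S" and v: "v \<in> fun_vs.span B"
  shows "h v \<in> S"
proof -
  have "h 0 = 0" using scale[of 0 0] by (simp add: fscale_def zero_fun_def)
  then have "fun_vs.subspace {v. h v \<in> S}"
    using sub unfolding fun_vs.subspace_def by (simp add: add scale)
  then have "fun_vs.span B \<subseteq> {v. h v \<in> S}" using gen by (intro fun_vs.span_minimal) auto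
  then show ?thesis using v by auto
qed

definition orbit_space :: "nat \<Rightarrow> (tabloid \<Rightarrow> 'k::field) set \<Rightarrow> (tabloid \<Rightarrow> 'k) set \<Rightarrow> (tabloid \<Rightarrow> 'k) set \<Rightarrow>
    (tabloid \<times> tabloid \<times> tabloid \<Rightarrow> 'k) set" where
  "orbit_space n V1 V2 V3 = fun_vs.span {orbit_sum n v1 v2 v3 | v1 v2 v3. v1 \<in> V1 \<and> v2 \<in> V2 \<and> v3 \<in> V3}"

lemma orbit_sum_in_orbit_space:
  "v1 \<in> V1 \<Longrightarrow> v2 \<in> V2 \<Longrightarrow> v3 \<in> V3 \<Longrightarrow> orbit_sum n v1 v2 v3 \<in> orbit_space n V1 V2 V3"
  unfolding orbit_space_def by (rule fun_vs.span_base) blast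

text \<open>Norms are linear in each of the three arguments. This reduces the generators to norms of
  polytabloids, which are images of integer vectors.\<close>

lemma orbit_space_span:
  "orbit_space n (fun_vs.span B1) (fun_vs.span B2) (fun_vs.span B3) =
    fun_vs.span {orbit_sum n v1 v2 v3 | v1 v2 v3. v1 \<in> B1 \<and> v2 \<in> B2 \<and> v3 \<in> B3}" (is "?L = ?R")
proof
  have 3: "orbit_sum n v1 v2 v3 \<in> ?R" if "v1 \<in> B1" "v2 \<in> B2" "v3 \<in> fun_vs.span B3" for v1 v2 v3
    by (rule linear_span_into[OF orbit_sum_add(3) orbit_sum_scale(3) fun_vs.subspace_span _ that(3)])
      (rule fun_vs.span_base, use that in blast)
  have 2: "orbit_sum n v1 v2 v3 \<in> ?R" if "v1 \<in> B1" "v2 \<in> fun_vs.span B2" "v3 \<in> fun_vs.span B3" for v1 v2 v3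
    by (rule linear_span_into[where h = "\<lambda>v2. orbit_sum n v1 v2 v3", OF orbit_sum_add(2) orbit_sum_scale(2) fun_vs.subspace_span _ that(2)])
      (rule 3[OF that(1) _ that(3)])
  have 1: "orbit_sum n v1 v2 v3 \<in> ?R" if "v1 \<in> fun_vs.span B1" "v2 \<in> fun_vs.span B2" "v3 \<in> fun_vs.span B3" for v1 v2 v3
    by (rule linear_span_into[where h = "\<lambda>v1. orbit_sum n v1 v2 v3", OF orbit_sum_add(1) orbit_sum_scale(1) fun_vs.subspace_span _ that(1)])
      (rule 2[OF _ that(2,3)])
  show "?L \<subseteq> ?R" unfolding orbit_space_def by (rule fun_vs.span_minimal) (use 1 in auto)
  show "?R \<subseteq> ?L"
    unfolding orbit_space_def by (rule fun_vs.span_mono) (use fun_vs.span_base in blast)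
qed

lemma orbit_space_mono: "V3 \<subseteq> W3 \<Longrightarrow> orbit_space n V1 V2 V3 \<subseteq> orbit_space n V1 V2 W3"
  unfolding orbit_space_def by (rule fun_vs.span_mono) blast

lemma act_supported:
  assumes "f \<in> supported (tabloids n l)" "p permutes {1..n}" "T \<notin> tabloids n l"
  shows "act p f T = 0"
  using supportedD[OF assms(1)] assms(3) tabloid_act_in_tabloids[OF permutes_inv[OF assms(2)]]
  by (simp add: act_def)

lemma orbit_space_supported:
  assumes "V1 \<subseteq> supported (tabloids n l1)" "V2 \<subseteq> supported (tabloids n l2)" "V3 \<subseteq> supported (tabloids n l3)"
  shows "orbit_space n V1 V2 V3 \<subseteq> supported (tabloids n l1 \<times> tabloids n l2 \<times> tabloids n l3)"
  unfolding orbit_space_def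
proof (rule fun_vs.span_minimal[OF _ subspace_supported], clarify)
  fix v1 v2 v3 assume "v1 \<in> V1" "v2 \<in> V2" "v3 \<in> V3"
  then have v: "v1 \<in> supported (tabloids n l1)" "v2 \<in> supported (tabloids n l2)" "v3 \<in> supported (tabloids n l3)"
    using assms by auto
  have "(\<Sum>p\<in>perms n. act p v1 T1 * act p v2 T2 * act p v3 T3) = 0"
    if "(T1, T2, T3) \<notin> tabloids n l1 \<times> tabloids n l2 \<times> tabloids n l3" for T1 T2 T3
    by (rule sum.neutral) (use that act_supported[OF v(1)] act_supported[OF v(2)] act_supported[OF v(3)] in auto)
  then show "orbit_sum n v1 v2 v3 \<in> supported (tabloids n l1 \<times> tabloids n l2 \<times> tabloids n l3)"
    by (auto simp: supported_def orbit_sum_def)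
qed

definition polytabloid_int :: "nat \<Rightarrow> (nat \<Rightarrow> nat) \<Rightarrow> (nat \<times> nat \<Rightarrow> nat) \<Rightarrow> tabloid \<Rightarrow> int" where
  "polytabloid_int n l t = (\<lambda>T. \<Sum>p\<in>column_stabilizer n l t.
    sign p * (if T = tabloid_act p (tabloid_of l t) then 1 else 0))"

lemma of_int_polytabloid_int: "of_int (polytabloid_int n l t T) = polytabloid n l t T"
  unfolding polytabloid_int_def polytabloid_def of_int_sum
  by (rule sum.cong) auto

lemma (in char_two) dim_orbit_space_le:
  assumes l: "l1 \<in> partitions n" "l2 \<in> partitions n" "l3 \<in> partitions n"
  shows "fun_vs.dim (orbit_space n (specht n l1) (specht n l2) (specht n l3) :: (_ \<Rightarrow> 'k) set) \<le>
    fun_vs.dim (orbit_space n (specht n l1) (specht n l2) (specht n l3) :: (_ \<Rightarrow> complex) set)"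
proof -
  define I where "I = {(t1, t2, t3). tableau n l1 t1 \<and> tableau n l2 t2 \<and> tableau n l3 t3}"
  define z where "z = (\<lambda>(t1, t2, t3) (T1, T2, T3). \<Sum>p\<in>perms n.
    polytabloid_int n l1 t1 (tabloid_act (inv p) T1) * polytabloid_int n l2 t2 (tabloid_act (inv p) T2) *
    polytabloid_int n l3 t3 (tabloid_act (inv p) T3))"
  \<comment> \<open>The integer vectors \<open>z\<close> do not depend on the field, so the same
    family generates the orbit space in characteristic two and over the complex numbers.\<close>
  have z: "(\<lambda>x. of_int (z (t1, t2, t3) x)) =
      (orbit_sum n (polytabloid n l1 t1) (polytabloid n l2 t2) (polytabloid n l3 t3) :: _ \<Rightarrow> 'f::field)"
    for t1 t2 t3
    by (auto simp: fun_eq_iff z_def orbit_sum_def act_def of_int_polytabloid_int)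
  have dim: "fun_vs.dim (orbit_space n (specht n l1) (specht n l2) (specht n l3) :: (_ \<Rightarrow> 'f::field) set) =
      fun_vs.dim ((\<lambda>i x. of_int (z i x) :: 'f) ` I)"
  proof -
    have "{orbit_sum n v1 v2 v3 | v1 v2 v3. v1 \<in> {polytabloid n l1 t | t. tableau n l1 t} \<and>
      v2 \<in> {polytabloid n l2 t | t. tableau n l2 t} \<and> v3 \<in> {polytabloid n l3 t | t. tableau n l3 t}} =
      (\<lambda>i x. of_int (z i x) :: 'f) ` I" (is "?L = ?R")
    proof
      show "?L \<subseteq> ?R"
      proof clarify
        fix t1 t2 t3 assume "tableau n l1 t1" "tableau n l2 t2" "tableau n l3 t3"
        then have "(t1, t2, t3) \<in> I" by (simp add: I_def)
        then have "(\<lambda>x. of_int (z (t1, t2, t3) x) :: 'f) \<in> ?R" by (rule imageI)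
        then show "orbit_sum n (polytabloid n l1 t1) (polytabloid n l2 t2) (polytabloid n l3 t3) \<in> ?R"
          by (simp only: z)
      qed
      show "?R \<subseteq> ?L"
      proof (rule image_subsetI)
        fix i assume i: "i \<in> I"
        obtain t1 t2 t3 where it: "i = (t1, t2, t3)" by (cases i)
        have "tableau n l1 t1" "tableau n l2 t2" "tableau n l3 t3" using i by (auto simp: I_def it)
        then show "(\<lambda>x. of_int (z i x) :: 'f) \<in> ?L" unfolding it z by blast
      qed
    qed
    then show ?thesis
      unfolding specht_def orbit_space_span fun_vs.dim_span by (simp only:)
  qed
  let ?X = "tabloids n l1 \<times> tabloids n l2 \<times> tabloids n l3"
  have fin: "finite ?X" using finite_tabloids l by blast
  have "z i x = 0" if "i \<in> I" "x \<notin> ?X" for i x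
  proof -
    obtain t1 t2 t3 where i: "i = (t1, t2, t3)" by (cases i)
    have "orbit_sum n (polytabloid n l1 t1) (polytabloid n l2 t2) (polytabloid n l3 t3) \<in>
        orbit_space n (specht n l1) (specht n l2) (specht n l3 :: (tabloid \<Rightarrow> complex) set)"
      using that(1) by (intro orbit_sum_in_orbit_space polytabloid_in_specht) (auto simp: I_def i)
    then have "(\<lambda>x. of_int (z i x) :: complex) \<in> supported ?X"
      using orbit_space_supported[OF specht_supported specht_supported specht_supported] unfolding i z by blast
    then have "(of_int (z i x) :: complex) = 0" using that(2) by (rule supportedD)
    then show ?thesis by simp
  qed
  then show ?thesis unfolding dim by (rule dim_mod_two_le[OF fin])
qed

section \<open>Norms along a composition series\<close>

section \<open>Composition factors\<close>

definition group_sum :: "nat \<Rightarrow> ((nat \<Rightarrow> nat) \<Rightarrow> 'k) \<Rightarrow> (tabloid \<Rightarrow> 'k::field) \<Rightarrow> tabloid \<Rightarrow> 'k" where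
  "group_sum n c x = (\<Sum>p\<in>perms n. fscale (c p) (act p x))"

lemma group_sum_in:
  assumes "submodule n U" "x \<in> U"
  shows "group_sum n c x \<in> U"
  unfolding group_sum_def
  by (intro fun_vs.subspace_sum fun_vs.subspace_scale submoduleD[OF assms(1)] assms(2)) simp

lemma orbit_sum_slice:
  "(\<lambda>T3. orbit_sum n v1 v2 x (T1, T2, T3)) = group_sum n (\<lambda>p. act p v1 T1 * act p v2 T2) x"
  by (simp add: fun_eq_iff orbit_sum_def group_sum_def sum_fun_apply fscale_def)

text \<open>With the first two tabloids fixed, a norm is the image of its third argument under an
  element of the group algebra, and a submodule is closed under these.\<close>

lemma orbit_space_slice:
  assumes U: "submodule n U" and h: "h \<in> orbit_space n V1 V2 U"
  shows "(\<lambda>T3. h (T1, T2, T3)) \<in> U"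
  using h unfolding orbit_space_def
proof (rule linear_span_into[where h = "\<lambda>h T3. h (T1, T2, T3)", rotated -1])
  show "fun_vs.subspace U" using U by (rule submoduleD)
  fix b assume "b \<in> {orbit_sum n v1 v2 v3 |v1 v2 v3. v1 \<in> V1 \<and> v2 \<in> V2 \<and> v3 \<in> U}"
  then show "(\<lambda>T3. b (T1, T2, T3)) \<in> U"
    using group_sum_in[OF U] by (auto simp: orbit_sum_slice)
qed (simp_all add: fun_eq_iff fscale_def)

lemma coset_add:
  assumes "fun_vs.subspace U"
  shows "(x +o U) + (y +o U) = (x + y) +o (U :: ('t \<Rightarrow> 'k::field) set)"
proof -
  have "U + U = U"
    using fun_vs.subspace_add[OF assms] fun_vs.subspace_0[OF assms]
    by (auto simp: set_plus_def) (metis add_0)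
  then show ?thesis by (simp add: set_plus_rearrange)
qed

lemma coset_scale:
  assumes "fun_vs.subspace U"
  shows "fscale c ` (x +o U) + U = fscale c x +o (U :: ('t \<Rightarrow> 'k::field) set)"
proof
  show "fscale c ` (x +o U) + U \<subseteq> fscale c x +o U"
  proof
    fix y assume "y \<in> fscale c ` (x +o U) + U"
    then obtain u u' where "u \<in> U" "u' \<in> U" "y = fscale c (x + u) + u'"
      by (auto simp: set_plus_def elt_set_plus_def)
    then have "y = fscale c x + (fscale c u + u')" "fscale c u + u' \<in> U"
      using fun_vs.subspace_add[OF assms] fun_vs.subspace_scale[OF assms]
      by (simp_all add: fun_vs.scale_right_distrib add.assoc)
    then show "y \<in> fscale c x +o U" by (auto simp: elt_set_plus_def)
  qed
  show "fscale c x +o U \<subseteq> fscale c ` (x +o U) + U"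
  proof
    fix y assume "y \<in> fscale c x +o U"
    then obtain u where u: "u \<in> U" "y = fscale c x + u" by (auto simp: elt_set_plus_def)
    have "x \<in> x +o U" using fun_vs.subspace_0[OF assms] by (force simp: elt_set_plus_def)
    then show "y \<in> fscale c ` (x +o U) + U" using u by (auto simp: set_plus_def)
  qed
qed

lemma coset_act:
  assumes U: "submodule n U" and p: "p permutes {1..n}"
  shows "act p ` (x +o U) = act p x +o U"
proof
  show "act p ` (x +o U) \<subseteq> act p x +o U"
    using submoduleD(2)[OF U p] by (auto simp: elt_set_plus_def act_add)
  show "act p x +o U \<subseteq> act p ` (x +o U)"
  proof
    fix y assume "y \<in> act p x +o U"
    then obtain u where u: "u \<in> U" "y = act p x + u" by (auto simp: elt_set_plus_def)
    have "y = act p (x + act (inv p) u)" by (simp only: act_add act_inv[OF p] u(2))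
    moreover have "act (inv p) u \<in> U" using submoduleD(2)[OF U permutes_inv[OF p] u(1)] .
    ultimately show "y \<in> act p ` (x +o U)" by (auto simp: elt_set_plus_def)
  qed
qed

text \<open>Isomorphic modules have the same annihilator in the group algebra. The isomorphism is
  given on cosets; those of the zero module are singletons, so it comes from a linear equivariant
  map \<open>f\<close> on \<open>V\<close> that is constant on cosets of \<open>U\<close>.\<close>

lemma quotient_iso_annihilator:
  assumes iso: "quotient_iso n V U A {0}"
    and V: "submodule n V" and U: "submodule n U" and A: "submodule n A"
    and ann: "\<And>x. x \<in> V \<Longrightarrow> group_sum n c x \<in> U" and w: "w \<in> A"
  shows "group_sum n c w = 0"
proof -
  have subU: "fun_vs.subspace U" using U by (rule submoduleD)
  have subV: "fun_vs.subspace V" using V by (rule submoduleD)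
  from iso obtain h where "bij_betw h (cosets V U) (cosets A {0}) \<and>
      (\<forall>B\<in>cosets V U. \<forall>C\<in>cosets V U. h (B + C) = h B + h C) \<and>
      (\<forall>c. \<forall>B\<in>cosets V U. h (fscale c ` B + U) = fscale c ` h B + {0}) \<and>
      (\<forall>p. p permutes {1..n} \<longrightarrow> (\<forall>B\<in>cosets V U. h (act p ` B) = act p ` h B))"
    unfolding quotient_iso_def by (rule exE)
  then have h: "bij_betw h (cosets V U) (cosets A {0})"
    "\<And>B C. B \<in> cosets V U \<Longrightarrow> C \<in> cosets V U \<Longrightarrow> h (B + C) = h B + h C"
    "\<And>c B. B \<in> cosets V U \<Longrightarrow> h (fscale c ` B + U) = fscale c ` h B + {0}"
    "\<And>p B. p permutes {1..n} \<Longrightarrow> B \<in> cosets V U \<Longrightarrow> h (act p ` B) = act p ` h B"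
    by blast+
  have cos: "x +o U \<in> cosets V U" if "x \<in> V" for x using that by (auto simp: cosets_def)
  have sing: "a +o {0} = {a}" for a :: "tabloid \<Rightarrow> 'a" by (auto simp: elt_set_plus_def)
  have "\<exists>a. h (x +o U) = {a}" if "x \<in> V" for x
  proof -
    have "h (x +o U) \<in> cosets A {0}" using h(1) cos[OF that] by (rule bij_betw_apply)
    then show ?thesis by (auto simp: cosets_def sing)
  qed
  then obtain f where f: "\<And>x. x \<in> V \<Longrightarrow> h (x +o U) = {f x}" by metis
  have add: "f (x + y) = f x + f y" if "x \<in> V" "y \<in> V" for x y
  proof -
    have "{f (x + y)} = h ((x +o U) + (y +o U))"
      unfolding coset_add[OF subU] using f fun_vs.subspace_add[OF subV that] by simp
    also have "\<dots> = {f x} + {f y}" using h(2)[OF cos cos] f that by simp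
    finally show ?thesis by (simp add: set_plus_def)
  qed
  have scale: "f (fscale a x) = fscale a (f x)" if "x \<in> V" for a x
  proof -
    have "{f (fscale a x)} = h (fscale a ` (x +o U) + U)"
      unfolding coset_scale[OF subU] using f fun_vs.subspace_scale[OF subV that] by simp
    also have "\<dots> = fscale a ` {f x} + {0}" using h(3)[OF cos] f that by simp
    finally show ?thesis by (simp add: set_plus_def)
  qed
  have act: "f (act p x) = act p (f x)" if "x \<in> V" "p permutes {1..n}" for p x
  proof -
    have "{f (act p x)} = h (act p ` (x +o U))"
      unfolding coset_act[OF U that(2)] using f submoduleD(2)[OF V that(2,1)] by simp
    also have "\<dots> = act p ` {f x}" using h(4)[OF that(2) cos] f that by simp
    finally show ?thesis by simp
  qed
  have V0: "0 \<in> V" using subV by (rule fun_vs.subspace_0)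
  have f0: "f 0 = 0" using add[OF V0 V0] by simp
  have sum: "f (\<Sum>p\<in>P. g p) = (\<Sum>p\<in>P. f (g p)) \<and> (\<Sum>p\<in>P. g p) \<in> V"
    if "\<And>p. p \<in> P \<Longrightarrow> g p \<in> V" for P and g :: "(nat \<Rightarrow> nat) \<Rightarrow> tabloid \<Rightarrow> 'a"
    using that
  proof (induction P rule: infinite_finite_induct)
    case (insert p P)
    then show ?case
      using add[of "g p" "\<Sum>p\<in>P. g p"] fun_vs.subspace_add[OF subV, of "g p" "\<Sum>p\<in>P. g p"]
      by (simp only: sum.insert insert_iff simp_thms)
  qed (use f0 V0 in simp_all)
  have "{w} \<in> cosets A {0}" using w by (auto simp: cosets_def sing)
  then have "{w} \<in> h ` cosets V U" using h(1) by (simp add: bij_betw_def)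
  then obtain B where "B \<in> cosets V U" "h B = {w}" by (metis imageE)
  then obtain x where x: "x \<in> V" "f x = w" using f by (auto simp: cosets_def)
  have "f (group_sum n c x) = (\<Sum>p\<in>perms n. f (fscale (c p) (act p x)))"
    unfolding group_sum_def
    using sum[of "perms n" "\<lambda>p. fscale (c p) (act p x)"] fun_vs.subspace_scale[OF subV] submoduleD(2)[OF V _ x(1)]
    by auto
  also have "\<dots> = group_sum n c w"
    unfolding group_sum_def using scale act submoduleD(2)[OF V _ x(1)] x by (intro sum.cong) auto
  finally have 1: "f (group_sum n c x) = group_sum n c w" .
  have y: "group_sum n c x \<in> U" using ann[OF x(1)] .
  have "group_sum n c x +o U = 0 +o U"
  proof
    show "group_sum n c x +o U \<subseteq> 0 +o U"
      using fun_vs.subspace_add[OF subU y] by (auto simp: elt_set_plus_def)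
    show "0 +o U \<subseteq> group_sum n c x +o U"
    proof
      fix u assume "u \<in> 0 +o U"
      then have "u - group_sum n c x \<in> U" using fun_vs.subspace_diff[OF subU _ y] by (auto simp: elt_set_plus_def)
      moreover have "u = group_sum n c x + (u - group_sum n c x)" by simp
      ultimately show "u \<in> group_sum n c x +o U" unfolding elt_set_plus_def by blast
    qed
  qed
  then have "{f (group_sum n c x)} = {f 0}" using f[OF V0] f[OF group_sum_in[OF V x(1)]] by metis
  then show ?thesis using 1 f0 by simp
qed

text \<open>A proper submodule of largest dimension is maximal. Existence guarantees that the series
  chosen in \<open>composition_mult\<close> really is a composition series.\<close>

lemma composition_series_exists:
  fixes V :: "(tabloid \<Rightarrow> 'k::field) set"
  assumes fin: "finite X" and "submodule n V" "V \<subseteq> supported X"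
  shows "\<exists>Us. composition_series n V Us"
  using assms(2,3)
proof (induction "fun_vs.dim V" arbitrary: V rule: less_induct)
  case less
  have sub0: "submodule n {0 :: tabloid \<Rightarrow> 'k}"
    by (auto simp: submodule_def fun_vs.subspace_def fscale_def zero_fun_def act_def)
  have zero_in: "0 \<in> U" if "submodule n U" for U :: "(tabloid \<Rightarrow> 'k) set"
    using submoduleD(1)[OF that] by (rule fun_vs.subspace_0)
  show ?case
  proof (cases "V = {0}")
    case True
    then show ?thesis by (intro exI[of _ "[{0}]"]) (simp add: composition_series_def)
  next
    case False
    define P where "P U \<longleftrightarrow> submodule n U \<and> U \<subset> V" for U
    have "P {0}" using sub0 zero_in[OF less.prems(1)] False by (auto simp: P_def)
    moreover have "fun_vs.dim U \<le> fun_vs.dim V" if "P U" for U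
      using that dim_mono[OF fin less.prems(2)] by (auto simp: P_def)
    ultimately have "\<exists>U. P U \<and> (\<forall>W. P W \<longrightarrow> fun_vs.dim W \<le> fun_vs.dim U)"
      by (intro ex_has_greatest_nat[of P "{0}" fun_vs.dim "Suc (fun_vs.dim V)"]) (auto simp: less_Suc_eq_le)
    then obtain U where U: "P U" "\<And>W. P W \<Longrightarrow> fun_vs.dim W \<le> fun_vs.dim U" by blast
    have Us: "submodule n U" "U \<subset> V" using U(1) by (auto simp: P_def)
    have max: "maximal_submodule n U V"
      unfolding maximal_submodule_def
    proof (intro conjI allI impI Us less.prems)
      fix W assume W: "submodule n W \<and> U \<subseteq> W \<and> W \<subseteq> V"
      show "W = U \<or> W = V"
      proof (rule ccontr)
        assume "\<not> (W = U \<or> W = V)"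
        then have "P W" "U \<subset> W" using W unfolding P_def by blast+
        moreover have "W \<subseteq> supported X" using W less.prems(2) by (meson order_trans)
        ultimately have "fun_vs.dim U < fun_vs.dim W"
          using dim_less[OF fin _ submoduleD(1)[OF Us(1)]] by metis
        then show False using U(2)[of W] \<open>P W\<close> by simp
      qed
    qed
    have "fun_vs.dim U < fun_vs.dim V"
      by (rule dim_less[OF fin less.prems(2) submoduleD(1)[OF Us(1)] Us(2)])
    then obtain Vs where Vs: "composition_series n U Vs"
      using less.hyps[of U] Us less.prems(2) by blast
    then have ne: "Vs \<noteq> []" "last Vs = U" by (auto simp: composition_series_def)
    have "composition_series n V (Vs @ [V])"
      unfolding composition_series_def
    proof (intro conjI allI impI)
      show "hd (Vs @ [V]) = {0}" using Vs by (simp add: composition_series_def)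
      fix i assume i: "Suc i < length (Vs @ [V])"
      show "maximal_submodule n ((Vs @ [V]) ! i) ((Vs @ [V]) ! Suc i)"
      proof (cases "Suc i < length Vs")
        case True
        then show ?thesis using Vs by (simp add: composition_series_def nth_append)
      next
        case False
        then have "i = length Vs - 1" "Suc i = length Vs" using i by auto
        then show ?thesis using max ne by (simp add: nth_append last_conv_nth)
      qed
    qed simp_all
    then show ?thesis by blast
  qed
qed

context staircase_char_two
begin

text \<open>Along a composition series the orbit spaces grow strictly at every factor isomorphic to the
  simple module \<open>specht n \<beta>\<close>.\<close>

lemma decomposition_number_le_dim:
  assumes \<alpha>: "\<alpha> \<in> partitions n" and \<beta>: "\<beta> \<in> partitions n" and c: "carter \<beta>"
  shows "decomposition_number TYPE('k) n \<alpha> \<beta> \<le>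
    fun_vs.dim (orbit_space n (specht n \<rho>) (specht n \<rho>) (specht n \<alpha>) :: (_ \<Rightarrow> 'k) set)"
proof -
  let ?D = "\<lambda>U. orbit_space n (specht n \<rho>) (specht n \<rho>) U :: (_ \<Rightarrow> 'k) set"
  let ?X = "tabloids n \<rho> \<times> tabloids n \<rho> \<times> tabloids n \<alpha>"
  have finX: "finite ?X" using finite_tabloids[OF \<rho>_part] finite_tabloids[OF \<alpha>] by simp
  define Us where "Us = (SOME Us. composition_series n (specht n \<alpha> :: (tabloid \<Rightarrow> 'k) set) Us)"
  have Us: "composition_series n (specht n \<alpha>) Us"
    unfolding Us_def
    by (rule someI_ex, rule composition_series_exists[OF finite_tabloids[OF \<alpha>] submodule_specht specht_supported])
  have ne: "Us \<noteq> []" and last: "last Us = specht n \<alpha>"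
    and max: "\<And>i. Suc i < length Us \<Longrightarrow> maximal_submodule n (Us ! i) (Us ! Suc i)"
    using Us by (auto simp: composition_series_def)
  define Q where "Q i \<longleftrightarrow> quotient_iso n (Us ! Suc i) (Us ! i) (specht n \<beta>) {0}" for i
  have sub: "Us ! i \<subseteq> specht n \<alpha>" if "i < length Us" for i
  proof -
    have "Us ! i \<subseteq> Us ! j" if "i \<le> j" "j < length Us" for j
      using that
    proof (induction rule: dec_induct)
      case (step m)
      have "Us ! m \<subseteq> Us ! Suc m"
        using max[OF step.prems] unfolding maximal_submodule_def by blast
      then show ?case using step.IH[OF Suc_lessD[OF step.prems]] by (rule order_trans[rotated])
    qed simp
    from this[of "length Us - 1"] show ?thesis using that ne last by (simp add: last_conv_nth)
  qed
  have suppD: "?D U \<subseteq> supported ?X" if "U \<subseteq> specht n \<alpha>" for U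
    by (rule orbit_space_supported[OF specht_supported specht_supported])
      (use that specht_supported in blast)
  have strict: "?D (Us ! i) \<subset> ?D (Us ! Suc i)" if i: "Suc i < length Us" "Q i" for i
  proof -
    have m: "submodule n (Us ! i)" "submodule n (Us ! Suc i)" "Us ! i \<subseteq> Us ! Suc i"
      using max[OF i(1)] by (auto simp: maximal_submodule_def)
    have "?D (Us ! i) \<subseteq> ?D (Us ! Suc i)" using m(3) by (rule orbit_space_mono)
    \<comment> \<open>Without growth, the group algebra elements built from coordinates of
      \<open>v1\<close> and \<open>v2\<close> would carry \<open>Us ! Suc i\<close> into
      \<open>Us ! i\<close>. They would annihilate the factor, hence the isomorphic S(\<beta>), and
      all norms on S(\<beta>) would vanish.\<close>
    moreover have "?D (Us ! i) \<noteq> ?D (Us ! Suc i)"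
    proof
      assume eq: "?D (Us ! i) = ?D (Us ! Suc i)"
      have "orbit_sum n v1 v2 w = 0"
        if v: "v1 \<in> specht n \<rho>" "v2 \<in> specht n \<rho>" "w \<in> specht n \<beta>" for v1 v2 w :: "tabloid \<Rightarrow> 'k"
      proof -
        have "group_sum n (\<lambda>p. act p v1 T1 * act p v2 T2) w = 0" for T1 T2
        proof (rule quotient_iso_annihilator[OF i(2)[unfolded Q_def] m(2,1) submodule_specht _ v(3)])
          fix x assume x: "x \<in> Us ! Suc i"
          have "orbit_sum n v1 v2 x \<in> ?D (Us ! i)"
            unfolding eq using v x by (intro orbit_sum_in_orbit_space)
          then show "group_sum n (\<lambda>p. act p v1 T1 * act p v2 T2) x \<in> Us ! i"
            unfolding orbit_sum_slice[symmetric] by (rule orbit_space_slice[OF m(1)])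
        qed
        then have "orbit_sum n v1 v2 w (T1, T2, T3) = 0" for T1 T2 T3
          using fun_cong[OF orbit_sum_slice, of n v1 v2 w T1 T2 T3] by simp
        then show ?thesis by auto
      qed
      then show False using carter_orbit_sum_nonzero[OF \<beta> c] by blast
    qed
    ultimately show ?thesis by blast
  qed
  have "card {i'. i' < i \<and> Q i'} \<le> fun_vs.dim (?D (Us ! i))" if "i < length Us" for i
    using that
  proof (induction i)
    case (Suc i)
    have subD: "?D (Us ! Suc i) \<subseteq> supported ?X" using suppD[OF sub[OF Suc.prems]] .
    have IH: "card {i'. i' < i \<and> Q i'} \<le> fun_vs.dim (?D (Us ! i))" using Suc by simp
    show ?case
    proof (cases "Q i")
      case True
      then have "{i'. i' < Suc i \<and> Q i'} = insert i {i'. i' < i \<and> Q i'}" by (auto simp: less_Suc_eq)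
      then have "card {i'. i' < Suc i \<and> Q i'} = Suc (card {i'. i' < i \<and> Q i'})" by simp
      moreover have "fun_vs.dim (?D (Us ! i)) < fun_vs.dim (?D (Us ! Suc i))"
        by (rule dim_less[OF finX subD _ strict[OF Suc.prems True]]) (simp add: orbit_space_def)
      ultimately show ?thesis using IH by simp
    next
      case False
      then have "{i'. i' < Suc i \<and> Q i'} = {i'. i' < i \<and> Q i'}" by (auto simp: less_Suc_eq)
      moreover have "fun_vs.dim (?D (Us ! i)) \<le> fun_vs.dim (?D (Us ! Suc i))"
        by (rule dim_mono[OF finX subD orbit_space_mono])
          (use max[OF Suc.prems] in \<open>auto simp: maximal_submodule_def\<close>)
      ultimately show ?thesis using IH by simp
    qed
  qed simp
  from this[of "length Us - 1"] have "card {i'. i' < length Us - 1 \<and> Q i'} \<le> fun_vs.dim (?D (specht n \<alpha>))"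
    using ne last by (simp add: last_conv_nth)
  moreover have "decomposition_number TYPE('k) n \<alpha> \<beta> = card {i. Suc i < length Us \<and> Q i}"
    unfolding decomposition_number_def composition_mult_def Us_def[symmetric] Q_def carter_radical[OF \<beta> c]
    by (simp add: Let_def)
  moreover have "{i. Suc i < length Us \<and> Q i} = {i'. i' < length Us - 1 \<and> Q i'}" by auto
  ultimately show ?thesis by simp
qed

end

section \<open>Complex characters and Kronecker coefficients as dimensions\<close>

section \<open>Traces\<close>

interpretation fun_vs_pair: vector_space_pair
  "fscale :: 'k::field \<Rightarrow> ('t \<Rightarrow> 'k) \<Rightarrow> 't \<Rightarrow> 'k" "fscale :: 'k \<Rightarrow> ('t \<Rightarrow> 'k) \<Rightarrow> 't \<Rightarrow> 'k"
  by unfold_locales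

lemma linear_sum_fun:
  fixes h :: "('t \<Rightarrow> 'k::field) \<Rightarrow> 's \<Rightarrow> 'k"
  assumes add: "\<And>f g. h (f + g) = h f + h g" and scale: "\<And>c f. h (fscale c f) = fscale c (h f)"
  shows "h (\<Sum>i\<in>I. f i) = (\<Sum>i\<in>I. h (f i))"
proof -
  have "h 0 = 0" using scale[of 0 0] by (simp add: fscale_def zero_fun_def)
  then show ?thesis
    by (induction I rule: infinite_finite_induct)
      (simp_all only: add sum.infinite sum.empty sum.insert not_False_eq_True)
qed

text \<open>Since \<open>h\<close> extends \<open>f\<close> to all functions with values still in
  \<open>V\<close>, its trace can be read off the delta functions. This also frees traces from the
  basis chosen in \<open>trace_on\<close>.\<close>

lemma trace_on_eq:
  fixes V :: "('t \<Rightarrow> 'k::field) set"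
  assumes fin: "finite X" and V: "fun_vs.subspace V" "V \<subseteq> supported X"
    and add: "\<And>f g. h (f + g) = h f + h g" and scale: "\<And>c f. h (fscale c f) = fscale c (h f)"
    and range: "\<And>f. h f \<in> V" and agree: "\<And>v. v \<in> V \<Longrightarrow> f v = h v"
  shows "trace_on V f = (\<Sum>x\<in>X. h (delta x) x)"
proof -
  define B where "B = (SOME B. fun_vs.independent B \<and> fun_vs.span B = V)"
  have "\<exists>B. fun_vs.independent B \<and> fun_vs.span B = V"
  proof -
    obtain B where "B \<subseteq> V" "fun_vs.independent B" "V \<subseteq> fun_vs.span B" "card B = fun_vs.dim V"
      by (rule fun_vs.basis_exists)
    then show ?thesis using fun_vs.span_minimal[OF _ V(1)] by blast
  qed
  then have B: "fun_vs.independent B" "fun_vs.span B = V"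
    unfolding B_def by (metis (mono_tags, lifting) someI_ex)+
  have BV: "B \<subseteq> V" using B(2) fun_vs.span_superset by blast
  have finB: "finite B" using card_independent_le_dim(1)[OF fin V(2) BV B(1)] .
  let ?r = "\<lambda>v. fun_vs.representation B v"
  have r: "?r (h b) b = (\<Sum>x\<in>X. b x * ?r (h (delta x)) b)" if "b \<in> B" for b
  proof -
    have "b = (\<Sum>x\<in>X. fscale (b x) (delta x))"
      using supported_expand[OF fin] that BV V(2) by blast
    then have "h b = (\<Sum>x\<in>X. fscale (b x) (h (delta x)))"
      by (metis (mono_tags, lifting) linear_sum_fun[OF add scale] scale sum.cong)
    then have "?r (h b) = (\<lambda>v. \<Sum>x\<in>X. ?r (fscale (b x) (h (delta x))) v)"
      using fun_vs.representation_sum[OF B(1), of X "\<lambda>x. fscale (b x) (h (delta x))"] range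
        fun_vs.span_scale B(2) by metis
    then show ?thesis
      using fun_vs.representation_scale[OF B(1)] range B(2) by simp
  qed
  have "(\<Sum>x\<in>X. h (delta x) x) = (\<Sum>x\<in>X. \<Sum>b\<in>B. ?r (h (delta x)) b * b x)"
  proof (rule sum.cong)
    fix x
    have "(\<Sum>b\<in>B. fscale (?r (h (delta x)) b) b) = h (delta x)"
      using fun_vs.sum_representation_eq[OF B(1) _ finB order_refl] range B(2) by metis
    then have "h (delta x) x = (\<Sum>b\<in>B. fscale (?r (h (delta x)) b) b) x" by simp
    then show "h (delta x) x = (\<Sum>b\<in>B. ?r (h (delta x)) b * b x)"
      by (simp add: sum_fun_apply fscale_def)
  qed simp
  also have "\<dots> = (\<Sum>b\<in>B. ?r (h b) b)"
    by (subst sum.swap) (simp add: r mult.commute)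
  also have "\<dots> = (\<Sum>b\<in>B. ?r (f b) b)"
    by (rule sum.cong) (use agree BV in auto)
  finally show ?thesis
    unfolding trace_on_def B_def[symmetric] by (simp add: Let_def)
qed

lemma trace_on_id:
  fixes V :: "('t \<Rightarrow> 'k::field) set"
  assumes fin: "finite X" and V: "fun_vs.subspace V" "V \<subseteq> supported X"
  shows "trace_on V (\<lambda>v. v) = of_nat (fun_vs.dim V)"
proof -
  define B where "B = (SOME B. fun_vs.independent B \<and> fun_vs.span B = V)"
  have "\<exists>B. fun_vs.independent B \<and> fun_vs.span B = V"
  proof -
    obtain B where "B \<subseteq> V" "fun_vs.independent B" "V \<subseteq> fun_vs.span B" "card B = fun_vs.dim V"
      by (rule fun_vs.basis_exists)
    then show ?thesis using fun_vs.span_minimal[OF _ V(1)] by blast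
  qed
  then have B: "fun_vs.independent B" "fun_vs.span B = V"
    unfolding B_def by (metis (mono_tags, lifting) someI_ex)+
  have "trace_on V (\<lambda>v. v) = (\<Sum>b\<in>B. 1)"
    unfolding trace_on_def B_def[symmetric] Let_def
    by (rule sum.cong) (simp_all add: fun_vs.representation_basis[OF B(1)])
  moreover have "fun_vs.dim V = card B" using fun_vs.dim_eq_card_independent[OF B(1)] B(2) fun_vs.dim_span by metis
  ultimately show ?thesis by simp
qed

text \<open>A linear projection with no equivariance; it extends operators from \<open>V\<close> to
  all functions, as \<open>trace_on_eq\<close> requires.\<close>

lemma projection_exists:
  fixes V :: "('t \<Rightarrow> 'k::field) set"
  assumes "fun_vs.subspace V"
  obtains P where "\<And>f g. P (f + g) = P f + P g" "\<And>c f. P (fscale c f) = fscale c (P f)"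
    "\<And>f. P f \<in> V" "\<And>v. v \<in> V \<Longrightarrow> P v = v"
proof -
  have "Vector_Spaces.linear fscale fscale (id :: ('t \<Rightarrow> 'k) \<Rightarrow> 't \<Rightarrow> 'k)"
    by unfold_locales auto
  then obtain P where P: "P ` UNIV \<subseteq> V" "Vector_Spaces.linear fscale fscale P" "\<forall>v\<in>V. P (id v) = v"
    using fun_vs_pair.linear_exists_left_inverse_on[OF _ assms inj_on_id] by blast
  interpret P: Vector_Spaces.linear fscale fscale P by (rule P(2))
  show thesis
    by (rule that[of P]) (use P P.add P.scale in auto)
qed

lemma act_delta:
  assumes "p permutes {1..n}"
  shows "act p (delta T) = delta (tabloid_act p T)"
proof
  fix U
  have "tabloid_act (inv p) U = T \<longleftrightarrow> U = tabloid_act p T" using tabloid_act_inv[OF assms] by metis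
  then show "act p (delta T) U = delta (tabloid_act p T) U" by (simp add: act_def delta_def)
qed

lemma sum_perms_right:
  assumes q: "q permutes {1..n}"
  shows "(\<Sum>p\<in>perms n. f p) = (\<Sum>p\<in>perms n. f (p \<circ> q))"
proof (rule sum.reindex_bij_witness[of _ "\<lambda>p. p \<circ> q" "\<lambda>p. p \<circ> inv q"])
  fix p :: "nat \<Rightarrow> nat"
  show "(p \<circ> inv q) \<circ> q = p" "(p \<circ> q) \<circ> inv q = p"
    using permutes_inv_o[OF q] by (simp_all add: comp_assoc)
  show "p \<circ> inv q \<in> perms n" "p \<circ> q \<in> perms n" if "p \<in> perms n"
    using that q by (auto intro: permutes_compose permutes_inv)
  show "f ((p \<circ> inv q) \<circ> q) = f p"
    using permutes_inv_o[OF q] by (simp add: comp_assoc)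
qed

lemma orbit_sum_invariant:
  assumes q: "q permutes {1..n}"
  shows "orbit_sum n (act q v1) (act q v2) (act q v3) = orbit_sum n v1 v2 v3"
proof -
  have "(\<Sum>p\<in>perms n. act (p \<circ> q) v1 T1 * act (p \<circ> q) v2 T2 * act (p \<circ> q) v3 T3) =
      (\<Sum>p\<in>perms n. act p v1 T1 * act p v2 T2 * act p v3 T3)" for T1 T2 T3
    by (rule sum_perms_right[OF q, symmetric])
  then show ?thesis
    by (auto simp: orbit_sum_def fun_eq_iff act_comp[OF _ q] intro!: sum.cong)
qed

lemma sum_triple_product:
  fixes f g h :: "'i \<Rightarrow> 'x \<Rightarrow> 'k::comm_ring_1"
  shows "(\<Sum>x\<in>A. \<Sum>y\<in>B. \<Sum>z\<in>C. \<Sum>i\<in>I. f i x * g i y * h i z) =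
    (\<Sum>i\<in>I. (\<Sum>x\<in>A. f i x) * (\<Sum>y\<in>B. g i y) * (\<Sum>z\<in>C. h i z))"
proof -
  have "(\<Sum>x\<in>A. f i x) * (\<Sum>y\<in>B. g i y) * (\<Sum>z\<in>C. h i z) =
      (\<Sum>x\<in>A. \<Sum>y\<in>B. \<Sum>z\<in>C. f i x * g i y * h i z)" for i
    unfolding sum_product unfolding sum_distrib_right unfolding sum_distrib_left
    by (rule sum.cong[OF refl]) (rule sum.swap)
  then show ?thesis by (simp only: sum.swap[of _ _ I])
qed

text \<open>The orbit space is the image of the averaging idempotent on the triple tensor product, so its
  dimension is a trace.\<close>

lemma dim_orbit_space:
  fixes V1 V2 V3 :: "(tabloid \<Rightarrow> complex) set"
  assumes l: "l1 \<in> partitions n" "l2 \<in> partitions n" "l3 \<in> partitions n"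
    and V1: "submodule n V1" "V1 \<subseteq> supported (tabloids n l1)"
    and V2: "submodule n V2" "V2 \<subseteq> supported (tabloids n l2)"
    and V3: "submodule n V3" "V3 \<subseteq> supported (tabloids n l3)"
  shows "of_nat (fun_vs.dim (orbit_space n V1 V2 V3)) =
    (\<Sum>p\<in>perms n. trace_on V1 (act p) * trace_on V2 (act p) * trace_on V3 (act p)) / of_nat (fact n)"
proof -
  let ?X1 = "tabloids n l1" and ?X2 = "tabloids n l2" and ?X3 = "tabloids n l3"
  let ?X = "?X1 \<times> ?X2 \<times> ?X3" and ?D = "orbit_space n V1 V2 V3" and ?N = "of_nat (fact n) :: complex"
  have fin: "finite ?X1" "finite ?X2" "finite ?X3" using finite_tabloids l by auto
  obtain P1 where P1: "\<And>f g. P1 (f + g) = P1 f + P1 g" "\<And>c f. P1 (fscale c f) = fscale c (P1 f)"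
    "\<And>f. P1 f \<in> V1" "\<And>v. v \<in> V1 \<Longrightarrow> P1 v = v"
    using projection_exists[OF submoduleD(1)[OF V1(1)]] by blast
  obtain P2 where P2: "\<And>f g. P2 (f + g) = P2 f + P2 g" "\<And>c f. P2 (fscale c f) = fscale c (P2 f)"
    "\<And>f. P2 f \<in> V2" "\<And>v. v \<in> V2 \<Longrightarrow> P2 v = v"
    using projection_exists[OF submoduleD(1)[OF V2(1)]] by blast
  obtain P3 where P3: "\<And>f g. P3 (f + g) = P3 f + P3 g" "\<And>c f. P3 (fscale c f) = fscale c (P3 f)"
    "\<And>f. P3 f \<in> V3" "\<And>v. v \<in> V3 \<Longrightarrow> P3 v = v"
    using projection_exists[OF submoduleD(1)[OF V3(1)]] by blast
  have tr: "trace_on V (act p) = (\<Sum>x\<in>tabloids n l. act p (P (delta x)) x)"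
    if "finite (tabloids n l)" "submodule n V" "V \<subseteq> supported (tabloids n l)" "p permutes {1..n}"
      "\<And>f g. P (f + g) = P f + P g" "\<And>c f. P (fscale c f) = fscale c (P f)"
      "\<And>f. P f \<in> V" "\<And>v. v \<in> V \<Longrightarrow> P v = v"
    for V l p and P :: "(tabloid \<Rightarrow> complex) \<Rightarrow> tabloid \<Rightarrow> complex"
    by (rule trace_on_eq[OF that(1) submoduleD(1)[OF that(2)] that(3)])
      (simp_all only: that act_add act_scale submoduleD(2)[OF that(2,4)])
  define w where "w = (\<lambda>(x1, x2, x3). orbit_sum n (P1 (delta x1)) (P2 (delta x2)) (P3 (delta x3)))"
  \<comment> \<open>Delta functions are projected factor by factor into the three modules and then
    averaged over the group. On the orbit space this is the identity, because the norm of a norm is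
    the norm times the group order.\<close>
  define h where "h f = (\<Sum>x\<in>?X. fscale (f x / ?N) (w x))" for f :: "tabloid \<times> tabloid \<times> tabloid \<Rightarrow> complex"
  have h_add: "h (f + g) = h f + h g" and h_scale: "h (fscale c f) = fscale c (h f)" for f g c
    by (auto simp: h_def fun_eq_iff sum_fun_apply fscale_def sum.distrib sum_distrib_left
        add_divide_distrib algebra_simps)
  have subD: "fun_vs.subspace ?D" unfolding orbit_space_def by (rule fun_vs.subspace_span)
  have h_range: "h f \<in> ?D" for f
  proof -
    have "w x \<in> ?D" for x
      unfolding w_def using P1(3) P2(3) P3(3) by (auto intro: orbit_sum_in_orbit_space split: prod.splits)
    then show ?thesis
      unfolding h_def by (intro fun_vs.subspace_sum[OF subD] fun_vs.subspace_scale[OF subD])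
  qed
  have expand: "(\<Sum>x\<in>tabloids n l. v x * act q (P (delta x)) T) = act q v T"
    if "finite (tabloids n l)" "v \<in> V" "V \<subseteq> supported (tabloids n l)"
      "\<And>f g. P (f + g) = P f + P g" "\<And>c f. P (fscale c f) = fscale c (P f)" "\<And>v. v \<in> V \<Longrightarrow> P v = v"
    for V l q v T and P :: "(tabloid \<Rightarrow> complex) \<Rightarrow> tabloid \<Rightarrow> complex"
  proof -
    have "v = P (\<Sum>x\<in>tabloids n l. fscale (v x) (delta x))"
      using supported_expand[OF that(1)] that by (metis subsetD)
    also have "\<dots> = (\<Sum>x\<in>tabloids n l. fscale (v x) (P (delta x)))"
      by (simp only: linear_sum_fun[of P, OF that(4,5)] that(5))
    finally have "act q v T = act q (\<Sum>x\<in>tabloids n l. fscale (v x) (P (delta x))) T" by simp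
    then show ?thesis unfolding act_sum act_scale sum_fun_apply by (simp add: fscale_def)
  qed
  have h_gen: "h (orbit_sum n v1 v2 v3) = orbit_sum n v1 v2 v3"
    if v: "v1 \<in> V1" "v2 \<in> V2" "v3 \<in> V3" for v1 v2 v3
  proof -
    have "card (perms n) = fact n" by (rule card_permutations) simp_all
    then have card: "of_nat (card (perms n)) = ?N" by simp
    have "h (orbit_sum n v1 v2 v3) (T1, T2, T3) = orbit_sum n v1 v2 v3 (T1, T2, T3)" for T1 T2 T3
    proof -
      have "h (orbit_sum n v1 v2 v3) (T1, T2, T3) = (\<Sum>x\<in>?X. orbit_sum n v1 v2 v3 x * w x (T1, T2, T3)) / ?N"
        by (simp add: h_def sum_fun_apply fscale_def sum_divide_distrib)
      also have "(\<Sum>x\<in>?X. orbit_sum n v1 v2 v3 x * w x (T1, T2, T3)) =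
        (\<Sum>x1\<in>?X1. \<Sum>x2\<in>?X2. \<Sum>x3\<in>?X3. \<Sum>z\<in>perms n \<times> perms n.
          (act (fst z) v1 x1 * act (snd z) (P1 (delta x1)) T1) *
          (act (fst z) v2 x2 * act (snd z) (P2 (delta x2)) T2) *
          (act (fst z) v3 x3 * act (snd z) (P3 (delta x3)) T3))"
        by (simp add: sum.cartesian_product' orbit_sum_apply w_def sum_product mult_ac)
      also have "\<dots> = (\<Sum>p\<in>perms n. \<Sum>q\<in>perms n.
          (\<Sum>x1\<in>?X1. act p v1 x1 * act q (P1 (delta x1)) T1) *
          (\<Sum>x2\<in>?X2. act p v2 x2 * act q (P2 (delta x2)) T2) *
          (\<Sum>x3\<in>?X3. act p v3 x3 * act q (P3 (delta x3)) T3))"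
        unfolding sum_triple_product by (simp add: sum.cartesian_product')
      also have "\<dots> = (\<Sum>p\<in>perms n. orbit_sum n (act p v1) (act p v2) (act p v3) (T1, T2, T3))"
      proof (rule sum.cong)
        fix p assume "p \<in> perms n"
        then have p: "p permutes {1..n}" by simp
        show "(\<Sum>q\<in>perms n. (\<Sum>x1\<in>?X1. act p v1 x1 * act q (P1 (delta x1)) T1) *
          (\<Sum>x2\<in>?X2. act p v2 x2 * act q (P2 (delta x2)) T2) *
          (\<Sum>x3\<in>?X3. act p v3 x3 * act q (P3 (delta x3)) T3)) =
          orbit_sum n (act p v1) (act p v2) (act p v3) (T1, T2, T3)"
          unfolding orbit_sum_apply
          using expand[OF fin(1) submoduleD(2)[OF V1(1) p v(1)] V1(2) P1(1,2,4)]
            expand[OF fin(2) submoduleD(2)[OF V2(1) p v(2)] V2(2) P2(1,2,4)]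
            expand[OF fin(3) submoduleD(2)[OF V3(1) p v(3)] V3(2) P3(1,2,4)] by simp
      qed simp
      also have "\<dots> = (\<Sum>p\<in>perms n. orbit_sum n v1 v2 v3 (T1, T2, T3))"
        by (rule sum.cong) (simp_all add: orbit_sum_invariant)
      finally show ?thesis using card by simp
    qed
    then show ?thesis by auto
  qed
  have h_fix: "h v = v" if "v \<in> ?D" for v
    by (rule linear_fixes_span[OF h_add h_scale _ that[unfolded orbit_space_def]]) (use h_gen in auto)
  have finX: "finite ?X" using fin by simp
  have supD: "?D \<subseteq> supported ?X" by (rule orbit_space_supported[OF V1(2) V2(2) V3(2)])
  have "of_nat (fun_vs.dim ?D) = trace_on ?D (\<lambda>v. v)" by (rule trace_on_id[OF finX subD supD, symmetric])
  also have "\<dots> = (\<Sum>x\<in>?X. h (delta x) x)"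
    by (rule trace_on_eq[OF finX subD supD h_add h_scale h_range]) (simp add: h_fix)
  also have "\<dots> = (\<Sum>x\<in>?X. w x x / ?N)"
  proof (rule sum.cong)
    fix x assume x: "x \<in> ?X"
    have "h (delta x) x = (\<Sum>y\<in>?X. if y = x then w x x / ?N else 0)"
      unfolding h_def sum_fun_apply fscale_def delta_def by (rule sum.cong) auto
    then show "h (delta x) x = w x x / ?N" using x finX by simp
  qed simp
  also have "\<dots> = (\<Sum>x\<in>?X. w x x) / ?N" by (simp add: sum_divide_distrib)
  also have "(\<Sum>x\<in>?X. w x x) = (\<Sum>x1\<in>?X1. \<Sum>x2\<in>?X2. \<Sum>x3\<in>?X3. \<Sum>p\<in>perms n.
      act p (P1 (delta x1)) x1 * act p (P2 (delta x2)) x2 * act p (P3 (delta x3)) x3)"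
    by (simp add: sum.cartesian_product' orbit_sum_apply w_def)
  also have "\<dots> = (\<Sum>p\<in>perms n. trace_on V1 (act p) * trace_on V2 (act p) * trace_on V3 (act p))"
    unfolding sum_triple_product
    by (rule sum.cong) (simp_all add: tr[OF fin(1) V1 _ P1] tr[OF fin(2) V2 _ P2] tr[OF fin(3) V3 _ P3])
  finally show ?thesis .
qed

lemma trace_conj:
  fixes V :: "(tabloid \<Rightarrow> complex) set"
  assumes l: "l \<in> partitions n" and V: "submodule n V" "V \<subseteq> supported (tabloids n l)"
    and p: "p permutes {1..n}" and q: "q permutes {1..n}"
  shows "trace_on V (act (q \<circ> p \<circ> inv q)) = trace_on V (act p)"
proof -
  obtain P where P: "\<And>f g. P (f + g) = P f + P g" "\<And>c f. P (fscale c f) = fscale c (P f)"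
    "\<And>f. P f \<in> V" "\<And>v. v \<in> V \<Longrightarrow> P v = v"
    using projection_exists[OF submoduleD(1)[OF V(1)]] by blast
  note inv_q = permutes_inv[OF q]
  let ?X = "tabloids n l"
  have "trace_on V (act (q \<circ> p \<circ> inv q)) = (\<Sum>x\<in>?X. act q (act p (P (act (inv q) (delta x)))) x)"
  proof (rule trace_on_eq[OF finite_tabloids[OF l] submoduleD(1)[OF V(1)] V(2)])
    show "act q (act p (P (act (inv q) f))) \<in> V" for f
      by (intro submoduleD(2)[OF V(1)] p q P(3))
    show "act (q \<circ> p \<circ> inv q) v = act q (act p (P (act (inv q) v)))" if "v \<in> V" for v
      unfolding P(4)[OF submoduleD(2)[OF V(1) inv_q that]] act_comp[OF q p] act_comp[OF permutes_compose[OF p q] inv_q]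
      by (rule refl)
  qed (simp_all only: P act_add act_scale)
  also have "\<dots> = (\<Sum>x\<in>?X. act p (P (delta (tabloid_act (inv q) x))) (tabloid_act (inv q) x))"
    by (simp add: act_delta[OF inv_q] act_def[of q])
  also have "\<dots> = (\<Sum>x\<in>?X. act p (P (delta x)) x)"
    by (rule sum_tabloids_act[OF inv_q, symmetric])
  also have "\<dots> = trace_on V (act p)"
    by (rule trace_on_eq[OF finite_tabloids[OF l] submoduleD(1)[OF V(1)] V(2), symmetric])
      (simp_all only: P act_add act_scale submoduleD(2)[OF V(1) p])
  finally show ?thesis .
qed

section \<open>Orthogonality\<close>

text \<open>The shape of the trivial module. As a third factor it turns
  \<open>dim_orbit_space\<close> into a formula for the inner product of two characters.\<close>

definition one_row :: "nat \<Rightarrow> nat \<Rightarrow> nat" where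
  "one_row n i = (if i = 0 then n else 0)"

lemma one_row_partition: "one_row n \<in> partitions n"
  by (rule partitionsI[of _ 1]) (auto simp: one_row_def)

lemma tabloids_one_row: "tabloids n (one_row n) = {\<lambda>i. if i = 0 then {1..n} else {}}"
proof -
  have "T = (\<lambda>i. if i = 0 then {1..n} else {})" if T: "T \<in> tabloids n (one_row n)" for T
  proof
    fix i
    show "T i = (if i = 0 then {1..n} else {})"
      using card_subset_eq[OF _ tabloids_sub[OF T, of i]] tabloids_card[OF T, of i]
        tabloids_empty[OF T, of i] by (auto simp: one_row_def)
  qed
  moreover have "tabloids n (one_row n) \<noteq> {}"
    using tableau_exists[OF one_row_partition] tabloid_of_in_tabloids by blast
  ultimately show ?thesis by blast
qed

lemma act_one_row:
  assumes "f \<in> supported (tabloids n (one_row n))" and p: "p permutes {1..n}"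
  shows "act p f = f"
proof
  fix T
  show "act p f T = f T"
  proof (cases "T \<in> tabloids n (one_row n)")
    case True
    then have "tabloid_act (inv p) T = T"
      using tabloid_act_in_tabloids[OF permutes_inv[OF p], of T "one_row n"]
      unfolding tabloids_one_row by blast
    then show ?thesis by (simp add: act_def)
  next
    case False
    then show ?thesis using act_supported[OF assms] supportedD[OF assms(1)] by simp
  qed
qed

lemma irr_char_one_row:
  assumes p: "p permutes {1..n}"
  shows "irr_char n (one_row n) p = 1"
proof -
  obtain T0 where T0: "tabloids n (one_row n) = {T0}" using tabloids_one_row by blast
  obtain t where t: "tableau n (one_row n) t" using tableau_exists[OF one_row_partition] by blast
  let ?S = "specht n (one_row n) :: (tabloid \<Rightarrow> complex) set"
  have "tabloid_of (one_row n) t = T0" using tabloid_of_in_tabloids[OF t] T0 by simp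
  then have "polytabloid n (one_row n) t T0 = (1 :: complex)"
    using polytabloid_perm_value[OF t column_stabilizer_id, where ?'k = complex]
    by (simp add: tabloid_act_id)
  then have "polytabloid n (one_row n) t = (delta T0 :: tabloid \<Rightarrow> complex)"
  proof (intro ext)
    fix x
    assume one: "polytabloid n (one_row n) t T0 = (1 :: complex)"
    show "polytabloid n (one_row n) t x = (delta T0 x :: complex)"
      using one supportedD[OF polytabloid_supported[OF t, where ?'a = complex], of x] T0
      by (cases "x = T0") (simp_all add: delta_def)
  qed
  then have d: "delta T0 \<in> ?S" using polytabloid_in_specht[OF t, where ?'a = complex] by simp
  have "irr_char n (one_row n) p = (\<Sum>x\<in>{T0}. fscale (delta x T0) (delta T0) x)"
    unfolding irr_char_def
  proof (rule trace_on_eq)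
    show "?S \<subseteq> supported {T0}" using specht_supported[of n "one_row n"] T0 by metis
    show "fscale (f T0) (delta T0) \<in> ?S" for f
      by (rule fun_vs.subspace_scale[OF submoduleD(1)[OF submodule_specht] d])
    show "act p v = fscale (v T0) (delta T0)" if "v \<in> ?S" for v
    proof -
      have v: "v \<in> supported (tabloids n (one_row n))" using that specht_supported by blast
      then have "act p v = v" by (rule act_one_row[OF _ p])
      moreover have "v = fscale (v T0) (delta T0)"
      proof
        fix x
        show "v x = fscale (v T0) (delta T0) x"
          using supportedD[OF v, of x] T0 by (cases "x = T0") (simp_all add: fscale_def delta_def)
      qed
      ultimately show ?thesis by simp
    qed
  qed (auto simp: submoduleD(1)[OF submodule_specht] fscale_def fun_eq_iff algebra_simps)
  then show ?thesis by (simp add: fscale_def delta_def)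
qed

definition pair_sum :: "nat \<Rightarrow> (tabloid \<Rightarrow> 'k::field) \<Rightarrow> (tabloid \<Rightarrow> 'k) \<Rightarrow> tabloid \<Rightarrow> tabloid \<Rightarrow> 'k" where
  "pair_sum n u v T T' = (\<Sum>p\<in>perms n. act p u T * act p v T')"

lemma pair_sum_commute: "pair_sum n u v T T' = pair_sum n v u T' T"
  by (simp add: pair_sum_def mult.commute)

lemma pair_sum_invariant:
  assumes "q permutes {1..n}"
  shows "pair_sum n (act q u) (act q v) T T' = pair_sum n u v T T'"
  unfolding pair_sum_def
  by (subst (2) sum_perms_right[OF assms]) (auto simp: act_comp[OF _ assms] intro!: sum.cong)

lemma act_column_sum:
  "act p (column_sum n l t v) T = (\<Sum>q\<in>column_stabilizer n l t. of_int (sign q) * act p (act q v) T)"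
  unfolding column_sum_def act_sum act_scale sum_fun_apply by (simp add: fscale_def)

text \<open>The pairing is invariant under the group, and inversion permutes the column stabilizer
  and keeps signs. So the column sum can be moved to the other argument.\<close>

lemma pair_sum_column_sum:
  "pair_sum n u (column_sum n l t v) T T' = pair_sum n (column_sum n l t u) v T T'"
proof -
  let ?C = "column_stabilizer n l t"
  have "pair_sum n u (column_sum n l t v) T T' =
      (\<Sum>q\<in>?C. of_int (sign q) * pair_sum n u (act q v) T T')"
    unfolding pair_sum_def act_column_sum sum_distrib_left sum.swap[of _ _ "perms n"]
    by (simp add: mult_ac)
  also have "\<dots> = (\<Sum>q\<in>?C. of_int (sign q) * pair_sum n (act (inv q) u) v T T')"
  proof (rule sum.cong)
    fix q assume "q \<in> ?C"
    then have q: "q permutes {1..n}" by (rule column_stabilizer_permutes)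
    show "of_int (sign q) * pair_sum n u (act q v) T T' = of_int (sign q) * pair_sum n (act (inv q) u) v T T'"
      using pair_sum_invariant[OF q, of "act (inv q) u" v T T'] by (simp add: act_inv[OF q])
  qed simp
  also have "\<dots> = (\<Sum>q\<in>?C. of_int (sign q) * pair_sum n (act q u) v T T')"
  proof (rule sum.reindex_bij_witness[of _ inv inv])
    fix q assume q: "q \<in> ?C"
    then have qp: "q permutes {1..n}" by (rule column_stabilizer_permutes)
    show "inv (inv q) = q" using qp by (rule permutes_inv_inv)
    then show "inv (inv q) = q" .
    show "inv q \<in> ?C" using q by (rule column_stabilizer_inv)
    then show "inv q \<in> ?C" .
    show "of_int (sign (inv q)) * pair_sum n (act (inv q) u) v T T' =
      of_int (sign q) * pair_sum n (act (inv q) u) v T T'"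
      by (simp only: sign_inv[OF qp])
  qed
  also have "\<dots> = pair_sum n (column_sum n l t u) v T T'"
    unfolding pair_sum_def act_column_sum sum_distrib_left sum_distrib_right sum.swap[of _ _ "perms n"]
    by (simp add: mult_ac)
  finally show ?thesis .
qed

lemma pair_sum_zero_left: "pair_sum n 0 v T T' = 0"
  by (simp add: pair_sum_def act_def)

lemma pair_sum_polytabloid:
  "pair_sum n u (polytabloid n m t) T T' = pair_sum n (column_sum n m t u) (delta (tabloid_of m t)) T T'"
  unfolding polytabloid_column_sum by (rule pair_sum_column_sum)

lemma dominance_antisym:
  fixes l m :: "nat \<Rightarrow> nat"
  assumes "\<And>I. (\<Sum>i<I. l i) \<le> (\<Sum>i<I. m i)" "\<And>I. (\<Sum>i<I. m i) \<le> (\<Sum>i<I. l i)"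
  shows "l = m"
proof
  fix i
  have "(\<Sum>i<I. l i) = (\<Sum>i<I. m i)" for I using assms le_antisym by blast
  from this[of i] this[of "Suc i"] show "l i = m i" by simp
qed

text \<open>Moving the column sum of one polytabloid onto the other gives zero unless one shape
  dominates. Doing so on either side forces dominance in both directions, hence equal
  shapes.\<close>

lemma pair_sum_distinct:
  assumes l: "l \<in> partitions n" "m \<in> partitions n" "l \<noteq> m" and s: "tableau n l s" and t: "tableau n m t"
  shows "pair_sum n (polytabloid n l s) (polytabloid n m t) T T' = (0 :: 'k::field)"
proof (rule ccontr)
  assume nz: "pair_sum n (polytabloid n l s) (polytabloid n m t) T T' \<noteq> (0 :: 'k)"
  then have "column_sum n m t (polytabloid n l s) \<noteq> (0 :: tabloid \<Rightarrow> 'k)"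
    unfolding pair_sum_polytabloid using pair_sum_zero_left by metis
  then have "(\<Sum>i<I. l i) \<le> (\<Sum>i<I. m i)" for I
    by (rule column_sum_dominance[OF l(2,1) t polytabloid_supported[OF s]])
  moreover have "column_sum n l s (polytabloid n m t) \<noteq> (0 :: tabloid \<Rightarrow> 'k)"
    using nz[unfolded pair_sum_commute[of n "polytabloid n l s"], unfolded pair_sum_polytabloid]
      pair_sum_zero_left by metis
  then have "(\<Sum>i<I. m i) \<le> (\<Sum>i<I. l i)" for I
    by (rule column_sum_dominance[OF l(1,2) s polytabloid_supported[OF t]])
  ultimately have "l = m" by (intro dominance_antisym)
  then show False using l(3) by simp
qed

text \<open>The moved column sum is a multiple of a polytabloid, and by invariance the sum that
  remains does not depend on \<open>t\<close>. So all these functions are multiples of one, and the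
  orbit space in the orthogonality relation has dimension at most 1.\<close>

lemma pair_sum_same_shape:
  assumes l: "l \<in> partitions n" and s: "tableau n l s" and t: "tableau n l t" and t0: "tableau n l t0"
  shows "\<exists>c. \<forall>T T'. pair_sum n (polytabloid n l s) (polytabloid n l t) T T' =
    c * pair_sum n (polytabloid n l t0) (delta (tabloid_of l t0)) T (T' :: tabloid) * (1 :: 'k::field)"
proof -
  obtain c where c: "column_sum n l t (polytabloid n l s) = fscale c (polytabloid n l t :: tabloid \<Rightarrow> 'k)"
    using column_sum_form[OF l t polytabloid_supported[OF s]] by blast
  obtain p where p: "p permutes {1..n}" "\<And>i j. j < l i \<Longrightarrow> t (i, j) = p (t0 (i, j))"
    using tableau_transitive[OF t0 t] by blast
  have "polytabloid n l t = (act p (polytabloid n l t0) :: tabloid \<Rightarrow> 'k)"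
    unfolding act_polytabloid[OF p(1)] by (rule polytabloid_cong) (simp add: p(2))
  moreover have "tabloid_of l t = tabloid_act p (tabloid_of l t0)"
    unfolding tabloid_of_perm[symmetric] using p(2) by (auto simp: tabloid_of_alt fun_eq_iff)
  ultimately have "pair_sum n (polytabloid n l t) (delta (tabloid_of l t)) T T' =
      (pair_sum n (polytabloid n l t0) (delta (tabloid_of l t0)) T T' :: 'k)" for T T'
    using pair_sum_invariant[OF p(1)] by (simp add: act_delta[OF p(1), symmetric])
  moreover have "pair_sum n (fscale c u) v T T' = c * pair_sum n u v T T'" for u v :: "tabloid \<Rightarrow> 'k" and T T'
    by (simp add: pair_sum_def act_scale) (simp add: fscale_def sum_distrib_left mult_ac)
  ultimately show ?thesis unfolding pair_sum_polytabloid c by (intro exI[of _ c]) simp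
qed

text \<open>The value is a sum of squares of integers in which the term at the identity is
  1.\<close>

lemma pair_sum_self_nonzero:
  assumes t: "tableau n l t"
  shows "pair_sum n (polytabloid n l t) (polytabloid n l t) (tabloid_of l t) (tabloid_of l t) \<noteq> (0 :: complex)"
proof -
  let ?e = "polytabloid_int n l t" and ?T = "tabloid_of l t"
  have e1: "?e ?T = 1"
  proof -
    have "(of_int (?e ?T) :: complex) = 1"
      using polytabloid_perm_value[OF t column_stabilizer_id, where ?'k = complex]
      by (simp add: of_int_polytabloid_int tabloid_act_id)
    then show ?thesis by (metis of_int_1 of_int_eq_iff)
  qed
  have "pair_sum n (polytabloid n l t) (polytabloid n l t) ?T ?T =
      (of_int (\<Sum>p\<in>perms n. ?e (tabloid_act (inv p) ?T) * ?e (tabloid_act (inv p) ?T)) :: complex)"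
    by (simp add: pair_sum_def act_def of_int_polytabloid_int[symmetric])
  moreover have "1 \<le> (\<Sum>p\<in>perms n. ?e (tabloid_act (inv p) ?T) * ?e (tabloid_act (inv p) ?T))"
  proof -
    have "?e (tabloid_act (inv id) ?T) * ?e (tabloid_act (inv id) ?T) \<le>
        (\<Sum>p\<in>perms n. ?e (tabloid_act (inv p) ?T) * ?e (tabloid_act (inv p) ?T))"
    proof (rule member_le_sum)
      show "id \<in> perms n" by (rule CollectI, rule permutes_id)
    qed (simp_all only: finite_perms zero_le_square)
    then show ?thesis by (simp add: tabloid_act_id e1)
  qed
  ultimately show ?thesis by (simp only: of_int_eq_0_iff)
qed

lemma orbit_sum_one_row:
  assumes "f \<in> supported (tabloids n (one_row n))"
  shows "orbit_sum n u v f (T1, T2, T3) = pair_sum n u v T1 T2 * f T3"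
  unfolding orbit_sum_apply pair_sum_def sum_distrib_right
  by (rule sum.cong) (simp_all add: act_one_row[OF assms])

text \<open>The inner product is the dimension of an orbit space with the trivial module as third
  factor, which is at most a line. There is no inverse or conjugate in the formula, since it counts
  invariants of a tensor product.\<close>

lemma irr_char_orthogonal:
  assumes l: "l \<in> partitions n" and m: "m \<in> partitions n"
  shows "(\<Sum>p\<in>perms n. irr_char n l p * irr_char n m p) / of_nat (fact n) = of_bool (l = m)"
proof -
  let ?o = "one_row n"
  let ?D = "orbit_space n (specht n l) (specht n m) (specht n ?o) :: (_ \<Rightarrow> complex) set"
  let ?G = "{orbit_sum n v1 v2 v3 | v1 v2 v3. v1 \<in> {polytabloid n l t | t. tableau n l t} \<and>
      v2 \<in> {polytabloid n m t | t. tableau n m t} \<and> v3 \<in> {polytabloid n ?o t | t. tableau n ?o t}}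
      :: (_ \<Rightarrow> complex) set"
  have D: "?D = fun_vs.span ?G" unfolding specht_def by (rule orbit_space_span)
  have sup: "polytabloid n ?o t \<in> (supported (tabloids n ?o) :: (tabloid \<Rightarrow> complex) set)" if "tableau n ?o t" for t
    using that by (rule polytabloid_supported)
  have "fun_vs.dim ?D = of_bool (l = m)"
  proof (cases "l = m")
    case False
    have "?G \<subseteq> {0}"
    proof clarify
      fix t1 t2 t3 assume t: "tableau n l t1" "tableau n m t2" "tableau n ?o t3"
      show "orbit_sum n (polytabloid n l t1) (polytabloid n m t2) (polytabloid n ?o t3) = (0 :: _ \<Rightarrow> complex)"
        using orbit_sum_one_row[OF sup[OF t(3)]] pair_sum_distinct[OF l m False t(1,2)] by (auto simp: fun_eq_iff)
    qed
    then have "?D \<subseteq> fun_vs.span {}" unfolding D using fun_vs.span_mono[of ?G "{0}"] by simp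
    then have "fun_vs.dim ?D \<le> card ({} :: (tabloid \<times> tabloid \<times> tabloid \<Rightarrow> complex) set)"
      by (rule fun_vs.dim_le_card) simp
    then show ?thesis using False by simp
  next
    case True
    obtain t0 where t0: "tableau n l t0" using tableau_exists[OF l] by blast
    obtain t1 where t1: "tableau n ?o t1" using tableau_exists[OF one_row_partition] by blast
    let ?e = "polytabloid n ?o t1 :: tabloid \<Rightarrow> complex"
    have one: "polytabloid n ?o t = ?e" if t: "tableau n ?o t" for t
    proof -
      obtain p where "p permutes {1..n}" "(polytabloid n ?o t :: tabloid \<Rightarrow> complex) = act p ?e"
        using polytabloid_transitive[OF t1 t] by blast
      then show ?thesis using act_one_row[OF sup[OF t1]] by simp
    qed
    define w where "w = orbit_sum n (polytabloid n l t0) (delta (tabloid_of l t0)) ?e"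
    have "?G \<subseteq> fun_vs.span {w}"
    proof clarify
      fix s t t3 assume st: "tableau n l s" "tableau n m t" "tableau n ?o t3"
      obtain c where "\<And>T T'. pair_sum n (polytabloid n l s) (polytabloid n l t) T T' =
          c * pair_sum n (polytabloid n l t0) (delta (tabloid_of l t0)) T T' * (1 :: complex)"
        using pair_sum_same_shape[OF l st(1) _ t0] st(2) True by blast
      then have "orbit_sum n (polytabloid n l s) (polytabloid n m t) (polytabloid n ?o t3) = fscale c w"
      proof (intro ext)
        fix x :: "tabloid \<times> tabloid \<times> tabloid"
        assume c: "\<And>T T'. pair_sum n (polytabloid n l s) (polytabloid n l t) T T' =
          c * pair_sum n (polytabloid n l t0) (delta (tabloid_of l t0)) T T' * (1 :: complex)"
        obtain T1 T2 T3 where x: "x = (T1, T2, T3)" by (cases x)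
        show "orbit_sum n (polytabloid n l s) (polytabloid n m t) (polytabloid n ?o t3) x = fscale c w x"
          unfolding one[OF st(3)] True[symmetric] x w_def fscale_def orbit_sum_one_row[OF sup[OF t1]] c
          by simp
      qed
      then show "orbit_sum n (polytabloid n l s) (polytabloid n m t) (polytabloid n ?o t3) \<in> fun_vs.span {w}"
        by (simp add: fun_vs.span_scale fun_vs.span_base)
    qed
    then have "?D \<subseteq> fun_vs.span {w}" unfolding D by (rule fun_vs.span_minimal) (rule fun_vs.subspace_span)
    then have "fun_vs.dim ?D \<le> card {w}" by (rule fun_vs.dim_le_card) simp
    moreover have "0 < fun_vs.dim ?D"
    proof (rule dim_positive)
      show "?D \<subseteq> supported (tabloids n l \<times> tabloids n m \<times> tabloids n ?o)"
        by (rule orbit_space_supported) (rule specht_supported)+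
      show "finite (tabloids n l \<times> tabloids n m \<times> tabloids n ?o)"
        using finite_tabloids l m one_row_partition by blast
      let ?x = "orbit_sum n (polytabloid n l t0) (polytabloid n m t0) ?e"
      show "?x \<in> ?D"
        using t0 t1 True by (intro orbit_sum_in_orbit_space polytabloid_in_specht) auto
      have "?e (tabloid_of ?o t1) = 1"
        using polytabloid_perm_value[OF t1 column_stabilizer_id, where ?'k = complex]
        by (simp add: tabloid_act_id)
      then have "?x (tabloid_of l t0, tabloid_of l t0, tabloid_of ?o t1) \<noteq> 0"
        using orbit_sum_one_row[OF sup[OF t1]] pair_sum_self_nonzero[OF t0] True by simp
      then show "?x \<noteq> 0" by auto
    qed
    ultimately show ?thesis using True by simp
  qed
  then have "of_bool (l = m) = (of_nat (fun_vs.dim ?D) :: complex)" by simp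
  also have "\<dots> = (\<Sum>p\<in>perms n. irr_char n l p * irr_char n m p * irr_char n ?o p) / of_nat (fact n)"
    unfolding irr_char_def
    by (rule dim_orbit_space[OF l m one_row_partition submodule_specht specht_supported submodule_specht
          specht_supported submodule_specht specht_supported])
  also have "(\<Sum>p\<in>perms n. irr_char n l p * irr_char n m p * irr_char n ?o p) =
      (\<Sum>p\<in>perms n. irr_char n l p * irr_char n m p)"
    by (rule sum.cong) (simp_all add: irr_char_one_row)
  finally show ?thesis by simp
qed

section \<open>Cycle types\<close>

text \<open>Cycles become rows. Splitting off a longest cycle first makes the row lengths decrease,
  so that they form a partition.\<close>

lemma cycle_tableau:
  assumes p: "permutation p" and fin: "finite A" and A: "bij_betw p A A"
  shows "\<exists>l\<in>partitions (card A). \<exists>t. bij_betw t (diagram l) A \<and>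
    (\<forall>i j. j < l i \<longrightarrow> p (t (i, j)) = t (i, Suc j mod l i))"
  using fin A
proof (induction "card A" arbitrary: A rule: less_induct)
  case less
  show ?case
  proof (cases "A = {}")
    case True
    have "(\<lambda>_. 0) \<in> partitions (card A)" using True by (intro partitionsI[of _ 0]) auto
    then show ?thesis using True by (intro bexI[of _ "\<lambda>_. 0"]) (auto simp: diagram_def bij_betw_def)
  next
    case False
    let ?lp = "least_power p"
    have "Max (?lp ` A) \<in> ?lp ` A" using less.prems(1) False by (intro Max_in) auto
    then obtain x where x: "x \<in> A" "?lp x = Max (?lp ` A)" by (metis imageE)
    have max: "?lp y \<le> ?lp x" if "y \<in> A" for y using x(2) that less.prems(1) by simp
    define c where "c = ?lp x"
    have c: "(p ^^ c) x = x" "c > 0" using least_power_of_permutation[OF p] by (auto simp: c_def)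
    define C where "C = (\<lambda>j. (p ^^ j) x) ` {..<c}"
    have inj: "inj_on (\<lambda>j. (p ^^ j) x) {..<c}"
      using cycle_of_permutation[OF p, of x] by (simp add: distinct_map c_def atLeast0LessThan)
    have pA: "p y \<in> A" if "y \<in> A" for y using that less.prems(2) by (auto simp: bij_betw_def)
    have powA: "(p ^^ j) x \<in> A" for j by (induction j) (use x pA in auto)
    have CA: "C \<subseteq> A" using powA by (auto simp: C_def)
    have step: "p ((p ^^ j) x) = (p ^^ (Suc j mod c)) x" if "j < c" for j
    proof (cases "Suc j = c")
      case True
      then show ?thesis using c(1) by auto
    next
      case False
      then show ?thesis using that by simp
    qed
    have pC: "bij_betw p C C"
    proof -
      have "p ` C \<subseteq> C" using step c(2) by (auto simp: C_def)
      moreover have "inj_on p C" using less.prems(2) CA by (auto simp: bij_betw_def intro: inj_on_subset)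
      moreover have "finite C" by (simp add: C_def)
      ultimately have "p ` C = C" by (intro endo_inj_surj)
      then show ?thesis using \<open>inj_on p C\<close> by (simp add: bij_betw_def)
    qed
    have "C \<noteq> {}" using c(2) by (auto simp: C_def)
    then have small: "card (A - C) < card A"
      using CA less.prems(1) by (intro psubset_card_mono) auto
    have "bij_betw p (A - C) (A - C)" using less.prems(2) pC CA by (intro bij_betw_DiffI)
    then obtain l' t' where l': "l' \<in> partitions (card (A - C))" and t': "bij_betw t' (diagram l') (A - C)"
      and cyc: "\<And>i j. j < l' i \<Longrightarrow> p (t' (i, j)) = t' (i, Suc j mod l' i)"
      using less.hyps[OF small] less.prems(1) by blast
    have le: "l' 0 \<le> c"
    proof (cases "l' 0 = 0")
      case False
      let ?y = "t' (0, 0)"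
      have y: "?y \<in> A" using t' False by (force simp: bij_betw_def diagram_def)
      have pow: "(p ^^ j) ?y = t' (0, j mod l' 0)" for j
        by (induction j) (use False cyc in \<open>auto simp: mod_Suc_eq\<close>)
      have "t' (0, ?lp ?y mod l' 0) = t' (0, 0)"
        using least_power_of_permutation(1)[OF p, of ?y] pow[of "?lp ?y"] by simp
      then have "?lp ?y mod l' 0 = 0"
        using t' False unfolding bij_betw_def
        by (auto simp: diagram_def dest!: inj_onD)
      then have "l' 0 \<le> ?lp ?y"
        using least_power_of_permutation(2)[OF p, of ?y] by (auto intro!: dvd_imp_le)
      then show ?thesis using max[OF y] by (simp add: c_def)
    qed simp
    define l where "l i = (case i of 0 \<Rightarrow> c | Suc i \<Rightarrow> l' i)" for i
    define t where "t = (\<lambda>(i, j). case i of 0 \<Rightarrow> (p ^^ j) x | Suc i \<Rightarrow> t' (i, j))"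
    have cardC: "card C = c" unfolding C_def using card_image[OF inj] by simp
    have "l \<in> partitions (card A)"
    proof (rule partitionsI[of _ "Suc (card (A - C))"])
      show "l (Suc i) \<le> l i" for i
        using le part_antimono[OF l', of "i - 1" i] by (cases i) (auto simp: l_def)
      show "l i = 0" if "Suc (card (A - C)) \<le> i" for i
        using part_zero[OF l', of "i - 1"] that by (cases i) (auto simp: l_def)
      have "(\<Sum>i<Suc (card (A - C)). l i) = c + (\<Sum>i<card (A - C). l' i)"
        unfolding sum.lessThan_Suc_shift by (simp add: l_def)
      also have "\<dots> = card C + card (A - C)" using part_sum[OF l' order_refl] cardC by simp
      also have "\<dots> = card A"
        using card_Diff_subset[OF finite_subset[OF CA less.prems(1)] CA] card_mono[OF less.prems(1) CA] by simp
      finally show "(\<Sum>i<Suc (card (A - C)). l i) = card A" .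
    qed
    moreover have "bij_betw t (diagram l) A"
    proof -
      have d: "diagram l = ({0} \<times> {..<c}) \<union> (\<lambda>(i, j). (Suc i, j)) ` diagram l'"
        by (auto simp: diagram_def l_def image_iff split: nat.splits)
      have "bij_betw t ({0} \<times> {..<c}) C"
        unfolding bij_betw_def
      proof
        show "inj_on t ({0} \<times> {..<c})" using inj by (auto simp: inj_on_def t_def)
        show "t ` ({0} \<times> {..<c}) = C" by (force simp: t_def C_def)
      qed
      moreover have "bij_betw t ((\<lambda>(i, j). (Suc i, j)) ` diagram l') (A - C)"
      proof -
        have "t \<circ> (\<lambda>(i, j). (Suc i, j)) = t'" by (auto simp: t_def fun_eq_iff)
        moreover have "inj_on (\<lambda>(i, j). (Suc i, j)) (diagram l')" by (auto simp: inj_on_def)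
        ultimately show ?thesis using t' by (metis bij_betw_def bij_betw_comp_iff)
      qed
      ultimately have "bij_betw t (diagram l) (C \<union> (A - C))"
        unfolding d by (rule bij_betw_combine) auto
      moreover have "C \<union> (A - C) = A" using CA by auto
      ultimately show ?thesis by simp
    qed
    moreover have "p (t (i, j)) = t (i, Suc j mod l i)" if "j < l i" for i j
      using that step cyc by (cases i) (auto simp: l_def t_def)
    ultimately show ?thesis by blast
  qed
qed

definition has_cycle_type :: "nat \<Rightarrow> (nat \<Rightarrow> nat) \<Rightarrow> (nat \<Rightarrow> nat) \<Rightarrow> bool" where
  "has_cycle_type n p l \<longleftrightarrow> (\<exists>t. tableau n l t \<and> (\<forall>i j. j < l i \<longrightarrow> p (t (i, j)) = t (i, Suc j mod l i)))"

lemma has_cycle_type_exists: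
  assumes "p permutes {1..n}"
  shows "\<exists>l\<in>partitions n. has_cycle_type n p l"
  using cycle_tableau[of p "{1..n}"] assms permutes_imp_bij[OF assms]
  by (auto simp: has_cycle_type_def tableau_def permutation_permutes)

text \<open>The permutation that carries one tableau of cycles to the other conjugates
  \<open>p\<close> to \<open>q\<close>.\<close>

lemma same_cycle_type_conj:
  assumes p: "p permutes {1..n}" "has_cycle_type n p l" and q: "q permutes {1..n}" "has_cycle_type n q l"
  shows "\<exists>g. g permutes {1..n} \<and> q = g \<circ> p \<circ> inv g"
proof -
  obtain t where t: "tableau n l t" "\<And>i j. j < l i \<Longrightarrow> p (t (i, j)) = t (i, Suc j mod l i)"
    using p(2) by (auto simp: has_cycle_type_def)
  obtain s where s: "tableau n l s" "\<And>i j. j < l i \<Longrightarrow> q (s (i, j)) = s (i, Suc j mod l i)"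
    using q(2) by (auto simp: has_cycle_type_def)
  obtain g where g: "g permutes {1..n}" "\<And>i j. j < l i \<Longrightarrow> s (i, j) = g (t (i, j))"
    using tableau_transitive[OF t(1) s(1)] by blast
  have "q x = (g \<circ> p \<circ> inv g) x" for x
  proof (cases "x \<in> {1..n}")
    case True
    then obtain i j where ij: "j < l i" "x = s (i, j)" using tableau_cover[OF s(1)] by blast
    have "Suc j mod l i < l i" using ij(1) by simp
    then have "q x = g (t (i, Suc j mod l i))" using s(2)[OF ij(1)] g(2) ij(2) by simp
    also have "\<dots> = g (p (inv g x))"
      using t(2)[OF ij(1)] g(2)[OF ij(1)] ij(2) permutes_inverses(2)[OF g(1)] by simp
    finally show ?thesis by simp
  next
    case False
    then have "inv g x = x" using permutes_inv[OF g(1)] permutes_not_in by metis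
    then show ?thesis using False p(1) q(1) g(1) by (simp add: permutes_not_in)
  qed
  then show ?thesis using g(1) by blast
qed

section \<open>Completeness\<close>

definition class_function :: "nat \<Rightarrow> ((nat \<Rightarrow> nat) \<Rightarrow> complex) \<Rightarrow> bool" where
  "class_function n f \<longleftrightarrow> (\<forall>p q. p permutes {1..n} \<longrightarrow> q permutes {1..n} \<longrightarrow> f (q \<circ> p \<circ> inv q) = f p)"

lemma class_function_irr_char: "l \<in> partitions n \<Longrightarrow> class_function n (irr_char n l)"
  unfolding class_function_def irr_char_def
  using trace_conj[OF _ submodule_specht specht_supported] by blast

definition restrict_perms :: "nat \<Rightarrow> ((nat \<Rightarrow> nat) \<Rightarrow> complex) \<Rightarrow> (nat \<Rightarrow> nat) \<Rightarrow> complex" where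
  "restrict_perms n f = (\<lambda>p. if p \<in> perms n then f p else 0)"

text \<open>There are at most as many conjugacy classes as partitions, so the orthonormal irreducible
  characters span the class functions.\<close>

lemma class_function_expansion:
  assumes f: "class_function n f" and p: "p permutes {1..n}"
  shows "f p = (\<Sum>l\<in>partitions n. (\<Sum>q\<in>perms n. f q * irr_char n l q) / of_nat (fact n) * irr_char n l p)"
proof -
  let ?P = "partitions n" and ?N = "of_nat (fact n) :: complex"
  let ?chi = "\<lambda>l. restrict_perms n (irr_char n l)"
  define ct where "ct p = (SOME l. l \<in> ?P \<and> has_cycle_type n p l)" for p
  have ct: "ct p \<in> ?P" "has_cycle_type n p (ct p)" if "p permutes {1..n}" for p
    using someI_ex[of "\<lambda>l. l \<in> ?P \<and> has_cycle_type n p l"] has_cycle_type_exists[OF that]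
    unfolding ct_def by blast+
  \<comment> \<open>Permutations with equal \<open>ct\<close> are conjugate, so a class function is
    constant on the fibres of \<open>ct\<close> and lies in the span of these at most
    \<open>card ?P\<close> functions.\<close>
  define ind where "ind l = (\<lambda>p. if p \<in> perms n \<and> ct p = l then 1 else (0 :: complex))" for l
  have in_span: "restrict_perms n f \<in> fun_vs.span (ind ` ?P)" if f: "class_function n f" for f
  proof -
    define v where "v l = f (SOME p. p permutes {1..n} \<and> ct p = l)" for l
    have v: "v (ct p) = f p" if p: "p permutes {1..n}" for p
    proof -
      define q where "q = (SOME q. q permutes {1..n} \<and> ct q = ct p)"
      have q: "q permutes {1..n}" "ct q = ct p"
        using someI_ex[of "\<lambda>q. q permutes {1..n} \<and> ct q = ct p"] p unfolding q_def by blast+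
      then obtain g where "g permutes {1..n}" "q = g \<circ> p \<circ> inv g"
        using same_cycle_type_conj[OF p ct(2)[OF p] q(1)] ct(2)[OF q(1)] by auto
      then have "f q = f p" using f p by (simp add: class_function_def)
      then show ?thesis by (simp add: v_def q_def)
    qed
    have "restrict_perms n f = (\<Sum>l\<in>?P. fscale (v l) (ind l))"
    proof
      fix p
      show "restrict_perms n f p = (\<Sum>l\<in>?P. fscale (v l) (ind l)) p"
      proof (cases "p \<in> perms n")
        case True
        then have pp: "p permutes {1..n}" by simp
        have "(\<Sum>l\<in>?P. fscale (v l) (ind l)) p = (\<Sum>l\<in>?P. if l = ct p then v (ct p) else 0)"
          unfolding sum_fun_apply fscale_def ind_def by (rule sum.cong) (use True in auto)
        then show ?thesis
          using ct(1)[OF pp] v[OF pp] finite_partitions True by (simp add: restrict_perms_def)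
      next
        case False
        then show ?thesis by (simp add: restrict_perms_def sum_fun_apply fscale_def ind_def)
      qed
    qed
    then show ?thesis
      by (simp only:) (intro fun_vs.span_sum fun_vs.span_scale fun_vs.span_base imageI)
  qed
  have inner: "(\<Sum>q\<in>perms n. (\<Sum>l\<in>?P. fscale (a l) (?chi l)) q * irr_char n m q) / ?N = a m"
    if m: "m \<in> ?P" for a m
  proof -
    have "(\<Sum>q\<in>perms n. (\<Sum>l\<in>?P. fscale (a l) (?chi l)) q * irr_char n m q) =
        (\<Sum>q\<in>perms n. \<Sum>l\<in>?P. a l * (irr_char n l q * irr_char n m q))"
      by (rule sum.cong) (simp_all add: sum_fun_apply fscale_def restrict_perms_def sum_distrib_right mult.assoc)
    also have "\<dots> = (\<Sum>l\<in>?P. a l * (\<Sum>q\<in>perms n. irr_char n l q * irr_char n m q))"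
      by (subst sum.swap) (simp add: sum_distrib_left)
    finally have "(\<Sum>q\<in>perms n. (\<Sum>l\<in>?P. fscale (a l) (?chi l)) q * irr_char n m q) / ?N =
        (\<Sum>l\<in>?P. a l * ((\<Sum>q\<in>perms n. irr_char n l q * irr_char n m q) / ?N))"
      by (simp only:, subst sum_divide_distrib, simp)
    also have "\<dots> = (\<Sum>l\<in>?P. if l = m then a l else 0)"
      by (rule sum.cong) (simp_all only: irr_char_orthogonal[OF _ m], simp)
    finally show ?thesis using m finite_partitions by simp
  qed
  have inj: "inj_on ?chi ?P"
  proof (rule inj_onI)
    fix l m assume lm: "l \<in> ?P" "m \<in> ?P" "?chi l = ?chi m"
    have "irr_char n l q = irr_char n m q" if "q \<in> perms n" for q
      using fun_cong[OF lm(3), of q] that by (simp add: restrict_perms_def)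
    then have "(\<Sum>q\<in>perms n. irr_char n l q * irr_char n m q) = (\<Sum>q\<in>perms n. irr_char n m q * irr_char n m q)"
      by simp
    then show "l = m"
      using irr_char_orthogonal[OF lm(1,2)] irr_char_orthogonal[OF lm(2,2)] by (simp split: if_splits)
  qed
  have ind_chi: "fun_vs.independent (?chi ` ?P)"
  proof (rule fun_vs.independent_if_scalars_zero)
    show "finite (?chi ` ?P)" using finite_partitions by simp
    fix u v assume sum0: "(\<Sum>v\<in>?chi ` ?P. fscale (u v) v) = 0" and v: "v \<in> ?chi ` ?P"
    obtain m where m: "m \<in> ?P" "v = ?chi m" using v by blast
    have "(\<Sum>l\<in>?P. fscale (u (?chi l)) (?chi l)) = 0" using sum0 by (simp add: sum.reindex[OF inj])
    then show "u v = 0" using inner[OF m(1), of "\<lambda>l. u (?chi l)"] m(2) by simp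
  qed
  have "restrict_perms n f \<in> fun_vs.span (?chi ` ?P)"
  proof (rule ccontr)
    \<comment> \<open>Then \<open>f\<close> and the characters would be \<open>Suc (card ?P)\<close>
      independent vectors in the span of at most \<open>card ?P\<close> functions.\<close>
    assume notin: "restrict_perms n f \<notin> fun_vs.span (?chi ` ?P)"
    then have "fun_vs.independent (insert (restrict_perms n f) (?chi ` ?P))"
      using ind_chi by (rule fun_vs.independent_insertI)
    moreover have "insert (restrict_perms n f) (?chi ` ?P) \<subseteq> fun_vs.span (ind ` ?P)"
      using in_span f class_function_irr_char by blast
    ultimately have "card (insert (restrict_perms n f) (?chi ` ?P)) \<le> card (ind ` ?P)"
      using fun_vs.independent_span_bound[OF finite_imageI[OF finite_partitions]] by blast
    moreover have "restrict_perms n f \<notin> ?chi ` ?P" using notin fun_vs.span_base[of _ "?chi ` ?P"] by metis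
    then have "card (insert (restrict_perms n f) (?chi ` ?P)) = Suc (card ?P)"
      using card_image[OF inj] finite_partitions by simp
    moreover have "card (ind ` ?P) \<le> card ?P" using finite_partitions by (rule card_image_le)
    ultimately show False by simp
  qed
  then obtain u where "restrict_perms n f = (\<Sum>v\<in>?chi ` ?P. fscale (u v) v)"
    using fun_vs.span_finite[of "?chi ` ?P"] finite_partitions by auto
  then have exp: "restrict_perms n f = (\<Sum>l\<in>?P. fscale (u (?chi l)) (?chi l))"
    by (simp add: sum.reindex[OF inj])
  have u: "u (?chi m) = (\<Sum>q\<in>perms n. f q * irr_char n m q) / ?N" if m: "m \<in> ?P" for m
  proof -
    have "(\<Sum>q\<in>perms n. f q * irr_char n m q) = (\<Sum>q\<in>perms n. restrict_perms n f q * irr_char n m q)"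
      by (rule sum.cong) (simp_all add: restrict_perms_def)
    then show ?thesis using inner[OF m, of "\<lambda>l. u (?chi l)"] exp by simp
  qed
  have "f p = restrict_perms n f p" using p by (simp add: restrict_perms_def)
  also have "\<dots> = (\<Sum>l\<in>?P. u (?chi l) * irr_char n l p)"
    unfolding exp using p by (simp add: sum_fun_apply fscale_def restrict_perms_def)
  also have "\<dots> = (\<Sum>l\<in>?P. (\<Sum>q\<in>perms n. f q * irr_char n l q) / ?N * irr_char n l p)"
    by (rule sum.cong) (simp_all add: u)
  finally show ?thesis .
qed

text \<open>The dimensions are the inner products of the product character with the irreducible
  characters, hence its coefficients. Orthogonality excludes any other coefficients, which settles
  the definite description in \<open>char_mult\<close>.\<close>

lemma kronecker_eq_dim:
  assumes l: "l \<in> partitions n" and m: "m \<in> partitions n" and v: "v \<in> partitions n"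
  shows "kronecker n l m v =
    fun_vs.dim (orbit_space n (specht n l) (specht n m) (specht n v) :: (_ \<Rightarrow> complex) set)"
proof -
  let ?d = "\<lambda>v. fun_vs.dim (orbit_space n (specht n l) (specht n m) (specht n v) :: (_ \<Rightarrow> complex) set)"
  let ?psi = "\<lambda>p. irr_char n l p * irr_char n m p"
  have d: "(of_nat (?d v) :: complex) = (\<Sum>p\<in>perms n. ?psi p * irr_char n v p) / of_nat (fact n)"
    if "v \<in> partitions n" for v
    unfolding irr_char_def
    by (rule dim_orbit_space[OF l m that submodule_specht specht_supported submodule_specht
          specht_supported submodule_specht specht_supported])
  define c where "c v = (if v \<in> partitions n then ?d v else 0)" for v
  have "class_function n ?psi"
    using class_function_irr_char[OF l] class_function_irr_char[OF m] by (simp add: class_function_def)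
  then have c1: "?psi p = (\<Sum>v\<in>partitions n. of_nat (c v) * irr_char n v p)" if "p permutes {1..n}" for p
    unfolding class_function_expansion[OF \<open>class_function n ?psi\<close> that]
    by (intro sum.cong refl) (simp add: c_def d)
  have "char_mult n ?psi = c"
    unfolding char_mult_def
  proof (rule the_equality)
    show "(\<forall>v. v \<notin> partitions n \<longrightarrow> c v = 0) \<and> (\<forall>p. p permutes {1..n} \<longrightarrow>
        ?psi p = (\<Sum>v\<in>partitions n. of_nat (c v) * irr_char n v p))"
      using c1 by (simp add: c_def)
    fix c' assume c': "(\<forall>v. v \<notin> partitions n \<longrightarrow> c' v = 0) \<and> (\<forall>p. p permutes {1..n} \<longrightarrow>
        ?psi p = (\<Sum>v\<in>partitions n. of_nat (c' v) * irr_char n v p))"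
    show "c' = c"
    proof
      fix v
      show "c' v = c v"
      proof (cases "v \<in> partitions n")
        case True
        have "(\<Sum>p\<in>perms n. ?psi p * irr_char n v p) =
            (\<Sum>p\<in>perms n. \<Sum>w\<in>partitions n. of_nat (c' w) * (irr_char n w p * irr_char n v p))"
          by (rule sum.cong) (use c' in \<open>simp_all add: sum_distrib_right mult.assoc\<close>)
        also have "\<dots> = (\<Sum>w\<in>partitions n. of_nat (c' w) * (\<Sum>p\<in>perms n. irr_char n w p * irr_char n v p))"
          by (subst sum.swap) (simp add: sum_distrib_left)
        finally have "(of_nat (?d v) :: complex) = (\<Sum>w\<in>partitions n. of_nat (c' w) *
            ((\<Sum>p\<in>perms n. irr_char n w p * irr_char n v p) / of_nat (fact n)))"
          unfolding d[OF True] by (simp only:, subst sum_divide_distrib, simp)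
        also have "\<dots> = (\<Sum>w\<in>partitions n. if w = v then of_nat (c' v) else 0)"
          by (rule sum.cong) (simp_all only: irr_char_orthogonal[OF _ True], simp)
        also have "\<dots> = of_nat (c' v)" using True finite_partitions by simp
        finally show ?thesis using True by (simp add: c_def)
      qed (use c' in \<open>simp add: c_def\<close>)
    qed
  qed
  then show ?thesis using v by (simp add: kronecker_def c_def)
qed

theorem theoremC:
  fixes k n :: nat
  assumes "k \<ge> 1" and "n = k * (k + 1) div 2"
    and "CHAR('k::field) = 2"
  shows "(\<forall>m \<alpha> \<beta>. carter_saxl_pair TYPE('k) n m \<alpha> \<beta> \<longrightarrow>
            kronecker n (staircase k) (staircase k) \<alpha> \<ge> m) \<and>
         (\<forall>j a b. num_parts (row_part a) + col_part b 0 \<le> j + 1 \<longrightarrow>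
            staircase_frame j (row_part a) (col_part b) \<in> partitions n \<longrightarrow>
            kronecker n (staircase k) (staircase k)
              (staircase_frame j (row_part a) (col_part b)) > 0)"
proof -
  interpret staircase_char_two "TYPE('k)" k n "staircase k"
    by unfold_locales (use assms in auto)
  let ?\<rho> = "staircase k"
  \<comment> \<open>From here on, both claims only ask for a lower bound of the dimension in
    characteristic two.\<close>
  have le: "fun_vs.dim (orbit_space n (specht n ?\<rho>) (specht n ?\<rho>) (specht n \<alpha>) :: (_ \<Rightarrow> 'k) set) \<le>
      kronecker n ?\<rho> ?\<rho> \<alpha>" if "\<alpha> \<in> partitions n" for \<alpha>
    unfolding kronecker_eq_dim[OF \<rho>_part \<rho>_part that] by (rule dim_orbit_space_le[OF \<rho>_part \<rho>_part that])
  show ?thesis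
  proof (intro conjI allI impI)
    fix m \<alpha> \<beta> assume "carter_saxl_pair TYPE('k) n m \<alpha> \<beta>"
    then have \<alpha>: "\<alpha> \<in> partitions n" and \<beta>: "\<beta> \<in> partitions n" "carter \<beta>"
      and m: "decomposition_number TYPE('k) n \<alpha> \<beta> = m"
      by (auto simp: carter_saxl_pair_def)
    show "m \<le> kronecker n ?\<rho> ?\<rho> \<alpha>"
      using decomposition_number_le_dim[OF \<alpha> \<beta>] le[OF \<alpha>] m by simp
  next
    fix j a b
    let ?\<alpha> = "staircase_frame j (row_part a) (col_part b)"
    assume \<alpha>: "?\<alpha> \<in> partitions n"
    obtain v1 v2 x where v: "v1 \<in> specht n ?\<rho>" "v2 \<in> specht n ?\<rho>" "x \<in> specht n ?\<alpha>"
      and nz: "orbit_sum n v1 v2 x \<noteq> (0 :: _ \<Rightarrow> 'k)"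
      using frame_orbit_sum_nonzero[OF refl \<alpha>] by blast
    have "0 < fun_vs.dim (orbit_space n (specht n ?\<rho>) (specht n ?\<rho>) (specht n ?\<alpha>) :: (_ \<Rightarrow> 'k) set)"
    proof (rule dim_positive)
      show "finite (tabloids n ?\<rho> \<times> tabloids n ?\<rho> \<times> tabloids n ?\<alpha>)"
        using finite_tabloids \<rho>_part \<alpha> by blast
      show "orbit_space n (specht n ?\<rho>) (specht n ?\<rho>) (specht n ?\<alpha>) \<subseteq>
          (supported (tabloids n ?\<rho> \<times> tabloids n ?\<rho> \<times> tabloids n ?\<alpha>) :: (_ \<Rightarrow> 'k) set)"
        by (rule orbit_space_supported) (rule specht_supported)+
      show "orbit_sum n v1 v2 x \<in> orbit_space n (specht n ?\<rho>) (specht n ?\<rho>) (specht n ?\<alpha>)"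
        using v by (rule orbit_sum_in_orbit_space)
    qed (rule nz)
    then show "0 < kronecker n ?\<rho> ?\<rho> ?\<alpha>" using le[OF \<alpha>] by simp
  qed
qed

end
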